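(* Let $m\ge1$ be an integer, $s>m/2$, and let $L_B$ be a self-adjoint operator on $H_B$ with $L_B\ge\ell_BI$ for some $\ell_B>0$. Consider the reduced multiplier $$T_{m,s}(L_B)=\int_{\mathbb{R}^m}\frac{d^mq}{(2\pi)^m}(L_B+|q|^2)^{-s}=\frac{1}{(4\pi)^{m/2}}\frac{\Gamma(s-m/2)}{\Gamma(s)}\,L_B^{m/2-s},$$ that is, the function $\lambda\mapsto \frac{1}{(4\pi)^{m/2}}\frac{\Gamma(s-m/2)}{\Gamma(s)}\lambda^{m/2-s}$ of $\lambda>0$ applied to $L_B$. The Green power $L_B^{-1}$ is obtained (i.e. $\lambda^{m/2-s}=\lambda^{-1}$ as functions of $\lambda>0$) exactly at $$s=s_\ast(m):=1+\frac m2 .$$ At this exponent, $$T_{m,s_\ast}(L_B)=\frac{1}{(4\pi)^{m/2}\,\Gamma(1+m/2)}\,L_B^{-1}.$$ In codimension three ($m=3$), $$s_\ast(3)=\frac52,\qquad T_{3,5/2}(L_B)=\frac{1}{6\pi^2}\,L_B^{-1}.$$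
   Context: $H_B=L^2(B,d\mu_B)$ with $B$ a three-dimensional Riemannian manifold or compactified three-dimensional region. The integral defining $T_{m,s}(L_B)$ is an operator-norm Bochner integral, and powers of $L_B$ are defined by the spectral theorem. *)

theory Defs
  imports "HOL-Analysis.Analysis"
begin

section \<open>Complex Hilbert spaces\<close>

text \<open>
  The inner product is conjugate-linear in its first argument.  Its real part is the library's real
  inner product, so that norm, topology and the Banach space \<^typ>\<open>'a \<Rightarrow>\<^sub>L 'a\<close> of bounded operators
  with the operator norm are those of the library.
\<close>

class complex_hilbert = real_inner + complete_space +
  fixes scaleC :: "complex \<Rightarrow> 'a \<Rightarrow> 'a"
    and cinner :: "'a \<Rightarrow> 'a \<Rightarrow> complex"
  assumes scaleC_add_right: "scaleC c (x + y) = scaleC c x + scaleC c y"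
    and scaleC_add_left: "scaleC (c + d) x = scaleC c x + scaleC d x"
    and scaleC_scaleC: "scaleC c (scaleC d x) = scaleC (c * d) x"
    and scaleC_of_real: "scaleC (complex_of_real r) x = r *\<^sub>R x"
    and cinner_commute: "cinner x y = cnj (cinner y x)"
    and cinner_add_right: "cinner x (y + z) = cinner x y + cinner x z"
    and cinner_scaleC_right: "cinner x (scaleC c y) = c * cinner x y"
    and Re_cinner: "Re (cinner x y) = inner x y"

definition square_integrable :: "'b measure \<Rightarrow> ('b \<Rightarrow> complex) set" where
  "square_integrable M = {f \<in> borel_measurable M. integrable M (\<lambda>x. (cmod (f x))\<^sup>2)}"

text \<open>
  The space \<open>L\<^sup>2(M)\<close> depends on the measure \<open>M\<close> and hence is not a type.  Instead, \<open>L2_space M cls\<close>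
  says that the Hilbert space \<open>'h\<close> is \<open>L\<^sup>2(M)\<close>, where \<open>cls f\<close> is the class of the square-integrable
  function \<open>f\<close>.  Two functions have the same class iff they agree almost everywhere: this follows
  from the linearity and the formula for the inner product.
\<close>

definition L2_space :: "'b measure \<Rightarrow> (('b \<Rightarrow> complex) \<Rightarrow> 'h::complex_hilbert) \<Rightarrow> bool" where
  "L2_space M cls \<longleftrightarrow>
     cls ` square_integrable M = UNIV \<and>
     (\<forall>f\<in>square_integrable M. \<forall>g\<in>square_integrable M.
        cls (\<lambda>x. f x + g x) = cls f + cls g \<and>
        cinner (cls f) (cls g) = (\<integral>x. cnj (f x) * g x \<partial>M)) \<and>
     (\<forall>c. \<forall>f\<in>square_integrable M. cls (\<lambda>x. c * f x) = scaleC c (cls f))"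


section \<open>Unbounded operators\<close>

text \<open>An unbounded operator is a partial function; its domain is \<^term>\<open>dom L\<close>.\<close>

type_synonym 'h unb_op = "'h \<Rightarrow> 'h option"

abbreviation app :: "'h unb_op \<Rightarrow> 'h \<Rightarrow> 'h" where
  "app L x \<equiv> the (L x)"

definition linear_op :: "('h::complex_hilbert) unb_op \<Rightarrow> bool" where
  "linear_op L \<longleftrightarrow>
     0 \<in> dom L \<and>
     (\<forall>x\<in>dom L. \<forall>y\<in>dom L. x + y \<in> dom L \<and> app L (x + y) = app L x + app L y) \<and>
     (\<forall>c. \<forall>x\<in>dom L. scaleC c x \<in> dom L \<and> app L (scaleC c x) = scaleC c (app L x))"

text \<open>The vector \<open>z\<close> in the definition of the adjoint is unique if \<^term>\<open>dom L\<close> is dense.\<close>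

definition adjoint_op :: "('h::complex_hilbert) unb_op \<Rightarrow> 'h unb_op" where
  "adjoint_op L = (\<lambda>y.
     if \<exists>z. \<forall>x\<in>dom L. cinner y (app L x) = cinner z x
     then Some (THE z. \<forall>x\<in>dom L. cinner y (app L x) = cinner z x)
     else None)"

definition self_adjoint_op :: "('h::complex_hilbert) unb_op \<Rightarrow> bool" where
  "self_adjoint_op L \<longleftrightarrow> linear_op L \<and> closure (dom L) = UNIV \<and> adjoint_op L = L"

definition bounded_below_op :: "real \<Rightarrow> ('h::complex_hilbert) unb_op \<Rightarrow> bool" where
  "bounded_below_op l L \<longleftrightarrow> (\<forall>x\<in>dom L. l * Re (cinner x x) \<le> Re (cinner x (app L x)))"

text \<open>The operator \<open>L + c I\<close>, with the domain of \<open>L\<close>.\<close>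

definition shift_op :: "('h::complex_hilbert) unb_op \<Rightarrow> real \<Rightarrow> 'h unb_op" where
  "shift_op L c = (\<lambda>x. map_option (\<lambda>y. y + c *\<^sub>R x) (L x))"

text \<open>An everywhere defined bounded operator as an element of the Banach space of bounded operators.\<close>

definition bounded_op :: "('h::complex_hilbert) unb_op \<Rightarrow> 'h \<Rightarrow>\<^sub>L 'h" where
  "bounded_op T = (THE B. \<forall>x. T x = Some (blinfun_apply B x))"


section \<open>Borel functional calculus\<close>

text \<open>
  Projection-valued measures on the Borel sets of the real line.  The requirement on non-Borel sets
  only fixes the junk values of \<open>E\<close>, so that the spectral measure of an operator is unique.
  Complex linearity of \<open>E A\<close> follows from its symmetry.
\<close>

definition projection_valued_measure ::
    "(real set \<Rightarrow> ('h::complex_hilbert) \<Rightarrow>\<^sub>L 'h) \<Rightarrow> bool" where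
  "projection_valued_measure E \<longleftrightarrow>
     (\<forall>A. A \<notin> sets borel \<longrightarrow> E A = 0) \<and>
     (\<forall>A\<in>sets borel. E A o\<^sub>L E A = E A \<and> (\<forall>x y. cinner (E A x) y = cinner x (E A y))) \<and>
     E UNIV = id_blinfun \<and>
     (\<forall>A\<in>sets borel. \<forall>B\<in>sets borel. E (A \<inter> B) = E A o\<^sub>L E B) \<and>
     (\<forall>A :: nat \<Rightarrow> real set. range A \<subseteq> sets borel \<longrightarrow> disjoint_family A \<longrightarrow>
        (\<forall>x. (\<lambda>n. E (A n) x) sums E (\<Union>n. A n) x))"

text \<open>The finite positive measure \<open>A \<mapsto> \<langle>x, E(A) x\<rangle>\<close>.\<close>

definition scalar_measure ::
    "(real set \<Rightarrow> ('h::complex_hilbert) \<Rightarrow>\<^sub>L 'h) \<Rightarrow> 'h \<Rightarrow> real measure" where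
  "scalar_measure E x =
     measure_of UNIV (sets borel) (\<lambda>A. ennreal (Re (cinner x (E A x))))"

text \<open>
  \<open>T = \<integral> f dE\<close> for a real Borel function \<open>f\<close>.  By polarization, the quadratic form on the domain
  determines the linear operator \<open>T\<close>.
\<close>

definition is_spectral_integral ::
    "(real set \<Rightarrow> ('h::complex_hilbert) \<Rightarrow>\<^sub>L 'h) \<Rightarrow> (real \<Rightarrow> real) \<Rightarrow> 'h unb_op \<Rightarrow> bool" where
  "is_spectral_integral E f T \<longleftrightarrow>
     linear_op T \<and>
     dom T = {x. (\<integral>\<^sup>+t. ennreal ((f t)\<^sup>2) \<partial>scalar_measure E x) < \<infinity>} \<and>
     (\<forall>x\<in>dom T. cinner x (app T x) = complex_of_real (\<integral>t. f t \<partial>scalar_measure E x))"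

definition spectral_measure ::
    "('h::complex_hilbert) unb_op \<Rightarrow> real set \<Rightarrow> 'h \<Rightarrow>\<^sub>L 'h" where
  "spectral_measure L =
     (THE E. projection_valued_measure E \<and> is_spectral_integral E (\<lambda>t. t) L)"

definition fun_calc :: "(real \<Rightarrow> real) \<Rightarrow> ('h::complex_hilbert) unb_op \<Rightarrow> 'h unb_op" where
  "fun_calc f L = (THE T. is_spectral_integral (spectral_measure L) f T)"

text \<open>
  Only used for \<open>L \<ge> l I\<close> with \<open>l > 0\<close>: the values of \<open>t powr a\<close> for \<open>t \<le> 0\<close> do not matter.
\<close>

definition op_powr :: "('h::complex_hilbert) unb_op \<Rightarrow> real \<Rightarrow> 'h unb_op" where
  "op_powr L a = fun_calc (\<lambda>t. t powr a) L"


section \<open>Bochner integral in an arbitrary normed space\<close>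

text \<open>
  This is the definition of \<open>has_bochner_integral\<close> in the library, without the restriction to second
  countable target spaces, which the space of bounded operators with the operator norm does not
  satisfy.
\<close>

definition has_strong_bochner_integral ::
    "'a measure \<Rightarrow> ('a \<Rightarrow> 'b::real_normed_vector) \<Rightarrow> 'b \<Rightarrow> bool" where
  "has_strong_bochner_integral M f I \<longleftrightarrow>
     f \<in> borel_measurable M \<and>
     (\<exists>s. (\<forall>i. Bochner_Integration.simple_bochner_integrable M (s i)) \<and>
          (\<lambda>i::nat. \<integral>\<^sup>+x. ennreal (norm (f x - s i x)) \<partial>M) \<longlonglongrightarrow> 0 \<and>
          (\<lambda>i. Bochner_Integration.simple_bochner_integral M (s i)) \<longlonglongrightarrow> I)"

definition strong_bochner_integrable ::
    "'a measure \<Rightarrow> ('a \<Rightarrow> 'b::real_normed_vector) \<Rightarrow> bool" where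
  "strong_bochner_integrable M f \<longleftrightarrow> (\<exists>I. has_strong_bochner_integral M f I)"

definition strong_bochner_integral ::
    "'a measure \<Rightarrow> ('a \<Rightarrow> 'b::real_normed_vector) \<Rightarrow> 'b" where
  "strong_bochner_integral M f = (THE I. has_strong_bochner_integral M f I)"


section \<open>The reduced multiplier\<close>

text \<open>
  Lebesgue measure on \<open>\<real>\<^sup>m\<close>.  Since \<open>m\<close> is a number, points are functions on \<open>{..<m}\<close>
  (with value \<^const>\<open>undefined\<close> elsewhere).
\<close>

definition lebesgue_Rn :: "nat \<Rightarrow> (nat \<Rightarrow> real) measure" where
  "lebesgue_Rn m = (\<Pi>\<^sub>M i\<in>{..<m}. lborel)"

definition norm_sq :: "nat \<Rightarrow> (nat \<Rightarrow> real) \<Rightarrow> real" where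
  "norm_sq m q = (\<Sum>i<m. (q i)\<^sup>2)"

definition multiplier_integrand ::
    "nat \<Rightarrow> real \<Rightarrow> ('h::complex_hilbert) unb_op \<Rightarrow> (nat \<Rightarrow> real) \<Rightarrow> 'h \<Rightarrow>\<^sub>L 'h" where
  "multiplier_integrand m s L q = bounded_op (op_powr (shift_op L (norm_sq m q)) (- s))"

definition reduced_multiplier ::
    "nat \<Rightarrow> real \<Rightarrow> ('h::complex_hilbert) unb_op \<Rightarrow> 'h \<Rightarrow>\<^sub>L 'h" where
  "reduced_multiplier m s L =
     (1 / (2 * pi) ^ m) *\<^sub>R strong_bochner_integral (lebesgue_Rn m) (multiplier_integrand m s L)"

definition multiplier_const :: "nat \<Rightarrow> real \<Rightarrow> real" where
  "multiplier_const m s =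
     1 / (4 * pi) powr (real m / 2) * (Gamma (s - real m / 2) / Gamma s)"

definition s_star :: "nat \<Rightarrow> real" where
  "s_star m = 1 + real m / 2"

end

theory Submission
  imports Defs "HOL-Probability.Probability"
begin

text \<open>
  For a number \<open>\<lambda> > 0\<close> the formula
  \<open>\<integral> (\<lambda> + |q|\<^sup>2)\<^sup>-\<^sup>s dq = \<pi>\<^sup>m\<^sup>/\<^sup>2 \<Gamma>(s - m/2) / \<Gamma>(s) \<lambda>\<^sup>m\<^sup>/\<^sup>2\<^sup>-\<^sup>s\<close>
  follows from the Gamma integral for \<open>(\<lambda> + |q|\<^sup>2)\<^sup>-\<^sup>s\<close> and a Gaussian integral
  (\<open>multiplier_scalar_integral\<close>). The spectral theorem carries it over to \<open>L\<close>: there is exactly one projection-valued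
  measure \<open>E\<close> with \<open>L = \<integral> \<lambda> dE\<close>, the operators \<open>(L + |q|\<^sup>2)\<^sup>-\<^sup>s\<close> are the functions \<open>(\<lambda> + |q|\<^sup>2)\<^sup>-\<^sup>s\<close> of \<open>L\<close>
  (\<open>fun_calc_shift\<close>), and the integral over \<open>q\<close> can be interchanged with the integral over the finite measure
  \<open>\<langle>x, E(\<cdot>) x\<rangle>\<close> (\<open>integrand_integral\<close>). The lower bound \<open>l > 0\<close> makes the integrand norm-continuous in \<open>q\<close>
  and dominated by an integrable function, so that it is Bochner integrable in operator norm
  (\<open>integrand_integrable\<close>).

  Since powers of \<open>L\<close> are defined through its spectral measure, existence and uniqueness of this measure are the main
  work. Both are reduced to the bounded operator \<open>G = l L\<^sup>-\<^sup>1\<close>, for which \<open>0 \<le> G \<le> 1\<close>, and to the moment problem on the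
  unit interval. Existence: positivity of \<open>G\<^sup>a (1 - G)\<^sup>b\<close> says that \<open>\<langle>x, G\<^sup>j x\<rangle>\<close> is a completely monotone sequence
  in \<open>j\<close>, hence the moment sequence of a measure \<open>\<mu>\<^sub>x\<close> (\<open>hausdorff_moment\<close>). A measure is determined by its moments,
  so that every algebraic property of the numbers \<open>\<langle>x, G\<^sup>j y\<rangle>\<close> is inherited by the measures: \<open>\<mu>\<^sub>x(B)\<close> is a
  quadratic form in \<open>x\<close>, the operators \<open>E(B)\<close> of these forms are commuting projections, and so on
  (\<open>unit_operator_spectral\<close>). The substitution \<open>t \<mapsto> l / t\<close> then yields the measure of \<open>L\<close>
  (\<open>spectral_pair_exists\<close>). Uniqueness: any spectral measure of \<open>L\<close> yields the moments \<open>\<langle>x, G\<^sup>j x\<rangle>\<close>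
  (\<open>spectral_measure_unique\<close>).
\<close>

section \<open>Complex Hilbert spaces\<close>

instance complex_hilbert \<subseteq> banach ..

lemma cinner_add_left: "cinner (x + y) z = cinner x z + cinner y z"
  using cinner_commute[of "x + y" z] cinner_commute[of x z] cinner_commute[of y z]
  by (simp add: cinner_add_right)

lemma cinner_zero_right [simp]: "cinner x 0 = 0"
  using cinner_add_right[of x 0 0] by simp

lemma cinner_zero_left [simp]: "cinner 0 x = 0"
  using cinner_add_left[of 0 0 x] by simp

lemma cinner_minus_right: "cinner x (- y) = - cinner x y"
  using cinner_add_right[of x y "- y"] by (simp add: eq_neg_iff_add_eq_0 add.commute)

lemma cinner_diff_right: "cinner x (y - z) = cinner x y - cinner x z"
  using cinner_add_right[of x y "- z"] by (simp add: cinner_minus_right)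

lemma cinner_scaleC_left: "cinner (scaleC c x) y = cnj c * cinner x y"
  using cinner_commute[of "scaleC c x" y] cinner_commute[of x y] by (simp add: cinner_scaleC_right)

lemma cinner_self: "cinner x x = complex_of_real (inner x x)"
proof -
  have "cnj (cinner x x) = cinner x x"
    using cinner_commute[of x x] by simp
  then have "Im (cinner x x) = 0"
    by (simp add: complex_eq_iff)
  then show ?thesis
    by (simp add: complex_eq_iff Re_cinner)
qed

lemma Im_cinner: "Im (cinner x y) = - inner x (scaleC \<i> y)"
proof -
  have "inner x (scaleC \<i> y) = Re (\<i> * cinner x y)"
    by (simp only: Re_cinner flip: cinner_scaleC_right)
  then show ?thesis by simp
qed

lemma cinner_eqI: "(\<And>y. cinner y x = cinner y z) \<Longrightarrow> x = z"
  by (simp add: vector_eq_ldot[of x z, symmetric] flip: Re_cinner)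

lemma inner_scaleC_ii: "inner (scaleC \<i> x) (scaleC \<i> y) = inner x y"
proof -
  have "cinner (scaleC \<i> x) (scaleC \<i> y) = cinner x y"
    by (simp add: cinner_scaleC_left cinner_scaleC_right mult.assoc[symmetric])
  then have "Re (cinner (scaleC \<i> x) (scaleC \<i> y)) = Re (cinner x y)" by (rule arg_cong)
  then show ?thesis by (simp only: Re_cinner)
qed

lemma scaleC_ii_ii: "scaleC \<i> (scaleC \<i> x) = - x"
  using scaleC_of_real[of "-1" x] by (simp add: scaleC_scaleC)

lemma scaleC_conv: "scaleC c x = Re c *\<^sub>R x + Im c *\<^sub>R scaleC \<i> x"
proof -
  have "scaleC c x = scaleC (complex_of_real (Re c) + complex_of_real (Im c) * \<i>) x"
    by (metis complex_eq mult.commute)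
  also have "\<dots> = Re c *\<^sub>R x + Im c *\<^sub>R scaleC \<i> x"
    by (simp add: scaleC_add_left scaleC_of_real flip: scaleC_scaleC)
  finally show ?thesis .
qed

lemma scaleC_zero [simp]: "scaleC c 0 = 0"
  using scaleC_add_right[of c 0 0] by simp

lemma scaleC_minus: "scaleC c (- x) = - scaleC c x"
  using scaleC_add_right[of c x "- x"] by (simp add: eq_neg_iff_add_eq_0 add.commute)

lemma scaleC_diff_right: "scaleC c (x - y) = scaleC c x - scaleC c y"
  using scaleC_add_right[of c x "- y"] by (simp add: scaleC_minus)

text \<open>
  Polarization on a complex subspace: replacing \<open>y\<close> by \<open>i y\<close> in \<open>b(x, y) + b(y, x) = 0\<close> changes the sign of
  one summand only. It is used for the inverse of \<open>L\<close> and for the uniqueness of functions of \<open>L\<close>.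
\<close>

lemma sesquilinear_zero:
  assumes "\<And>x y. x \<in> D \<Longrightarrow> y \<in> D \<Longrightarrow> x + y \<in> D"
    and "\<And>c x. x \<in> D \<Longrightarrow> scaleC c x \<in> D"
    and addl: "\<And>x y z. x \<in> D \<Longrightarrow> y \<in> D \<Longrightarrow> z \<in> D \<Longrightarrow> b (x + y) z = (b x z + b y z :: complex)"
    and addr: "\<And>x y z. x \<in> D \<Longrightarrow> y \<in> D \<Longrightarrow> z \<in> D \<Longrightarrow> b z (x + y) = b z x + b z y"
    and scl: "\<And>c x z. x \<in> D \<Longrightarrow> z \<in> D \<Longrightarrow> b (scaleC c x) z = cnj c * b x z"
    and scr: "\<And>c x z. x \<in> D \<Longrightarrow> z \<in> D \<Longrightarrow> b z (scaleC c x) = c * b z x"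
    and diag: "\<And>x. x \<in> D \<Longrightarrow> b x x = 0"
    and x: "x \<in> D" and y: "y \<in> D"
  shows "b x y = 0"
proof -
  have 1: "b x z + b z x = 0" if "z \<in> D" for z
  proof -
    have "b (x + z) (x + z) = b x x + b z x + (b x z + b z z)"
      using that x assms(1) by (simp add: addl addr)
    then show ?thesis using diag[OF x] diag[OF that] diag[OF assms(1)[OF x that]] by (simp add: add.commute)
  qed
  have "b x (scaleC \<i> y) + b (scaleC \<i> y) x = 0"
    using 1 assms(2) y by blast
  then have "\<i> * (b x y - b y x) = 0"
    using x y by (simp add: scl scr algebra_simps)
  with 1[OF y] show ?thesis by simp
qed

lemma one_over_Suc_tendsto: "(\<lambda>n. 1 / (real n + 1)) \<longlonglongrightarrow> 0"
  using LIMSEQ_inverse_real_of_nat by (simp add: inverse_eq_divide add.commute)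

lemma convergent_if_tails_bounded:
  fixes z :: "nat \<Rightarrow> 'a::banach"
  assumes r: "r \<longlonglongrightarrow> (0::real)" and le: "\<And>m n N. N \<le> m \<Longrightarrow> N \<le> n \<Longrightarrow> norm (z m - z n) \<le> r N"
  obtains z' where "z \<longlonglongrightarrow> z'"
proof -
  have "Cauchy z"
  proof (rule CauchyI)
    fix e :: real assume "e > 0"
    then have "eventually (\<lambda>n. r n < e) sequentially" by (rule order_tendstoD(2)[OF r])
    then obtain N where "r N < e" by (auto simp: eventually_sequentially)
    then have "norm (z m - z n) < e" if "m \<ge> N" "n \<ge> N" for m n
      using le[OF that] by linarith
    then show "\<exists>N. \<forall>m\<ge>N. \<forall>n\<ge>N. norm (z m - z n) < e" by blast
  qed
  then show ?thesis using that Cauchy_convergent_iff convergent_def by blast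
qed

lemma inner_le_zero_iff: "inner x x \<le> 0 \<longleftrightarrow> x = (0::'a::real_inner)"
  using inner_gt_zero_iff[of x] by (auto simp: not_le[symmetric])

section \<open>Symmetric operators and the Riesz representation theorem\<close>

text \<open>
  Symmetry for the real inner product. Together with commutation with \<open>i\<close> it gives symmetry for the
  complex inner product, so that most arguments can stay in the real Hilbert space.
\<close>

definition symmetric_op :: "('a::real_inner \<Rightarrow>\<^sub>L 'a) \<Rightarrow> bool" where
  "symmetric_op T \<longleftrightarrow> (\<forall>x y. inner (T x) y = inner x (T y))"

lemma symmetric_opD: "symmetric_op T \<Longrightarrow> inner (T x) y = inner x (T y)"
  by (simp add: symmetric_op_def)

lemma symmetric_op_add: "symmetric_op T \<Longrightarrow> symmetric_op S \<Longrightarrow> symmetric_op (T + S)"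
  by (simp add: symmetric_op_def blinfun.bilinear_simps inner_simps)

lemma symmetric_op_diff: "symmetric_op T \<Longrightarrow> symmetric_op S \<Longrightarrow> symmetric_op (T - S)"
  by (simp add: symmetric_op_def blinfun.bilinear_simps inner_simps)

lemma symmetric_op_scaleR: "symmetric_op T \<Longrightarrow> symmetric_op (c *\<^sub>R T)"
  by (simp add: symmetric_op_def blinfun.bilinear_simps)

lemma symmetric_op_polarization:
  assumes "symmetric_op T"
  shows "4 * inner x (T y) = inner (x + y) (T (x + y)) - inner (x - y) (T (x - y))"
  using symmetric_opD[OF assms, of x y]
  by (simp add: blinfun.bilinear_simps inner_simps inner_commute)

lemma symmetric_op_eqI:
  assumes T: "symmetric_op T" and S: "symmetric_op S"
    and eq: "\<And>x. inner x (T x) = inner x (S x)"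
  shows "T = S"
proof (rule blinfun_eqI)
  fix y
  have "inner x (T y) = inner x (S y)" for x
    using symmetric_op_polarization[OF T, of x y] symmetric_op_polarization[OF S, of x y] eq by simp
  then show "T y = S y"
    using vector_eq_ldot by blast
qed

text \<open>
  The polarization identity bounds \<open>\<langle>y, T x\<rangle>\<close> by values of the quadratic form; it is used for
  \<open>y = T x\<close> rescaled to the length of \<open>x\<close>.
\<close>

lemma symmetric_op_norm_le:
  assumes T: "symmetric_op T" and c: "0 \<le> c"
    and le: "\<And>x. \<bar>inner x (T x)\<bar> \<le> c * inner x x"
  shows "norm T \<le> c"
proof (rule norm_blinfun_bound[OF c])
  fix x
  show "norm (T x) \<le> c * norm x"
  proof (cases "T x = 0")
    case False
    define y where "y = (norm x / norm (T x)) *\<^sub>R T x"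
    have ny: "norm y = norm x" using False by (simp add: y_def)
    have "4 * (norm x * norm (T x)) = 4 * inner y (T x)"
      using False by (simp add: y_def power2_norm_eq_inner[symmetric] power2_eq_square)
    also have "\<dots> = inner (y + x) (T (y + x)) - inner (y - x) (T (y - x))"
      by (rule symmetric_op_polarization[OF T])
    also have "\<dots> \<le> c * inner (y + x) (y + x) + c * inner (y - x) (y - x)"
      using le[of "y + x"] le[of "y - x"] by linarith
    also have "\<dots> = c * (2 * (norm y)\<^sup>2 + 2 * (norm x)\<^sup>2)"
      by (simp add: power2_norm_eq_inner inner_simps inner_commute algebra_simps)
    also have "\<dots> = 4 * (norm x * (c * norm x))"
      by (simp add: ny power2_eq_square)
    finally have *: "norm x * norm (T x) \<le> norm x * (c * norm x)"
      by simp
    have "x \<noteq> 0" using False by (auto simp: blinfun.bilinear_simps)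
    with * show ?thesis by simp
  qed (simp add: c)
qed

text \<open>
  The vector is the minimizer of \<open>|x|\<^sup>2 / 2 - f x\<close> on \<open>S\<close>: the derivative in every direction of \<open>S\<close>
  vanishes there. For \<open>S = UNIV\<close> this is the representation theorem, and for \<open>f = \<langle>w, \<cdot>\<rangle>\<close> it is the
  orthogonal projection of \<open>w\<close> onto \<open>S\<close>.
\<close>

lemma riesz_on_subspace:
  fixes S :: "'a::{real_inner,banach} set" and f :: "'a \<Rightarrow> real"
  assumes S: "subspace S" "closed S" and f: "bounded_linear f"
  shows "\<exists>x\<in>S. \<forall>y\<in>S. inner x y = f y"
proof -
  interpret f: bounded_linear f by fact
  define q where "q x = inner x x / 2 - f x" for x
  obtain K where K: "\<And>x. \<bar>f x\<bar> \<le> norm x * K"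
    using f.bounded by (auto simp: real_norm_def)
  have below: "- K\<^sup>2 / 2 \<le> q x" for x
  proof -
    have "0 \<le> (norm x - K)\<^sup>2" by simp
    then have "norm x * K \<le> (norm x)\<^sup>2 / 2 + K\<^sup>2 / 2"
      by (simp add: power2_eq_square algebra_simps)
    then show ?thesis using K[of x] by (simp add: q_def power2_norm_eq_inner)
  qed
  define d where "d = Inf (q ` S)"
  have bb: "bdd_below (q ` S)"
    using below by (auto intro!: bdd_belowI)
  have ne: "q ` S \<noteq> {}" using subspace_0[OF S(1)] by auto
  have d_le: "d \<le> q x" if "x \<in> S" for x
    unfolding d_def using bb that by (simp add: cINF_lower)
  have "\<exists>x\<in>S. q x < d + 1 / (real n + 1)" for n
    using cInf_less_iff[OF ne bb, of "d + 1 / (real n + 1)"] by (auto simp: d_def)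
  then obtain u where uS: "\<And>n. u n \<in> S" and u: "\<And>n. q (u n) < d + 1 / (real n + 1)"
    by metis
  \<comment> \<open>the parallelogram identity makes every minimizing sequence a Cauchy sequence\<close>
  have par: "inner (x - y) (x - y) = 4 * (q x + q y - 2 * q ((1/2) *\<^sub>R (x + y)))" for x y
    by (simp add: q_def inner_simps f.add f.scaleR inner_commute algebra_simps)
  have dist: "(norm (u n - u m))\<^sup>2 \<le> 4 * (1 / (real n + 1) + 1 / (real m + 1))" for n m
  proof -
    have "(1/2) *\<^sub>R (u n + u m) \<in> S"
      using S(1) uS by (simp add: subspace_add subspace_scale)
    from d_le[OF this] show ?thesis
      using u[of n] u[of m] par[of "u n" "u m"] by (simp add: power2_norm_eq_inner)
  qed
  obtain x where x: "u \<longlonglongrightarrow> x"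
  proof (rule convergent_if_tails_bounded)
    have "(\<lambda>N. sqrt (8 * (1 / (real N + 1)))) \<longlonglongrightarrow> sqrt (8 * 0)"
      by (intro tendsto_real_sqrt tendsto_mult tendsto_const one_over_Suc_tendsto)
    then show "(\<lambda>N. sqrt (8 * (1 / (real N + 1)))) \<longlonglongrightarrow> 0" by simp
    fix m n N :: nat assume mn: "N \<le> m" "N \<le> n"
    have "1 / (real k + 1) \<le> 1 / (real N + 1)" if "N \<le> k" for k
      using that by (intro divide_left_mono) auto
    from this[OF mn(1)] this[OF mn(2)] have "(norm (u m - u n))\<^sup>2 \<le> 8 * (1 / (real N + 1))"
      using dist[of m n] by simp
    then show "norm (u m - u n) \<le> sqrt (8 * (1 / (real N + 1)))" by (rule real_le_rsqrt)
  qed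
  have xS: "x \<in> S" using closed_sequentially[OF S(2) uS x] .
  have "(\<lambda>n. q (u n)) \<longlonglongrightarrow> q x"
    unfolding q_def by (intro tendsto_intros x f.tendsto) auto
  moreover have "(\<lambda>n. d + 1 / (real n + 1)) \<longlonglongrightarrow> d + 0"
    by (intro tendsto_add tendsto_const one_over_Suc_tendsto)
  ultimately have qx: "q x \<le> d"
    using LIMSEQ_le[of "\<lambda>n. q (u n)" "q x" "\<lambda>n. d + 1 / (real n + 1)" d] less_imp_le[OF u] by auto
  have "inner x y = f y" if y: "y \<in> S" for y
  proof (rule ccontr)
    define a where "a = inner x y - f y"
    assume "inner x y \<noteq> f y"
    then have a: "a \<noteq> 0" by (simp add: a_def)
    have y0: "inner y y > 0"
      using a by (auto simp: a_def f.zero)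
    define t where "t = - a / inner y y"
    have "x + t *\<^sub>R y \<in> S" using S(1) xS y by (simp add: subspace_add subspace_scale)
    then have "q x \<le> q (x + t *\<^sub>R y)" using d_le qx by force
    also have "\<dots> = q x + t * a + t\<^sup>2 * inner y y / 2"
      by (simp add: q_def a_def inner_simps f.add f.scaleR inner_commute power2_eq_square field_simps)
    also have "\<dots> = q x - a\<^sup>2 / inner y y / 2"
      using y0 by (simp add: t_def power2_eq_square field_simps)
    finally show False using a y0 by (simp add: field_simps)
  qed
  then show ?thesis using xS by blast
qed

lemma exists_orthogonal_vector:
  fixes S :: "'a::{real_inner,banach} set"
  assumes S: "subspace S" "closed S" "S \<noteq> UNIV"
  shows "\<exists>z. z \<noteq> 0 \<and> (\<forall>y\<in>S. inner z y = 0)"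
proof -
  obtain w where w: "w \<notin> S" using S(3) by blast
  obtain x where "x \<in> S" "\<forall>y\<in>S. inner x y = inner w y"
    using riesz_on_subspace[OF S(1,2) bounded_linear_inner_right[of w]] by blast
  then show ?thesis using w by (intro exI[of _ "w - x"]) (auto simp: inner_simps)
qed

lemma bounded_form_operator:
  fixes b :: "'a::{real_inner,banach} \<Rightarrow> 'a \<Rightarrow> real"
  assumes b: "bounded_bilinear b"
  shows "\<exists>T :: 'a \<Rightarrow>\<^sub>L 'a. \<forall>x y. inner x (T y) = b x y"
proof -
  interpret b: bounded_bilinear b by fact
  have "\<exists>z. \<forall>x. inner z x = b x y" for y
    using riesz_on_subspace[OF subspace_UNIV closed_UNIV b.bounded_linear_left[of y]] by auto
  then obtain T where T: "\<And>x y. inner (T y) x = b x y" by metis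
  have eqI: "u = v" if "\<And>x. inner u x = inner v x" for u v :: 'a
    using that vector_eq_rdot by blast
  obtain K where K: "\<And>x y. norm (b x y) \<le> norm x * norm y * K" using b.bounded by blast
  have "bounded_linear T"
  proof (rule bounded_linear_intro)
    show "T (x + y) = T x + T y" for x y by (rule eqI) (simp add: T inner_simps b.add_right)
    show "T (r *\<^sub>R x) = r *\<^sub>R T x" for r x by (rule eqI) (simp add: T inner_simps b.scaleR_right)
    show "norm (T x) \<le> norm x * K" for x
    proof (cases "T x = 0")
      case True
      have "0 \<le> norm (b x x)" by simp
      also have "\<dots> \<le> norm x * (norm x * K)" using K[of x x] by (simp add: mult.assoc)
      finally show ?thesis using True
        by (cases "x = 0") (auto simp: zero_le_mult_iff)
    next
      case False
      have "norm (T x) * norm (T x) = inner (T x) (T x)"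
        by (simp add: power2_norm_eq_inner[symmetric] power2_eq_square)
      also have "\<dots> \<le> norm (T x) * (norm x * K)"
        using K[of "T x" x] by (simp add: T[symmetric] mult.assoc)
      finally show ?thesis using False by simp
    qed
  qed
  then have "inner x (Blinfun T y) = b x y" for x y
    using T[of y x] inner_commute[of x "T y"] by (simp add: bounded_linear_Blinfun_apply)
  then show ?thesis by blast
qed

lemma norm_le_zeroI: "(\<And>e. e > 0 \<Longrightarrow> norm (a - b) \<le> C * e) \<Longrightarrow> a = (b :: 'z::real_normed_vector)"
proof -
  assume *: "\<And>e. e > 0 \<Longrightarrow> norm (a - b) \<le> C * e"
  have "norm (a - b) \<le> 0"
  proof (rule field_le_epsilon)
    fix e :: real assume "e > 0"
    then have "norm (a - b) \<le> C * (e / (\<bar>C\<bar> + 1))" by (intro *) auto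
    also have "\<dots> = (C / (\<bar>C\<bar> + 1)) * e" by simp
    also have "\<dots> \<le> 1 * e" using \<open>e > 0\<close> by (intro mult_right_mono) (auto simp: divide_le_eq)
    finally show "norm (a - b) \<le> 0 + e" by simp
  qed
  then show ?thesis by simp
qed

section \<open>Bounded Borel functions\<close>

definition bborel :: "(real \<Rightarrow> real) set" where
  "bborel = {f \<in> borel_measurable borel. \<exists>c. \<forall>t. \<bar>f t\<bar> \<le> c}"

lemma bborelI: "f \<in> borel_measurable borel \<Longrightarrow> (\<And>t. \<bar>f t\<bar> \<le> c) \<Longrightarrow> f \<in> bborel"
  by (auto simp: bborel_def)

lemma bborel_measurable [measurable_dest]: "f \<in> bborel \<Longrightarrow> f \<in> borel_measurable borel"
  by (simp add: bborel_def)

lemma bborel_bound: "f \<in> bborel \<Longrightarrow> \<exists>c\<ge>0. \<forall>t. \<bar>f t\<bar> \<le> c"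
  by (auto simp: bborel_def) (meson abs_ge_zero order_trans)

lemma bborel_indicator [simp]: "A \<in> sets borel \<Longrightarrow> indicator A \<in> bborel"
  by (rule bborelI[where c=1]) (auto simp: indicator_def)

lemma bborel_lin:
  assumes "f \<in> bborel" "g \<in> bborel"
  shows "(\<lambda>t. a * f t + g t) \<in> bborel"
proof -
  obtain c d where "\<And>t. \<bar>f t\<bar> \<le> c" "\<And>t. \<bar>g t\<bar> \<le> d"
    using assms[THEN bborel_bound] by blast
  then have "\<bar>a * f t + g t\<bar> \<le> \<bar>a\<bar> * c + d" for t
    by (intro order_trans[OF abs_triangle_ineq] add_mono) (simp_all add: abs_mult mult_left_mono)
  then show ?thesis using assms by (intro bborelI) auto
qed

lemma bborel_mult:
  assumes "f \<in> bborel" "g \<in> bborel"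
  shows "(\<lambda>t. f t * g t) \<in> bborel"
proof -
  obtain c d where "\<And>t. \<bar>f t\<bar> \<le> c" "c \<ge> 0" "\<And>t. \<bar>g t\<bar> \<le> d"
    using assms[THEN bborel_bound] by blast
  then have "\<bar>f t * g t\<bar> \<le> c * d" for t
    by (simp add: abs_mult mult_mono)
  then show ?thesis using assms by (intro bborelI) auto
qed

lemma bborel_const [simp]: "(\<lambda>t. c) \<in> bborel"
  by (rule bborelI[where c="\<bar>c\<bar>"]) auto

lemma bborel_diff: "f \<in> bborel \<Longrightarrow> g \<in> bborel \<Longrightarrow> (\<lambda>t. f t - g t) \<in> bborel"
  using bborel_lin[of g f "-1"] by simp

text \<open>
  Rounding the values of a bounded function down to multiples of \<open>e\<close> gives a finite linear combination of
  indicators at distance at most \<open>e\<close>. So an identity for functions of an operator only has to be checked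
  on indicators and shown to survive uniform limits.
\<close>

lemma bborel_induct [consumes 1, case_names indicator lin uniform]:
  assumes f: "f \<in> bborel"
    and ind: "\<And>A. A \<in> sets borel \<Longrightarrow> P (indicator A)"
    and lin: "\<And>a f g. f \<in> bborel \<Longrightarrow> g \<in> bborel \<Longrightarrow> P f \<Longrightarrow> P g \<Longrightarrow> P (\<lambda>t. a * f t + g t)"
    and unif: "\<And>f. f \<in> bborel \<Longrightarrow> (\<And>e. e > 0 \<Longrightarrow> \<exists>g\<in>bborel. P g \<and> (\<forall>t. \<bar>f t - g t\<bar> \<le> e)) \<Longrightarrow> P f"
  shows "P f"
proof (rule unif[OF f])
  fix e :: real assume e: "e > 0"
  obtain c where c: "\<And>t. \<bar>f t\<bar> \<le> c" "c \<ge> 0" using bborel_bound[OF f] by blast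
  define N where "N = \<lceil>c / e\<rceil> + 1"
  define B where "B k = {t. \<lfloor>f t / e\<rfloor> = k}" for k
  have [measurable]: "f \<in> borel_measurable borel" using f by (simp add: bborel_def)
  have B: "B k \<in> sets borel" for k
  proof -
    have "B k = {t \<in> space borel. of_int k \<le> f t / e \<and> f t / e < of_int k + 1}"
      by (auto simp: B_def floor_eq_iff)
    then show ?thesis by simp
  qed
  have *: "(\<lambda>t. \<Sum>k\<in>K. (e * of_int k) * indicator (B k) t) \<in> bborel \<and>
        P (\<lambda>t. \<Sum>k\<in>K. (e * of_int k) * indicator (B k) t)" if "finite K" for K
    using that
  proof induction
    case empty
    have "P (indicator {})" by (rule ind) auto
    moreover have "(indicator {} :: real \<Rightarrow> real) = (\<lambda>t. 0)" by auto
    ultimately show ?case by simp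
  next
    case (insert k K)
    then show ?case
      unfolding sum.insert[OF insert(1,2)]
      using bborel_lin[OF bborel_indicator[OF B]] lin[OF bborel_indicator[OF B] _ ind[OF B]] by blast
  qed
  define g where "g t = (\<Sum>k\<in>{-N..N}. (e * of_int k) * indicator (B k) t)" for t
  have g: "g t = e * of_int \<lfloor>f t / e\<rfloor>" for t
  proof -
    have "\<bar>f t / e\<bar> \<le> c / e" using c e by (simp add: divide_right_mono)
    then have "\<lfloor>f t / e\<rfloor> \<in> {-N..N}" unfolding N_def by (simp, linarith)
    moreover have "g t = (\<Sum>k\<in>{-N..N}. if k = \<lfloor>f t / e\<rfloor> then e * of_int k else 0)"
      unfolding g_def by (rule sum.cong) (auto simp: B_def)
    ultimately show ?thesis by simp
  qed
  have "\<bar>f t - g t\<bar> \<le> e" for t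
  proof -
    have "\<bar>f t / e - of_int \<lfloor>f t / e\<rfloor>\<bar> \<le> 1" by linarith
    then have "e * \<bar>f t / e - of_int \<lfloor>f t / e\<rfloor>\<bar> \<le> e * 1" using e by (intro mult_left_mono) auto
    also have "e * \<bar>f t / e - of_int \<lfloor>f t / e\<rfloor>\<bar> = \<bar>f t - g t\<bar>"
    proof -
      have "f t - g t = e * (f t / e - of_int \<lfloor>f t / e\<rfloor>)" using e by (simp add: g right_diff_distrib)
      then show ?thesis using e by (simp only: abs_mult abs_of_pos)
    qed
    finally show ?thesis by simp
  qed
  moreover have "g = (\<lambda>t. \<Sum>k\<in>{-N..N}. (e * of_int k) * indicator (B k) t)"
    by (simp add: g_def fun_eq_iff)
  ultimately show "\<exists>g\<in>bborel. P g \<and> (\<forall>t. \<bar>f t - g t\<bar> \<le> e)"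
    using *[of "{-N..N}"] by auto
qed

section \<open>Projection-valued measures\<close>

locale pvm =
  fixes E :: "real set \<Rightarrow> ('h::complex_hilbert) \<Rightarrow>\<^sub>L 'h"
  assumes pvm: "projection_valued_measure E"
begin

lemma proj_idem: "A \<in> sets borel \<Longrightarrow> E A (E A x) = E A x"
  using pvm unfolding projection_valued_measure_def by (metis blinfun_apply_blinfun_compose)

lemma proj_cinner: "A \<in> sets borel \<Longrightarrow> cinner (E A x) y = cinner x (E A y)"
  using pvm unfolding projection_valued_measure_def by blast

lemma proj_symmetric: "A \<in> sets borel \<Longrightarrow> symmetric_op (E A)"
  unfolding symmetric_op_def by (simp add: proj_cinner flip: Re_cinner)

lemma proj_Int: "A \<in> sets borel \<Longrightarrow> B \<in> sets borel \<Longrightarrow> E A (E B x) = E (A \<inter> B) x"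
  using pvm unfolding projection_valued_measure_def by (metis blinfun_apply_blinfun_compose)

lemma proj_UNIV [simp]: "E UNIV x = x"
  using pvm unfolding projection_valued_measure_def by simp

lemma proj_sums:
  fixes A :: "nat \<Rightarrow> real set"
  shows "range A \<subseteq> sets borel \<Longrightarrow> disjoint_family A \<Longrightarrow> (\<lambda>n. E (A n) x) sums E (\<Union>n. A n) x"
  using pvm unfolding projection_valued_measure_def by blast

lemma proj_empty [simp]: "E {} x = 0"
proof -
  have "summable (\<lambda>n::nat. E {} x)"
    using proj_sums[of "\<lambda>n. {}" x] by (auto simp: disjoint_family_on_def sums_iff)
  then show ?thesis by (simp add: summable_const_iff)
qed

lemma proj_scaleC:
  assumes A: "A \<in> sets borel" shows "E A (scaleC c x) = scaleC c (E A x)"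
  by (rule cinner_eqI) (simp add: proj_cinner[OF A, symmetric] cinner_scaleC_right)

lemma proj_inner: "A \<in> sets borel \<Longrightarrow> inner x (E A x) = (norm (E A x))\<^sup>2"
  by (metis proj_idem proj_symmetric symmetric_opD power2_norm_eq_inner)

abbreviation mu :: "'h \<Rightarrow> real measure" where
  "mu \<equiv> scalar_measure E"

lemma sets_mu [simp, measurable_cong]: "sets (mu x) = sets borel"
  unfolding scalar_measure_def by (metis sets.sigma_sets_eq sets_measure_of space_borel sets.space_closed)

lemma space_mu [simp]: "space (mu x) = UNIV"
  using sets_eq_imp_space_eq[OF sets_mu] by simp

lemma emeasure_mu:
  assumes A: "A \<in> sets borel" shows "emeasure (mu x) A = ennreal (inner x (E A x))"
proof -
  have "emeasure (mu x) A = ennreal (Re (cinner x (E A x)))"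
    unfolding scalar_measure_def
  proof (rule emeasure_measure_of_sigma)
    show "sigma_algebra UNIV (sets (borel :: real measure))"
      using sets.sigma_algebra_axioms[of borel] by simp
    show "positive (sets borel) (\<lambda>A. ennreal (Re (cinner x (E A x))))"
      by (simp add: positive_def)
    show "countably_additive (sets borel) (\<lambda>A. ennreal (Re (cinner x (E A x))))"
    proof (rule countably_additiveI)
      fix A :: "nat \<Rightarrow> real set"
      assume A: "range A \<subseteq> sets borel" "disjoint_family A" "(\<Union>i. A i) \<in> sets borel"
      have "(\<lambda>n. inner x (E (A n) x)) sums inner x (E (\<Union>n. A n) x)"
        by (rule bounded_linear.sums[OF bounded_linear_inner_right proj_sums[OF A(1,2)]])
      moreover have "0 \<le> inner x (E (A n) x)" for n
        using A(1) by (subst proj_inner) auto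
      ultimately show "(\<Sum>i. ennreal (Re (cinner x (E (A i) x)))) = ennreal (Re (cinner x (E (\<Union>i. A i) x)))"
        unfolding Re_cinner by (intro suminf_ennreal_eq)
    qed
  qed fact
  then show ?thesis by (simp add: Re_cinner)
qed

lemma finite_measure_mu: "finite_measure (mu x)"
  by (rule finite_measureI) (simp add: emeasure_mu)

lemma measure_mu: "A \<in> sets borel \<Longrightarrow> measure (mu x) A = inner x (E A x)"
  by (simp add: measure_def emeasure_mu proj_inner)

lemma measure_mu_UNIV: "measure (mu x) UNIV = inner x x"
  by (simp add: measure_mu)

lemma integrable_mu: "f \<in> bborel \<Longrightarrow> integrable (mu x) f"
proof -
  assume f: "f \<in> bborel"
  then obtain c where "\<forall>t. \<bar>f t\<bar> \<le> c" by (auto simp: bborel_def)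
  then show ?thesis
    using f by (intro finite_measure.integrable_const_bound[OF finite_measure_mu, where B=c]) auto
qed

lemma integral_mu_bound:
  assumes f: "f \<in> bborel" and c: "\<And>t. \<bar>f t\<bar> \<le> c"
  shows "\<bar>\<integral>t. f t \<partial>mu x\<bar> \<le> c * inner x x"
proof -
  have "\<bar>\<integral>t. f t \<partial>mu x\<bar> \<le> (\<integral>t. \<bar>f t\<bar> \<partial>mu x)" by (rule integral_abs_bound)
  also have "\<dots> \<le> (\<integral>t. c \<partial>mu x)"
    using integrable_mu[OF f] c finite_measure_mu by (intro integral_mono) (auto intro: finite_measure.integrable_const)
  also have "\<dots> = c * inner x x" by (simp add: measure_mu_UNIV)
  finally show ?thesis .
qed

section \<open>The bounded Borel functional calculus\<close>

text \<open>
  By polarization a symmetric operator is determined by its quadratic form, so this relation says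
  \<open>T = \<integral> f dE\<close>.
\<close>

definition represents :: "(real \<Rightarrow> real) \<Rightarrow> ('h \<Rightarrow>\<^sub>L 'h) \<Rightarrow> bool" where
  "represents f T \<longleftrightarrow> symmetric_op T \<and> (\<forall>x. inner x (T x) = (\<integral>t. f t \<partial>mu x))"

lemma represents_unique: "represents f T \<Longrightarrow> represents f S \<Longrightarrow> T = S"
  unfolding represents_def by (intro symmetric_op_eqI) auto

lemma represents_indicator: "A \<in> sets borel \<Longrightarrow> represents (indicator A) (E A)"
  unfolding represents_def by (simp add: proj_symmetric measure_mu)

lemma represents_lin:
  assumes "f \<in> bborel" "g \<in> bborel" "represents f T" "represents g S"
  shows "represents (\<lambda>t. a * f t + g t) (a *\<^sub>R T + S)"
  using assms integrable_mu unfolding represents_def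
  by (auto intro!: symmetric_op_add symmetric_op_scaleR simp: blinfun.bilinear_simps inner_simps)

lemma represents_norm_le:
  assumes "f \<in> bborel" "represents f T" "\<And>t. \<bar>f t\<bar> \<le> c"
  shows "norm T \<le> c"
proof (rule symmetric_op_norm_le)
  show "0 \<le> c" using assms(3)[of 0] by linarith
  show "\<bar>inner x (T x)\<bar> \<le> c * inner x x" for x
    using assms integral_mu_bound unfolding represents_def by auto
qed (use assms in \<open>simp add: represents_def\<close>)

lemma represents_diff_norm_le:
  assumes "f \<in> bborel" "g \<in> bborel" "represents f T" "represents g S" "\<And>t. \<bar>f t - g t\<bar> \<le> c"
  shows "norm (T - S) \<le> c"
  using represents_norm_le[of "\<lambda>t. (-1) * g t + f t" "(-1) *\<^sub>R S + T" c]
    represents_lin[OF assms(2,1,4,3), of "-1"] bborel_lin[OF assms(2,1), of "-1"] assms(5)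
  by simp

text \<open>
  The quadratic form bounds the norm of a symmetric operator, so a uniformly convergent sequence of functions
  yields a Cauchy sequence of operators.
\<close>

lemma represents_exists: "f \<in> bborel \<Longrightarrow> \<exists>T. represents f T"
proof (induction rule: bborel_induct)
  case (indicator A)
  then show ?case using represents_indicator by blast
next
  case (lin a f g)
  then show ?case using represents_lin by blast
next
  case (uniform f)
  have "\<forall>n. \<exists>g T. g \<in> bborel \<and> represents g T \<and> (\<forall>t. \<bar>f t - g t\<bar> \<le> 1 / (real n + 1))"
    using uniform(2)[of "1 / (real _ + 1)"] by (metis divide_pos_pos of_nat_0_le_iff add_nonneg_pos zero_less_one)
  then obtain g T where g: "\<And>n. g n \<in> bborel" and T: "\<And>n. represents (g n) (T n)"
    and fg: "\<And>n t. \<bar>f t - g n t\<bar> \<le> 1 / (real n + 1)" by metis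
  note lim0 = one_over_Suc_tendsto
  have TT: "norm (T m - T n) \<le> 1 / (real m + 1) + 1 / (real n + 1)" for m n
  proof (rule represents_diff_norm_le[OF g g T T])
    show "\<bar>g m t - g n t\<bar> \<le> 1 / (real m + 1) + 1 / (real n + 1)" for t
      using fg[of t m] fg[of t n] by linarith
  qed
  obtain T' where T': "T \<longlonglongrightarrow> T'"
  proof (rule convergent_if_tails_bounded)
    show "(\<lambda>N. 1 / (real N + 1) + 1 / (real N + 1)) \<longlonglongrightarrow> 0"
      using tendsto_add[OF lim0 lim0] by simp
    fix m n N :: nat assume mn: "N \<le> m" "N \<le> n"
    have "1 / (real k + 1) \<le> 1 / (real N + 1)" if "N \<le> k" for k
      using that by (intro divide_left_mono) auto
    from add_mono[OF this[OF mn(1)] this[OF mn(2)]] TT[of m n]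
    show "norm (T m - T n) \<le> 1 / (real N + 1) + 1 / (real N + 1)" by linarith
  qed
  have Tx: "(\<lambda>n. T n x) \<longlonglongrightarrow> T' x" for x
    by (intro tendsto_intros T')
  have "represents f T'"
    unfolding represents_def
  proof (intro conjI allI)
    show "symmetric_op T'"
      unfolding symmetric_op_def
    proof (intro allI)
      fix x y
      have "(\<lambda>n. inner (T n x) y) \<longlonglongrightarrow> inner (T' x) y" "(\<lambda>n. inner x (T n y)) \<longlonglongrightarrow> inner x (T' y)"
        by (intro tendsto_intros Tx)+
      moreover have "inner (T n x) y = inner x (T n y)" for n
        using T[of n] by (simp add: represents_def symmetric_op_def)
      ultimately show "inner (T' x) y = inner x (T' y)"
        using LIMSEQ_unique by simp
    qed
    fix x
    have "(\<lambda>n. (\<integral>t. g n t \<partial>mu x) - (\<integral>t. f t \<partial>mu x)) \<longlonglongrightarrow> 0"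
    proof (rule Lim_null_comparison)
      show "(\<lambda>n. 1 / (real n + 1) * inner x x) \<longlonglongrightarrow> 0"
        using tendsto_mult_right[OF lim0, of "inner x x"] by simp
      have "\<bar>\<integral>t. g n t - f t \<partial>mu x\<bar> \<le> 1 / (real n + 1) * inner x x" for n
        using fg by (intro integral_mu_bound bborel_diff g uniform) (simp add: abs_minus_commute)
      then show "\<forall>\<^sub>F n in sequentially. norm ((\<integral>t. g n t \<partial>mu x) - (\<integral>t. f t \<partial>mu x)) \<le> 1 / (real n + 1) * inner x x"
        using integrable_mu[OF g] integrable_mu[OF uniform(1)] by simp
    qed
    then have "(\<lambda>n. \<integral>t. g n t \<partial>mu x) \<longlonglongrightarrow> (\<integral>t. f t \<partial>mu x)"
      by (simp add: LIM_zero_iff)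
    moreover have "(\<lambda>n. \<integral>t. g n t \<partial>mu x) \<longlonglongrightarrow> inner x (T' x)"
    proof -
      have "(\<lambda>n. inner x (T n x)) \<longlonglongrightarrow> inner x (T' x)" by (intro tendsto_intros Tx)
      then show ?thesis using T by (simp add: represents_def)
    qed
    ultimately show "inner x (T' x) = (\<integral>t. f t \<partial>mu x)"
      using LIMSEQ_unique by blast
  qed
  then show ?case by blast
qed

definition calc :: "(real \<Rightarrow> real) \<Rightarrow> 'h \<Rightarrow>\<^sub>L 'h" where
  "calc f = (THE T. represents f T)"

lemma represents_calc: "f \<in> bborel \<Longrightarrow> represents f (calc f)"
  unfolding calc_def using represents_exists represents_unique by (metis theI')

lemma calc_eqI: "f \<in> bborel \<Longrightarrow> represents f T \<Longrightarrow> calc f = T"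
  using represents_calc represents_unique by blast

lemma calc_indicator: "A \<in> sets borel \<Longrightarrow> calc (indicator A) = E A"
  by (simp add: calc_eqI represents_indicator)

lemma calc_lin: "f \<in> bborel \<Longrightarrow> g \<in> bborel \<Longrightarrow> calc (\<lambda>t. a * f t + g t) = a *\<^sub>R calc f + calc g"
  by (simp add: calc_eqI represents_lin represents_calc bborel_lin)

lemma calc_diff: "f \<in> bborel \<Longrightarrow> g \<in> bborel \<Longrightarrow> calc (\<lambda>t. f t - g t) = calc f - calc g"
  using calc_lin[of g f "-1"] by simp

lemma calc_symmetric: "f \<in> bborel \<Longrightarrow> symmetric_op (calc f)"
  using represents_calc unfolding represents_def by blast

lemma inner_calc: "f \<in> bborel \<Longrightarrow> inner x (calc f x) = (\<integral>t. f t \<partial>mu x)"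
  using represents_calc unfolding represents_def by blast

lemma norm_calc_le: "f \<in> bborel \<Longrightarrow> (\<And>t. \<bar>f t\<bar> \<le> c) \<Longrightarrow> norm (calc f) \<le> c"
  using represents_norm_le represents_calc by blast

lemma norm_calc_diff_le:
  "f \<in> bborel \<Longrightarrow> g \<in> bborel \<Longrightarrow> (\<And>t. \<bar>f t - g t\<bar> \<le> c) \<Longrightarrow> norm (calc f - calc g) \<le> c"
  using represents_diff_norm_le represents_calc by blast

text \<open>
  First half of multiplicativity: on indicators it is \<open>E(B \<inter> A) = E(B) E(A)\<close>.
\<close>

lemma calc_mult_indicator:
  assumes A: "A \<in> sets borel"
  shows "f \<in> bborel \<Longrightarrow> calc (\<lambda>t. f t * indicator A t) = calc f o\<^sub>L E A"
proof (induction rule: bborel_induct)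
  case (indicator B)
  have "calc (indicator (B \<inter> A)) = E B o\<^sub>L E A"
    using A indicator by (simp add: calc_indicator blinfun_eqI proj_Int)
  then show ?case using indicator by (simp add: calc_indicator indicator_inter_arith[abs_def])
next
  case (lin a f g)
  have "calc (\<lambda>t. a * (f t * indicator A t) + g t * indicator A t) = a *\<^sub>R (calc f o\<^sub>L E A) + (calc g o\<^sub>L E A)"
    using lin A by (simp add: calc_lin bborel_mult)
  moreover have "(\<lambda>t. (a * f t + g t) * indicator A t) = (\<lambda>t. a * (f t * indicator A t) + g t * indicator A t)"
    by (simp add: algebra_simps)
  ultimately show ?case using lin
    by (simp add: calc_lin bounded_bilinear.add_left[OF bounded_bilinear_blinfun_compose] bounded_bilinear.scaleR_left[OF bounded_bilinear_blinfun_compose])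
next
  case (uniform f)
  show ?case
  proof (rule norm_le_zeroI)
    fix e :: real assume "e > 0"
    then obtain g where g: "g \<in> bborel" "calc (\<lambda>t. g t * indicator A t) = calc g o\<^sub>L E A" "\<And>t. \<bar>f t - g t\<bar> \<le> e"
      using uniform by blast
    have 1: "norm (calc (\<lambda>t. f t * indicator A t) - calc (\<lambda>t. g t * indicator A t)) \<le> e"
    proof (rule norm_calc_diff_le)
      show "\<bar>f t * indicator A t - g t * indicator A t\<bar> \<le> e" for t
        using g(3)[of t] \<open>e > 0\<close> by (auto simp: indicator_def)
    qed (use g uniform A in \<open>auto intro: bborel_mult\<close>)
    have "norm (calc g - calc f) \<le> e"
      using g uniform by (intro norm_calc_diff_le) (auto simp: abs_minus_commute)
    moreover have "norm (E A) \<le> 1"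
      using norm_calc_le[of "indicator A" 1] A by (simp add: calc_indicator)
    ultimately have 2: "norm ((calc g - calc f) o\<^sub>L E A) \<le> e * 1"
      using \<open>e > 0\<close> by (intro order_trans[OF norm_blinfun_compose] mult_mono) auto
    have "norm (calc (\<lambda>t. f t * indicator A t) - (calc f o\<^sub>L E A)) =
      norm ((calc (\<lambda>t. f t * indicator A t) - calc (\<lambda>t. g t * indicator A t)) + ((calc g - calc f) o\<^sub>L E A))"
      by (simp add: g bounded_bilinear.diff_left[OF bounded_bilinear_blinfun_compose])
    also have "\<dots> \<le> 2 * e" using norm_triangle_le[OF add_mono[OF 1 2]] by simp
    finally show "norm (calc (\<lambda>t. f t * indicator A t) - (calc f o\<^sub>L E A)) \<le> 2 * e" .
  qed
qed

lemma calc_mult: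
  assumes f: "f \<in> bborel"
  shows "g \<in> bborel \<Longrightarrow> calc (\<lambda>t. f t * g t) = calc f o\<^sub>L calc g"
proof (induction rule: bborel_induct)
  case (indicator B)
  then show ?case by (simp add: calc_mult_indicator f calc_indicator)
next
  case (lin a g h)
  have "calc (\<lambda>t. a * (f t * g t) + f t * h t) = a *\<^sub>R (calc f o\<^sub>L calc g) + (calc f o\<^sub>L calc h)"
    using lin f by (simp add: calc_lin bborel_mult)
  moreover have "(\<lambda>t. f t * (a * g t + h t)) = (\<lambda>t. a * (f t * g t) + f t * h t)"
    by (simp add: algebra_simps)
  ultimately show ?case using lin
    by (simp add: calc_lin bounded_bilinear.add_right[OF bounded_bilinear_blinfun_compose] bounded_bilinear.scaleR_right[OF bounded_bilinear_blinfun_compose])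
next
  case (uniform g)
  obtain c where c: "c \<ge> 0" "\<And>t. \<bar>f t\<bar> \<le> c" using bborel_bound[OF f] by blast
  show ?case
  proof (rule norm_le_zeroI)
    fix e :: real assume "e > 0"
    then obtain h where h: "h \<in> bborel" "calc (\<lambda>t. f t * h t) = calc f o\<^sub>L calc h" "\<And>t. \<bar>g t - h t\<bar> \<le> e"
      using uniform by blast
    have 1: "norm (calc (\<lambda>t. f t * g t) - calc (\<lambda>t. f t * h t)) \<le> c * e"
    proof (rule norm_calc_diff_le)
      show "\<bar>f t * g t - f t * h t\<bar> \<le> c * e" for t
        using h(3)[of t] c by (simp add: abs_mult mult_mono flip: right_diff_distrib)
    qed (use h uniform f in \<open>auto intro: bborel_mult\<close>)
    have "norm (calc h - calc g) \<le> e"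
      using h uniform by (intro norm_calc_diff_le) (auto simp: abs_minus_commute)
    moreover have "norm (calc f) \<le> c"
      using norm_calc_le f c by blast
    ultimately have 2: "norm (calc f o\<^sub>L (calc h - calc g)) \<le> c * e"
      using c by (intro order_trans[OF norm_blinfun_compose] mult_mono) auto
    have "norm (calc (\<lambda>t. f t * g t) - (calc f o\<^sub>L calc g)) =
      norm ((calc (\<lambda>t. f t * g t) - calc (\<lambda>t. f t * h t)) + (calc f o\<^sub>L (calc h - calc g)))"
      by (simp add: h bounded_bilinear.diff_right[OF bounded_bilinear_blinfun_compose])
    also have "\<dots> \<le> (2 * c) * e" using norm_triangle_le[OF add_mono[OF 1 2]] by simp
    finally show "norm (calc (\<lambda>t. f t * g t) - (calc f o\<^sub>L calc g)) \<le> (2 * c) * e" .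
  qed
qed

lemma calc_scaleC: "f \<in> bborel \<Longrightarrow> calc f (scaleC c x) = scaleC c (calc f x)"
proof (induction rule: bborel_induct)
  case (indicator A)
  then show ?case by (simp add: calc_indicator proj_scaleC)
next
  case (lin a f g)
  have "scaleC c (a *\<^sub>R calc f x) = a *\<^sub>R scaleC c (calc f x)"
    by (simp flip: scaleC_of_real add: scaleC_scaleC mult.commute)
  then show ?case using lin by (simp add: calc_lin blinfun.bilinear_simps scaleC_add_right)
next
  case (uniform f)
  have scl: "norm (scaleC c z) \<le> (\<bar>Re c\<bar> + \<bar>Im c\<bar>) * norm z" for z :: 'h
  proof -
    have "norm (scaleC c z) \<le> norm (Re c *\<^sub>R z) + norm (Im c *\<^sub>R scaleC \<i> z)"
      unfolding scaleC_conv[of c z] by (rule norm_triangle_ineq)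
    moreover have "norm (scaleC \<i> z) = norm z" by (simp add: norm_eq_sqrt_inner inner_scaleC_ii)
    ultimately show ?thesis by (simp add: algebra_simps)
  qed
  show ?case
  proof (rule norm_le_zeroI)
    fix e :: real assume "e > 0"
    then obtain g where g: "g \<in> bborel" "calc g (scaleC c x) = scaleC c (calc g x)" "\<And>t. \<bar>f t - g t\<bar> \<le> e"
      using uniform by blast
    have fg: "norm (calc f - calc g) \<le> e"
      using g uniform by (intro norm_calc_diff_le) auto
    have *: "norm ((calc f - calc g) y) \<le> e * norm y" for y
      by (rule order_trans[OF norm_blinfun mult_right_mono[OF fg]]) simp
    have "calc f (scaleC c x) - scaleC c (calc f x) = (calc f - calc g) (scaleC c x) - scaleC c ((calc f - calc g) x)"
      by (simp add: blinfun.bilinear_simps g scaleC_diff_right)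
    also have "norm \<dots> \<le> e * norm (scaleC c x) + (\<bar>Re c\<bar> + \<bar>Im c\<bar>) * (e * norm x)"
      by (rule order_trans[OF norm_triangle_ineq4], intro add_mono * order_trans[OF scl] mult_left_mono) simp
    also have "\<dots> = (norm (scaleC c x) + (\<bar>Re c\<bar> + \<bar>Im c\<bar>) * norm x) * e"
      by (simp add: algebra_simps)
    finally show "norm (calc f (scaleC c x) - scaleC c (calc f x)) \<le> (norm (scaleC c x) + (\<bar>Re c\<bar> + \<bar>Im c\<bar>) * norm x) * e" .
  qed
qed

lemma calc_cinner: 
  assumes f: "f \<in> bborel" shows "cinner (calc f x) y = cinner x (calc f y)"
proof -
  have 1: "inner (calc f x) y = inner x (calc f y)" for y
    using calc_symmetric[OF f] by (simp add: symmetric_op_def)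
  then show ?thesis
    by (simp add: complex_eq_iff Re_cinner Im_cinner 1 calc_scaleC[OF f])
qed

lemma cinner_calc: 
  assumes f: "f \<in> bborel" shows "cinner x (calc f x) = complex_of_real (\<integral>t. f t \<partial>mu x)"
proof -
  have "cnj (cinner x (calc f x)) = cinner x (calc f x)"
    using cinner_commute[of x "calc f x"] calc_cinner[OF f, of x x] by simp
  then have "Im (cinner x (calc f x)) = 0" by (simp add: complex_eq_iff)
  then show ?thesis by (simp add: complex_eq_iff Re_cinner inner_calc f)
qed

text \<open>
  For an indicator \<open>g\<close>, \<open>\<langle>f(E) x, g(E) f(E) x\<rangle> = \<langle>x, (f g f)(E) x\<rangle>\<close> by symmetry and multiplicativity.
\<close>

lemma mu_calc:
  assumes f: "f \<in> bborel"
  shows "mu (calc f x) = density (mu x) (\<lambda>t. ennreal ((f t)\<^sup>2))"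
proof (rule measure_eqI)
  fix A assume "A \<in> sets (mu (calc f x))"
  then have A: "A \<in> sets borel" by simp
  have b: "(\<lambda>t. f t * (f t * indicator A t)) \<in> bborel" by (intro bborel_mult f bborel_indicator A)
  have "calc (\<lambda>t. f t * (f t * indicator A t)) = calc f o\<^sub>L (calc f o\<^sub>L E A)"
    using f A by (simp add: calc_mult bborel_mult calc_indicator)
  moreover have "calc (\<lambda>t. indicator A t * (f t * f t)) = E A o\<^sub>L (calc f o\<^sub>L calc f)"
    using f A by (simp add: calc_mult bborel_mult calc_indicator)
  moreover have "calc (\<lambda>t. indicator A t * f t) = E A o\<^sub>L calc f" "calc (\<lambda>t. f t * indicator A t) = calc f o\<^sub>L E A"
    using f A by (simp_all add: calc_mult bborel_mult calc_indicator)
  ultimately have *: "calc (\<lambda>t. f t * (f t * indicator A t)) = calc f o\<^sub>L (E A o\<^sub>L calc f)"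
    using f A by (simp add: mult.commute)
  have "emeasure (mu (calc f x)) A = ennreal (inner (calc f x) (E A (calc f x)))"
    by (rule emeasure_mu[OF A])
  also have "inner (calc f x) (E A (calc f x)) = inner x (calc f (E A (calc f x)))"
    using calc_symmetric[OF f] by (simp add: symmetric_op_def)
  also have "\<dots> = (\<integral>t. f t * (f t * indicator A t) \<partial>mu x)"
    using inner_calc[OF b, of x] by (simp add: *)
  also have "ennreal \<dots> = (\<integral>\<^sup>+t. ennreal (f t * (f t * indicator A t)) \<partial>mu x)"
    by (rule nn_integral_eq_integral[symmetric]) (use integrable_mu[OF b] in \<open>auto simp: indicator_def\<close>)
  also have "\<dots> = (\<integral>\<^sup>+t. ennreal ((f t)\<^sup>2) * indicator A t \<partial>mu x)"
    by (intro nn_integral_cong) (auto simp: indicator_def power2_eq_square)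
  also have "\<dots> = emeasure (density (mu x) (\<lambda>t. ennreal ((f t)\<^sup>2))) A"
    using A f by (subst emeasure_density) auto
  finally show "emeasure (mu (calc f x)) A = emeasure (density (mu x) (\<lambda>t. ennreal ((f t)\<^sup>2))) A" .
qed simp

lemma norm_calc_sq:
  assumes f: "f \<in> bborel" shows "(norm (calc f x))\<^sup>2 = (\<integral>t. (f t)\<^sup>2 \<partial>mu x)"
proof -
  have "(norm (calc f x))\<^sup>2 = inner x (calc f (calc f x))"
    using calc_symmetric[OF f] by (simp add: symmetric_op_def power2_norm_eq_inner)
  also have "\<dots> = inner x (calc (\<lambda>t. f t * f t) x)" using f by (simp add: calc_mult)
  also have "\<dots> = (\<integral>t. (f t)\<^sup>2 \<partial>mu x)" using f by (simp add: inner_calc bborel_mult power2_eq_square)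
  finally show ?thesis .
qed

lemma calc_cong_AE:
  assumes f: "f \<in> bborel" "g \<in> bborel" and AE: "\<And>x. AE t in mu x. f t = g t"
  shows "calc f = calc g"
proof (rule calc_eqI[OF f(1)])
  have "(\<integral>t. f t \<partial>mu x) = (\<integral>t. g t \<partial>mu x)" for x
    using f AE by (intro integral_cong_AE) auto
  then show "represents f (calc g)" using represents_calc[OF f(2)] by (simp add: represents_def)
qed

text \<open>
  The distance is \<open>\<mu>\<^sub>x(- B\<^sub>n)\<^sup>1\<^sup>/\<^sup>2\<close>, which tends to zero by dominated convergence.
\<close>

lemma truncation_tendsto:
  assumes B [measurable]: "\<And>n. B n \<in> sets borel"
    and ev: "AE t in mu x. eventually (\<lambda>n. t \<in> B n) sequentially"
  shows "(\<lambda>n. E (B n) x) \<longlonglongrightarrow> x"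
proof -
  have eq: "norm (E (B n) x - x) = sqrt (measure (mu x) (- B n))" for n
  proof -
    have "(norm (calc (\<lambda>t. indicator (B n) t - 1) x))\<^sup>2 = (\<integral>t. (indicator (B n) t - 1)\<^sup>2 \<partial>mu x)"
      by (intro norm_calc_sq bborel_diff) auto
    also have "(\<lambda>t. (indicator (B n) t - 1)\<^sup>2) = indicat_real (- B n)" by (auto simp: indicator_def fun_eq_iff)
    also have "calc (\<lambda>t. indicator (B n) t - 1) x = E (B n) x - x"
      using calc_diff[of "indicator (B n)" "indicator UNIV"] calc_indicator[of "B n"] calc_indicator[of UNIV]
      by (simp add: blinfun.diff_left)
    finally have "(norm (E (B n) x - x))\<^sup>2 = measure (mu x) (- B n)" by simp
    then show ?thesis by (metis norm_ge_zero real_sqrt_unique)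
  qed
  have "(\<lambda>n. \<integral>t. indicat_real (- B n) t \<partial>mu x) \<longlonglongrightarrow> (\<integral>t. 0 \<partial>mu x)"
  proof (rule integral_dominated_convergence[where w="\<lambda>_. 1"])
    show "AE t in mu x. (\<lambda>n. indicat_real (- B n) t) \<longlonglongrightarrow> 0"
      using ev
    proof eventually_elim
      case (elim t)
      from elim have "eventually (\<lambda>n. indicat_real (- B n) t = 0) sequentially"
        by eventually_elim simp
      then show ?case by (rule tendsto_eventually)
    qed
  qed (use finite_measure.integrable_const[OF finite_measure_mu] in auto)
  then have "(\<lambda>n. sqrt (measure (mu x) (- B n))) \<longlonglongrightarrow> sqrt 0"
    by (intro tendsto_real_sqrt) simp
  then have "(\<lambda>n. E (B n) x - x) \<longlonglongrightarrow> 0"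
    by (subst tendsto_norm_zero_iff[symmetric]) (simp add: eq)
  then show ?thesis by (rule LIM_zero_cancel)
qed

text \<open>
  The truncations of a function in \<open>L\<^sup>2(\<mu>\<^sub>x)\<close> form a Cauchy sequence in \<open>L\<^sup>2(\<mu>\<^sub>x)\<close>, and \<open>w \<mapsto> w(E) x\<close> is
  isometric from there into the Hilbert space. This reaches unbounded functions of \<open>E\<close>.
\<close>

lemma truncated_calc_converges:
  assumes B [measurable]: "\<And>n. B n \<in> sets borel" and mono: "\<And>n m. n \<le> m \<Longrightarrow> B n \<subseteq> B m"
    and ev: "AE t in mu x. eventually (\<lambda>n. t \<in> B n) sequentially"
    and f [measurable]: "f \<in> borel_measurable borel"
    and w: "\<And>n. (\<lambda>t. indicator (B n) t * f t) \<in> bborel"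
    and fin: "(\<integral>\<^sup>+t. ennreal ((f t)\<^sup>2) \<partial>mu x) < \<infinity>"
  obtains z where "(\<lambda>n. calc (\<lambda>t. indicator (B n) t * f t) x) \<longlonglongrightarrow> z"
proof -
  define r where "r n = (\<integral>t. (f t)\<^sup>2 * indicator (- B n) t \<partial>mu x)" for n
  have sq: "integrable (mu x) (\<lambda>t. (f t)\<^sup>2)"
    using fin by (intro integrableI_nonneg) auto
  have "r \<longlonglongrightarrow> (\<integral>t. 0 \<partial>mu x)"
    unfolding r_def
  proof (rule integral_dominated_convergence[OF _ _ sq])
    show "AE t in mu x. (\<lambda>n. (f t)\<^sup>2 * indicator (- B n) t) \<longlonglongrightarrow> 0"
      using ev
    proof eventually_elim
      case (elim t)
      from elim have "eventually (\<lambda>n. (f t)\<^sup>2 * indicator (- B n) t = 0) sequentially"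
        by eventually_elim simp
      then show ?case by (rule tendsto_eventually)
    qed
    show "AE t in mu x. norm ((f t)\<^sup>2 * indicator (- B n) t) \<le> (f t)\<^sup>2" for n
      by (auto simp: indicator_def)
  qed auto
  then have r0: "(\<lambda>n. sqrt (r n)) \<longlonglongrightarrow> 0"
    using tendsto_real_sqrt[of r 0] by simp
  show ?thesis
  proof (rule convergent_if_tails_bounded[OF r0 _ that])
    fix m n N :: nat assume mn: "N \<le> m" "N \<le> n"
    let ?w = "\<lambda>n t. indicator (B n) t * f t"
    have "(norm (calc (?w m) x - calc (?w n) x))\<^sup>2 = (\<integral>t. (?w m t - ?w n t)\<^sup>2 \<partial>mu x)"
      using norm_calc_sq[OF bborel_diff[OF w w], of m n x] by (simp add: calc_diff[OF w w] blinfun.diff_left)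
    also have "\<dots> \<le> r N"
      unfolding r_def
    proof (rule integral_mono)
      show "integrable (mu x) (\<lambda>t. (?w m t - ?w n t)\<^sup>2)"
        using integrable_mu[OF bborel_mult[OF bborel_diff[OF w w] bborel_diff[OF w w]], of x m n m n]
        by (simp add: power2_eq_square)
      show "integrable (mu x) (\<lambda>t. (f t)\<^sup>2 * indicator (- B N) t)"
        by (intro integrable_real_mult_indicator sq) auto
      show "(?w m t - ?w n t)\<^sup>2 \<le> (f t)\<^sup>2 * indicator (- B N) t" for t
        using mono[OF mn(1)] mono[OF mn(2)] by (auto simp: indicator_def)
    qed
    finally show "norm (calc (?w m) x - calc (?w n) x) \<le> sqrt (r N)" by (rule real_le_rsqrt)
  qed
qed

end

section \<open>Moments of measures on the unit interval\<close>

definition unit_measure :: "real measure \<Rightarrow> bool" where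
  "unit_measure M \<longleftrightarrow> finite_measure M \<and> sets M = sets borel \<and> (AE t in M. t \<in> {0..1})"

lemma unit_measure_integrable:
  assumes M: "unit_measure M" and f: "f \<in> borel_measurable borel" and c: "\<And>t. t \<in> {0..1} \<Longrightarrow> \<bar>f t\<bar> \<le> (c::real)"
  shows "integrable M f"
proof -
  interpret finite_measure M using M by (simp add: unit_measure_def)
  have [measurable_cong]: "sets M = sets borel" using M by (simp add: unit_measure_def)
  have "AE t in M. t \<in> {0..1}" using M by (simp add: unit_measure_def)
  then have "AE t in M. norm (f t) \<le> c"
    by eventually_elim (simp add: c)
  then show ?thesis using f by (intro integrable_const_bound) auto
qed

lemma unit_measure_integrable_power: "unit_measure M \<Longrightarrow> integrable M (\<lambda>t. t ^ j)"
  by (rule unit_measure_integrable[where c=1]) (auto simp: power_le_one)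

lemma abs_cts_step_le: "a < b \<Longrightarrow> \<bar>cts_step a b x\<bar> \<le> 1"
  by (simp add: cts_step_def)

lemma borel_atMost: "sets borel = sigma_sets UNIV (range (atMost :: real \<Rightarrow> real set))"
  unfolding borel_eq_atMost by simp

text \<open>
  The moment problem on a compact interval is determinate. The statement is about signed combinations of
  measures because it is applied to the polarized forms of families \<open>\<mu>\<^sub>x\<close>. By the Weierstrass theorem the
  vanishing of all moments passes to continuous functions, then by dominated convergence to indicators of
  half-lines, and from these to all Borel sets.
\<close>

lemma moments_determine_sum:
  fixes c :: "'i \<Rightarrow> real" and M :: "'i \<Rightarrow> real measure"
  assumes I: "finite I" and M: "\<And>i. i \<in> I \<Longrightarrow> unit_measure (M i)"
    and mom: "\<And>j. (\<Sum>i\<in>I. c i * (\<integral>t. t ^ j \<partial>M i)) = 0"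
    and B: "B \<in> sets borel"
  shows "(\<Sum>i\<in>I. c i * measure (M i) B) = 0"
proof -
  define F where "F f = (\<Sum>i\<in>I. c i * (\<integral>t. f t \<partial>M i))" for f :: "real \<Rightarrow> real"
  have fin: "finite_measure (M i)" and sets [simp]: "sets (M i) = sets borel" 
    and unit: "AE t in M i. t \<in> {0..1}" if "i \<in> I" for i
    using M[OF that] by (auto simp: unit_measure_def)
  have sp [simp]: "space (M i) = UNIV" if "i \<in> I" for i
    using sets_eq_imp_space_eq[OF sets[OF that]] by simp
  have poly: "F (\<lambda>t. \<Sum>k\<le>n. a k * t ^ k) = 0" for a n
  proof -
    have "F (\<lambda>t. \<Sum>k\<le>n. a k * t ^ k) = (\<Sum>i\<in>I. \<Sum>k\<le>n. a k * (c i * (\<integral>t. t ^ k \<partial>M i)))"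
      unfolding F_def
      by (intro sum.cong refl)
        (simp add: Bochner_Integration.integral_sum unit_measure_integrable_power M sum_distrib_left mult.left_commute)
    also have "\<dots> = (\<Sum>k\<le>n. a k * (\<Sum>i\<in>I. c i * (\<integral>t. t ^ k \<partial>M i)))"
      by (subst sum.swap) (simp add: sum_distrib_left)
    finally show ?thesis by (simp add: mom)
  qed
  have cont: "F f = 0" if f: "continuous_on UNIV f" for f
  proof (rule norm_le_zeroI)
    fix e :: real assume e: "e > 0"
    obtain p where p: "real_polynomial_function p" "\<And>t. t \<in> {0..1} \<Longrightarrow> \<bar>f t - p t\<bar> < e"
      using Stone_Weierstrass_real_polynomial_function[OF compact_Icc continuous_on_subset[OF f] e, of 0 1] by auto
    obtain a n where pa: "p = (\<lambda>x. \<Sum>k\<le>n. a k * x ^ k)"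
      using p(1) unfolding real_polynomial_function_iff_sum by blast
    have [measurable]: "f \<in> borel_measurable borel" "p \<in> borel_measurable borel"
      using f by (auto simp: pa intro: borel_measurable_continuous_onI)
    have "compact (f ` {0..1})" by (rule compact_continuous_image[OF continuous_on_subset[OF f]]) auto
    then obtain d where "\<forall>x\<in>f ` {0..1}. norm x \<le> d"
      using compact_imp_bounded bounded_iff by blast
    then have d: "\<bar>f t\<bar> \<le> d" if "t \<in> {0..1}" for t
      using that by simp
    have intf: "integrable (M i) f" if "i \<in> I" for i
      using d by (intro unit_measure_integrable[OF M[OF that]]) auto
    have intp: "integrable (M i) p" if "i \<in> I" for i
      unfolding pa using that by (simp add: unit_measure_integrable_power M)
    have "\<bar>c i * (\<integral>t. f t \<partial>M i) - c i * (\<integral>t. p t \<partial>M i)\<bar> \<le> (\<bar>c i\<bar> * measure (M i) UNIV) * e" if i: "i \<in> I" for i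
    proof -
      interpret finite_measure "M i" using fin[OF i] .
      have "\<bar>\<integral>t. f t - p t \<partial>M i\<bar> \<le> (\<integral>t. \<bar>f t - p t\<bar> \<partial>M i)" by (rule integral_abs_bound)
      also have "\<dots> \<le> (\<integral>t. e \<partial>M i)"
      proof (rule integral_mono_AE)
        show "AE t in M i. \<bar>f t - p t\<bar> \<le> e" using unit[OF i] by eventually_elim (use p(2) in fastforce)
      qed (use intf[OF i] intp[OF i] in auto)
      finally have "\<bar>c i\<bar> * \<bar>(\<integral>t. f t \<partial>M i) - (\<integral>t. p t \<partial>M i)\<bar> \<le> \<bar>c i\<bar> * (measure (M i) UNIV * e)"
        using intf[OF i] intp[OF i] i by (intro mult_left_mono) auto
      then show ?thesis by (simp add: abs_mult mult.assoc flip: right_diff_distrib)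
    qed
    then have "\<bar>F f - F p\<bar> \<le> (\<Sum>i\<in>I. (\<bar>c i\<bar> * measure (M i) UNIV) * e)"
      unfolding F_def sum_subtractf[symmetric] by (intro order_trans[OF sum_abs] sum_mono) auto
    then show "norm (F f - 0) \<le> (\<Sum>i\<in>I. \<bar>c i\<bar> * measure (M i) UNIV) * e"
      using poly[of a n] by (simp add: pa sum_distrib_right)
  qed
  have F_ind: "F (indicator A) = (\<Sum>i\<in>I. c i * measure (M i) A)" if "A \<in> sets borel" for A
    unfolding F_def using that by (intro sum.cong) auto
  have half: "F (indicator {..a}) = 0" for a
  proof -
    define g where "g n = cts_step a (a + 1 / (real n + 1))" for n
    have "continuous_on UNIV (g n)" for n
      unfolding g_def by (intro uniformly_continuous_imp_continuous cts_step_uniformly_continuous) simp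
    then have g0: "F (g n) = 0" and gm [measurable]: "g n \<in> borel_measurable borel" for n
      using cont by (auto intro: borel_measurable_continuous_onI)
    have "(\<lambda>n. F (g n)) \<longlonglongrightarrow> F (indicator {..a})"
      unfolding F_def
    proof (intro tendsto_sum tendsto_mult tendsto_const)
      fix i assume i: "i \<in> I"
      interpret finite_measure "M i" using fin[OF i] .
      note sets[OF i, measurable_cong]
      show "(\<lambda>n. \<integral>t. g n t \<partial>M i) \<longlonglongrightarrow> (\<integral>t. indicator {..a} t \<partial>M i)"
      proof (rule integral_dominated_convergence[where w="\<lambda>_. 1"])
        show "AE t in M i. (\<lambda>n. g n t) \<longlonglongrightarrow> indicator {..a} t"
        proof (rule AE_I2)
          fix t
          show "(\<lambda>n. g n t) \<longlonglongrightarrow> indicator {..a} t"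
          proof (cases "t \<le> a")
            case True
            then show ?thesis by (simp add: g_def cts_step_def)
          next
            case False
            have "eventually (\<lambda>n. 1 / (real n + 1) < t - a) sequentially"
              using False by (intro order_tendstoD(2)[OF one_over_Suc_tendsto]) simp
            then have "eventually (\<lambda>n. g n t = indicator {..a} t) sequentially"
              by eventually_elim (use False in \<open>auto simp: g_def cts_step_def\<close>)
            then show ?thesis by (rule tendsto_eventually)
          qed
        qed
        show "AE t in M i. norm (g n t) \<le> 1" for n
          unfolding g_def by (intro AE_I2) (simp add: abs_cts_step_le)
      qed auto
    qed
    then show ?thesis using g0 LIMSEQ_unique by (simp add: tendsto_const_iff)
  qed
  have UN: "(\<Sum>i\<in>I. c i * measure (M i) UNIV) = 0"
    using mom[of 0] by (simp cong: sum.cong)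
  have Bs: "B \<in> sigma_sets UNIV (range atMost)" using B by (simp add: borel_atMost)
  have ints: "Int_stable (range (atMost :: real \<Rightarrow> real set))"
    by (auto simp: Int_stable_def)
  show ?thesis
  proof (rule sigma_sets_induct_disjoint[where P="\<lambda>A. (\<Sum>i\<in>I. c i * measure (M i) A) = 0", OF ints _ Bs])
    fix A assume "A \<in> range (atMost :: real \<Rightarrow> real set)"
    then show "(\<Sum>i\<in>I. c i * measure (M i) A) = 0" using half F_ind by force
  next
    fix A assume A: "A \<in> sigma_sets UNIV (range (atMost :: real \<Rightarrow> real set))" "(\<Sum>i\<in>I. c i * measure (M i) A) = 0"
    have "c i * measure (M i) (UNIV - A) = c i * measure (M i) UNIV - c i * measure (M i) A" if i: "i \<in> I" for i
      using finite_measure.finite_measure_compl[OF fin[OF i], of A] A i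
      by (simp add: borel_atMost[symmetric] right_diff_distrib)
    then show "(\<Sum>i\<in>I. c i * measure (M i) (UNIV - A)) = 0"
      using A UN by (simp add: sum_subtractf)
  next
    fix A :: "nat \<Rightarrow> real set"
    assume A: "disjoint_family A" "range A \<subseteq> sigma_sets UNIV (range (atMost :: real \<Rightarrow> real set))"
      "\<And>n. (\<Sum>i\<in>I. c i * measure (M i) (A n)) = 0"
    have "(\<lambda>n. \<Sum>i\<in>I. c i * measure (M i) (A n)) sums (\<Sum>i\<in>I. c i * measure (M i) (\<Union>n. A n))"
    proof (intro sums_sum sums_mult)
      fix i assume i: "i \<in> I"
      show "(\<lambda>n. measure (M i) (A n)) sums measure (M i) (\<Union>n. A n)"
        using A i by (intro finite_measure.finite_measure_UNION fin) (auto simp: borel_atMost)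
    qed
    then show "(\<Sum>i\<in>I. c i * measure (M i) (\<Union>n. A n)) = 0"
      unfolding A(3) using sums_unique2[OF _ sums_zero] by blast
  qed auto
qed

lemma moments_determine_sum_list:
  assumes M: "\<And>c M. (c, M) \<in> set xs \<Longrightarrow> unit_measure M"
    and mom: "\<And>j. (\<Sum>(c, M)\<leftarrow>xs. c * (\<integral>t. t ^ j \<partial>M)) = 0"
    and B: "B \<in> sets borel"
  shows "(\<Sum>(c, M)\<leftarrow>xs. c * measure M B) = 0"
proof -
  have conv: "(\<Sum>(c, M)\<leftarrow>xs. c * h M) = (\<Sum>i\<in>{0..<length xs}. fst (xs ! i) * h (snd (xs ! i)))" for h
    by (simp add: sum_list_sum_nth case_prod_beta)
  show ?thesis
    unfolding conv
  proof (rule moments_determine_sum[OF _ _ _ B])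
    show "unit_measure (snd (xs ! i))" if "i \<in> {0..<length xs}" for i
      using M[of "fst (xs ! i)" "snd (xs ! i)"] that by simp
    show "(\<Sum>i\<in>{0..<length xs}. fst (xs ! i) * (\<integral>t. t ^ j \<partial>snd (xs ! i))) = 0" for j
      using mom[of j] unfolding conv[of "\<lambda>M. \<integral>t. t ^ j \<partial>M"] .
  qed simp
qed

section \<open>The Hausdorff moment problem\<close>

text \<open>
  The factor of \<open>(k choose j) / (n choose j)\<close> with index \<open>i\<close> is \<open>(k - i) / (n - i)\<close>, and it differs from
  \<open>k / n\<close> by at most \<open>i / (n - i)\<close>; the errors of \<open>j\<close> factors between \<open>0\<close> and \<open>1\<close> add up.
\<close>

lemma power_approx_binomial_ratio:
  assumes "k \<le> n" "j \<le> J" "J < n"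
  shows "\<bar>(real k / real n) ^ j - real (k choose j) / real (n choose j)\<bar> \<le> real j * (real J / (real n - real J))"
  using assms(2)
proof (induction j)
  case 0
  then show ?case by simp
next
  case (Suc j)
  define p where "p = real k / real n"
  define a where "a = real (k choose j) / real (n choose j)"
  define r where "r = (real k - real j) / (real n - real j)"
  have n: "real n > real J" "j < J" using assms Suc by auto
  have p: "0 \<le> p" "p \<le> 1" using assms n by (auto simp: p_def divide_le_eq)
  have step: "real (m choose Suc j) * (real j + 1) = real (m choose j) * (real m - real j)" for m
  proof (cases "j \<le> m")
    case True
    have "Suc j * (m choose Suc j) = (m - j) * (m choose j)"
      using binomial_absorb_comp[of m j] Suc_times_binomial_eq[of "m - 1" j]
      by (cases m) (simp_all add: binomial_absorption mult.commute)
    then have "real (Suc j * (m choose Suc j)) = real ((m - j) * (m choose j))" by (rule arg_cong)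
    then show ?thesis using True by (simp add: of_nat_diff algebra_simps)
  qed (simp add: binomial_eq_0)
  have nj: "real (n choose j) > 0" "real (n choose Suc j) > 0"
    using n assms by (auto simp: zero_less_binomial_iff)
  have a1: "real (k choose Suc j) / real (n choose Suc j) = a * r"
  proof -
    have "real (k choose Suc j) / real (n choose Suc j) =
        (real (k choose Suc j) * (real j + 1)) / (real (n choose Suc j) * (real j + 1))"
      by simp
    also have "\<dots> = a * r" unfolding step by (simp add: a_def r_def)
    finally show ?thesis .
  qed
  have a: "0 \<le> a" "a \<le> 1"
    using nj binomial_right_mono[OF assms(1), of j] by (auto simp: a_def divide_le_eq)
  have "p - r = real j * (real n - real k) / (real n * (real n - real j))"
    using n by (simp add: p_def r_def field_simps)
  also have "\<dots> = (real j / (real n - real j)) * ((real n - real k) / real n)" by simp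
  finally have pr: "p - r = (real j / (real n - real j)) * ((real n - real k) / real n)" .
  have "(real j / (real n - real j)) * ((real n - real k) / real n) \<le> (real J / (real n - real J)) * 1"
    using n assms by (intro mult_mono frac_le) (auto simp: divide_le_eq)
  moreover have "0 \<le> (real j / (real n - real j)) * ((real n - real k) / real n)"
    using n assms by auto
  ultimately have pr: "\<bar>p - r\<bar> \<le> real J / (real n - real J)" unfolding pr
    by (simp only: abs_of_nonneg mult_1_right)
  have "\<bar>p ^ Suc j - a * r\<bar> = \<bar>p * (p ^ j - a) + a * (p - r)\<bar>" by (simp add: algebra_simps)
  also have "\<dots> \<le> \<bar>p * (p ^ j - a)\<bar> + \<bar>a * (p - r)\<bar>" by (rule abs_triangle_ineq)
  also have "\<dots> \<le> 1 * \<bar>p ^ j - a\<bar> + 1 * \<bar>p - r\<bar>"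
    unfolding abs_mult using p a by (intro add_mono mult_right_mono) auto
  also have "\<dots> \<le> real j * (real J / (real n - real J)) + real J / (real n - real J)"
    using Suc pr unfolding p_def a_def by simp
  finally show ?case unfolding a1 p_def[symmetric] by (simp add: algebra_simps add_divide_distrib)
qed

text \<open>
  The model is \<open>d a b = \<integral> t\<^sup>a (1 - t)\<^sup>b d\<mu>(t)\<close> for a finite measure \<open>\<mu>\<close> on the unit interval. The recursion
  is \<open>1 = t + (1 - t)\<close>. Such an array is determined by its first column, a completely monotone sequence.
\<close>

locale hausdorff_array =
  fixes d :: "nat \<Rightarrow> nat \<Rightarrow> real"
  assumes nonneg: "0 \<le> d a b" and rec: "d a b = d (Suc a) b + d a (Suc b)"
begin

lemma sum_binomial: "(\<Sum>k\<le>n. real (n choose k) * d (a + k) (b + (n - k))) = d a b"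
proof (induction n arbitrary: a b)
  case (Suc n)
  define T where "T k = d (a + k) (b + (Suc n - k))" for k
  have T1: "T k = d (a + k) (Suc b + (n - k))" if "k \<le> n" for k
    using that by (simp add: T_def Suc_diff_le)
  have T2: "T (Suc k) = d (Suc a + k) (b + (n - k))" for k
    by (simp add: T_def)
  have "(\<Sum>k\<le>Suc n. real (Suc n choose k) * T k) = T 0 + (\<Sum>k\<le>n. real (Suc n choose Suc k) * T (Suc k))"
    by (subst sum.atMost_Suc_shift) simp
  also have "(\<Sum>k\<le>n. real (Suc n choose Suc k) * T (Suc k)) =
      (\<Sum>k\<le>n. real (n choose k) * T (Suc k)) + (\<Sum>k\<le>n. real (n choose Suc k) * T (Suc k))"
    by (simp add: distrib_right sum.distrib)
  also have "T 0 + (\<dots>) = (\<Sum>k\<le>n. real (n choose k) * T (Suc k)) + (\<Sum>k\<le>Suc n. real (n choose k) * T k)"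
    using sum.atMost_Suc_shift[of "\<lambda>k. real (n choose k) * T k" n] by simp
  also have "(\<Sum>k\<le>Suc n. real (n choose k) * T k) = (\<Sum>k\<le>n. real (n choose k) * T k)"
    by simp
  also have "\<dots> = (\<Sum>k\<le>n. real (n choose k) * d (a + k) (Suc b + (n - k)))"
    by (intro sum.cong refl) (simp add: T1)
  also have "\<dots> = d a (Suc b)" by (rule Suc.IH)
  also have "(\<Sum>k\<le>n. real (n choose k) * T (Suc k)) = d (Suc a) b"
    unfolding T2 by (rule Suc.IH)
  also have "d (Suc a) b + d a (Suc b) = d a b" by (rule rec[symmetric])
  finally show ?case unfolding T_def .
qed simp

text \<open>
  In the model this is \<open>\<Sum>\<^sub>k (n - j choose k - j) t\<^sup>k (1 - t)\<^sup>n\<^sup>-\<^sup>k = t\<^sup>j\<close>.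
\<close>

lemma sum_binomial_moment:
  assumes "j \<le> n"
  shows "(\<Sum>k\<le>n. real (n choose k) * d k (n - k) * (real (k choose j) / real (n choose j))) = d j 0"
proof -
  have nj: "real (n choose j) > 0" using assms by (simp add: zero_less_binomial_iff)
  have "(\<Sum>k\<le>n. real (n choose k) * d k (n - k) * (real (k choose j) / real (n choose j))) =
     (\<Sum>k\<in>{j..n}. real (n choose k) * d k (n - k) * (real (k choose j) / real (n choose j)))"
    by (rule sum.mono_neutral_right) (auto simp: not_le binomial_eq_0)
  also have "\<dots> = (\<Sum>k\<in>{j..n}. real ((n - j) choose (k - j)) * d k (n - k))"
  proof (rule sum.cong[OF refl])
    fix k assume k: "k \<in> {j..n}"
    then have "real ((n choose k) * (k choose j)) = real ((n choose j) * ((n - j) choose (k - j)))"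
      using choose_mult[of j k n] by (intro arg_cong[where f=real]) auto
    then have "real (n choose k) * real (k choose j) = real (n choose j) * real ((n - j) choose (k - j))"
      by simp
    moreover have "real (n choose k) * d k (n - k) * (real (k choose j) / real (n choose j)) =
        (real (n choose k) * real (k choose j)) * d k (n - k) / real (n choose j)"
      by simp
    ultimately show "real (n choose k) * d k (n - k) * (real (k choose j) / real (n choose j)) = real ((n - j) choose (k - j)) * d k (n - k)"
      using nj by simp
  qed
  also have "\<dots> = (\<Sum>k\<le>n - j. real ((n - j) choose k) * d (j + k) (0 + ((n - j) - k)))"
    by (rule sum.reindex_bij_witness[of _ "\<lambda>k. j + k" "\<lambda>k. k - j"]) (use assms in auto)
  also have "\<dots> = d j 0" by (rule sum_binomial)
  finally show ?thesis .
qed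

lemma moment_mono: "d j 0 \<le> d 0 0"
proof (induction j)
  case (Suc j)
  then show ?case using rec[of j 0] nonneg[of j "Suc 0"] by linarith
qed simp

text \<open>
  These are the moments of the measure with mass \<open>(n choose k) d k (n - k)\<close> at \<open>k / n\<close>. With the powers
  \<open>(k / n)\<^sup>j\<close> replaced by binomial ratios the sum equals \<open>d j 0\<close> exactly.
\<close>

lemma moments_converge:
  "(\<lambda>n. \<Sum>k\<le>n. real (n choose k) * d k (n - k) * (real k / real n) ^ j) \<longlonglongrightarrow> d j 0"
proof -
  let ?S = "\<lambda>n. \<Sum>k\<le>n. real (n choose k) * d k (n - k) * (real k / real n) ^ j"
  have "(\<lambda>n. ?S n - d j 0) \<longlonglongrightarrow> 0"
  proof (rule Lim_null_comparison)
    show "(\<lambda>n. d 0 0 * (real j * (real j / (real n - real j)))) \<longlonglongrightarrow> 0"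
    proof -
      have "(\<lambda>n. 1 / (real n - real j)) \<longlonglongrightarrow> 0" by real_asymp
      then have "(\<lambda>n. (d 0 0 * real j * real j) * (1 / (real n - real j))) \<longlonglongrightarrow> 0"
        by (rule tendsto_mult_right_zero)
      then show ?thesis by (simp add: mult.assoc)
    qed
    show "\<forall>\<^sub>F n in sequentially. norm (?S n - d j 0) \<le> d 0 0 * (real j * (real j / (real n - real j)))"
      using eventually_gt_at_top[of j]
    proof eventually_elim
      case (elim n)
      have eq: "?S n - d j 0 = (\<Sum>k\<le>n. real (n choose k) * d k (n - k) * ((real k / real n) ^ j - real (k choose j) / real (n choose j)))"
        unfolding right_diff_distrib sum_subtractf using sum_binomial_moment[OF less_imp_le[OF elim]] by simp
      have "\<bar>?S n - d j 0\<bar> \<le> (\<Sum>k\<le>n. real (n choose k) * d k (n - k) * (real j * (real j / (real n - real j))))"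
        unfolding eq
      proof (intro order_trans[OF sum_abs] sum_mono)
        fix k assume "k \<in> {..n}"
        then have "\<bar>(real k / real n) ^ j - real (k choose j) / real (n choose j)\<bar> \<le> real j * (real j / (real n - real j))"
          using elim by (intro power_approx_binomial_ratio) auto
        then have "(real (n choose k) * d k (n - k)) * \<bar>(real k / real n) ^ j - real (k choose j) / real (n choose j)\<bar>
            \<le> (real (n choose k) * d k (n - k)) * (real j * (real j / (real n - real j)))"
          by (rule mult_left_mono) (simp add: nonneg)
        then show "\<bar>real (n choose k) * d k (n - k) * ((real k / real n) ^ j - real (k choose j) / real (n choose j))\<bar>
            \<le> real (n choose k) * d k (n - k) * (real j * (real j / (real n - real j)))"
          by (simp add: abs_mult nonneg)
      qed
      also have "\<dots> = d 0 0 * (real j * (real j / (real n - real j)))"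
        unfolding sum_distrib_right[symmetric] using sum_binomial[of n 0 0] by simp
      finally show ?case by simp
    qed
  qed
  then show ?thesis by (simp add: LIM_zero_iff)
qed

text \<open>
  The discrete measures of the Bernstein construction live on the unit interval, hence they are tight.
  A weak limit of a subsequence, given by Helly's theorem, has the prescribed moments.
\<close>

lemma exists_measure_normalized:
  assumes 1: "d 0 0 = 1"
  shows "\<exists>M. unit_measure M \<and> (\<forall>j. (\<integral>t. t ^ j \<partial>M) = d j 0)"
proof -
  define w where "w n k = real (n choose k) * d k (n - k)" for n k
  define P where "P n = point_measure {..n} (w n)" for n
  define N where "N n = distr (P n) borel (\<lambda>k. real k / real n)" for n
  have w: "0 \<le> w n k" for n k by (simp add: w_def nonneg)
  have "prob_space (P n)" for n
    using sum_binomial[of n 0 0] 1 w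
    by (intro prob_spaceI) (simp add: P_def space_point_measure emeasure_point_measure_finite sum_nonneg flip: w_def)
  then have N: "real_distribution (N n)" for n
    unfolding N_def P_def by (intro prob_space.real_distribution_distr) (auto simp: P_def)
  have N_AE: "AE t in N n. t \<in> {0..1}" for n
    unfolding N_def P_def by (subst AE_distr_iff) (auto simp: AE_point_measure divide_le_eq)
  have N_int: "(\<integral>t. f t \<partial>N n) = (\<Sum>k\<le>n. w n k * f (real k / real n))" if "f \<in> borel_measurable borel" for f :: "real \<Rightarrow> real" and n
    unfolding N_def using that w
    by (subst integral_distr) (auto simp: P_def lebesgue_integral_point_measure_finite)
  have "tight N"
    unfolding tight_def
  proof (intro conjI allI impI N)
    fix e :: real assume "e > 0"
    have "measure (N n) {-1<..1} = 1" for n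
    proof -
      interpret real_distribution "N n" by (rule N)
      show ?thesis using N_AE[of n] by (subst prob_eq_1) (auto elim: eventually_mono)
    qed
    then show "\<exists>a b. a < b \<and> (\<forall>n. 1 - e < measure (N n) {a<..b})"
      using \<open>e > 0\<close> by (intro exI[of _ "-1"] exI[of _ 1]) auto
  qed
  then obtain r M where r: "strict_mono r" and M: "real_distribution M" and conv: "weak_conv_m (N \<circ> id \<circ> r) M"
    using tight_imp_convergent_subsubsequence[of N id] by (auto simp: strict_mono_id)
  interpret M: real_distribution M by (rule M)
  have lim: "(\<lambda>n. \<integral>t. f t \<partial>N (r n)) \<longlonglongrightarrow> (\<integral>t. f t \<partial>M)"
    if "continuous_on UNIV f" "\<And>x. \<bar>f x\<bar> \<le> B" for f :: "real \<Rightarrow> real" and B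
    using weak_conv_imp_integral_bdd_continuous_conv[OF _ M conv, of f B] N that
    by (simp add: continuous_on_eq_continuous_at)
  have AE_M: "AE t in M. t \<in> {0..1}"
  proof -
    \<comment> \<open>a bounded continuous function that vanishes exactly on the unit interval\<close>
    define f where "f t = min 1 (max 0 (max (- t) (t - 1)))" for t :: real
    have f: "continuous_on UNIV f" unfolding f_def by (intro continuous_intros)
    have f1: "\<bar>f t\<bar> \<le> 1" "0 \<le> f t" for t by (auto simp: f_def)
    have [measurable]: "f \<in> borel_measurable borel" using f by (rule borel_measurable_continuous_onI)
    have "(\<integral>t. f t \<partial>N n) = (\<integral>t. 0 \<partial>N n)" for n
    proof (rule integral_cong_AE)
      show "AE t in N n. f t = 0" using N_AE by eventually_elim (auto simp: f_def)
    qed (use N[of n, THEN real_distribution.events_eq_borel] in \<open>auto simp: N_def\<close>)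
    then have "(\<integral>t. f t \<partial>M) = 0"
      using lim[OF f f1(1)] LIMSEQ_unique by (simp add: tendsto_const_iff)
    moreover have "integrable M f" using f1 by (intro M.integrable_const_bound[where B=1]) auto
    ultimately have "AE t in M. f t = 0"
      using integral_nonneg_eq_0_iff_AE[of M f] f1 by simp
    then show ?thesis by eventually_elim (auto simp: f_def min_def max_def split: if_splits)
  qed
  have "(\<integral>t. t ^ j \<partial>M) = d j 0" for j
  proof -
    \<comment> \<open>the power, made bounded without changing it on the unit interval\<close>
    define f where "f t = (min 1 (max 0 t)) ^ j" for t :: real
    have f: "continuous_on UNIV f" unfolding f_def by (intro continuous_intros)
    have [measurable]: "f \<in> borel_measurable borel" using f by (rule borel_measurable_continuous_onI)
    have f1: "\<bar>f t\<bar> \<le> 1" for t unfolding f_def by (auto intro!: power_le_one simp: power_abs[symmetric])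
    have "(\<integral>t. f t \<partial>N n) = (\<Sum>k\<le>n. real (n choose k) * d k (n - k) * (real k / real n) ^ j)" for n
    proof -
      have "f (real k / real n) = (real k / real n) ^ j" if "k \<le> n" for k
      proof -
        have "max 0 (real k / real n) = real k / real n" by simp
        moreover have "min 1 (real k / real n) = real k / real n" using that by (simp add: divide_le_eq)
        ultimately show ?thesis by (simp only: f_def)
      qed
      then show ?thesis
        unfolding N_int[OF \<open>f \<in> borel_measurable borel\<close>] w_def by (intro sum.cong refl) simp
    qed
    then have "(\<lambda>n. \<integral>t. f t \<partial>N (r n)) \<longlonglongrightarrow> d j 0"
      using LIMSEQ_subseq_LIMSEQ[OF moments_converge[of j] r] by (simp add: o_def)
    then have "(\<integral>t. f t \<partial>M) = d j 0" using lim[OF f f1] LIMSEQ_unique by blast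
    moreover have "(\<integral>t. f t \<partial>M) = (\<integral>t. t ^ j \<partial>M)"
    proof (rule integral_cong_AE)
      show "AE t in M. f t = t ^ j" using AE_M by eventually_elim (simp add: f_def)
    qed auto
    ultimately show ?thesis by simp
  qed
  moreover have "unit_measure M" unfolding unit_measure_def using AE_M M.finite_measure by simp
  ultimately show ?thesis by blast
qed

end

theorem hausdorff_moment:
  assumes "hausdorff_array d"
  shows "\<exists>M. unit_measure M \<and> (\<forall>j. (\<integral>t. t ^ j \<partial>M) = d j 0)"
proof -
  interpret hausdorff_array d by fact
  show ?thesis
  proof (cases "d 0 0 = 0")
    case True
    have "d j 0 = 0" for j using moment_mono[of j] nonneg[of j 0] True by simp
    moreover have "unit_measure (null_measure borel)"
      unfolding unit_measure_def by (auto intro!: finite_measureI AE_I[of _ _ UNIV])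
    moreover have "(\<integral>t. t ^ j \<partial>null_measure borel) = (0::real)" for j
      by (simp add: integral_null_measure)
    ultimately show ?thesis by auto
  next
    case False
    then have c: "d 0 0 > 0" using nonneg[of 0 0] by simp
    interpret n: hausdorff_array "\<lambda>a b. d a b / d 0 0"
    proof
      show "0 \<le> d a b / d 0 0" for a b using c nonneg by simp
      show "d a b / d 0 0 = d (Suc a) b / d 0 0 + d a (Suc b) / d 0 0" for a b
        unfolding add_divide_distrib[symmetric] rec[of a b, symmetric] ..
    qed
    obtain M where M: "unit_measure M" "\<And>j. (\<integral>t. t ^ j \<partial>M) = d j 0 / d 0 0"
      using n.exists_measure_normalized c by auto
    have s [measurable_cong]: "sets M = sets borel" using M by (simp add: unit_measure_def)
    define M' where "M' = density M (\<lambda>_. ennreal (d 0 0))"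
    have "emeasure M' (space M') = ennreal (d 0 0) * emeasure M (space M)"
      unfolding M'_def by (simp add: emeasure_density_const)
    moreover have "emeasure M (space M) < \<infinity>"
      using M(1) finite_measure.emeasure_finite[of M "space M"] by (simp add: unit_measure_def less_top)
    ultimately have "finite_measure M'"
      by (intro finite_measureI) (simp add: ennreal_mult_eq_top_iff)
    moreover have "AE t in M'. t \<in> {0..1}"
      using M(1) unfolding M'_def by (subst AE_density) (auto simp: unit_measure_def)
    moreover have "sets M' = sets borel" using s by (simp add: M'_def)
    ultimately have "unit_measure M'"
      unfolding unit_measure_def by blast
    moreover have "(\<integral>t. t ^ j \<partial>M') = d j 0" for j
      unfolding M'_def using c s by (subst integral_density) (auto simp: M)
    ultimately show ?thesis by blast
  qed
qed

section \<open>The spectral theorem for operators between zero and one\<close>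

text \<open>
  The operator \<open>G\<close> satisfies \<open>0 \<le> G \<le> 1\<close>. The numbers \<open>\<langle>x, G\<^sup>j x\<rangle>\<close> are the moments of a measure \<open>\<mu>\<^sub>x\<close>, by
  Hausdorff's theorem, and determinacy of the moment problem turns algebraic identities between these
  numbers into identities between the measures. In this way \<open>\<mu>\<^sub>x(B)\<close> is a bounded quadratic form in \<open>x\<close>,
  which the Riesz theorem represents by an operator; that is the spectral projection of \<open>B\<close>.
\<close>

locale positive_contraction =
  fixes G :: "('h::complex_hilbert) \<Rightarrow>\<^sub>L 'h"
  assumes sym: "symmetric_op G"
    and complex_linear: "G (scaleC \<i> x) = scaleC \<i> (G x)"
    and nonneg: "0 \<le> inner x (G x)"
    and le_one: "inner x (G x) \<le> inner x x"
begin

definition opow :: "nat \<Rightarrow> 'h \<Rightarrow> 'h" where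
  "opow j = blinfun_apply G ^^ j"

definition copow :: "nat \<Rightarrow> 'h \<Rightarrow> 'h" where
  "copow j = (\<lambda>x. x - G x) ^^ j"

lemma opow_simps: "opow 0 x = x" "opow (Suc j) x = G (opow j x)"
  by (simp_all add: opow_def)

lemma copow_simps: "copow 0 x = x" "copow (Suc j) x = copow j x - G (copow j x)"
  by (simp_all add: copow_def)

lemma opow_add: "opow j (x + y) = opow j x + opow j y"
  by (induction j) (simp_all add: opow_simps blinfun.add_right)

lemma opow_diff: "opow j (x - y) = opow j x - opow j y"
  by (induction j) (simp_all add: opow_simps blinfun.diff_right)

lemma opow_G: "opow j (G x) = G (opow j x)"
  by (induction j) (simp_all add: opow_simps)

lemma copow_G: "copow j (G x) = G (copow j x)"
  by (induction j) (simp_all add: copow_simps blinfun.diff_right)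

lemma copow_diff: "copow j (x - y) = copow j x - copow j y"
  by (induction j) (simp_all add: copow_simps blinfun.diff_right)

lemma opow_add_exponent: "opow (i + j) x = opow i (opow j x)"
  by (induction i) (simp_all add: opow_simps)

lemma opow_sym: "inner (opow j x) y = inner x (opow j y)"
  by (induction j arbitrary: x) (simp_all add: opow_simps symmetric_opD[OF sym] flip: opow_G)

lemma opow_polarization:
  "inner (x + y) (opow j (x + y)) - inner (x - y) (opow j (x - y)) = 4 * inner x (opow j y)"
  using opow_sym[of j x y] by (simp add: opow_add opow_diff inner_simps inner_commute)

lemma opow_commute:
  assumes "\<And>x. f (G x) = G (f x)" shows "f (opow j x) = opow j (f x)"
  by (induction j) (simp_all add: opow_simps assms)

definition moment_array :: "'h \<Rightarrow> nat \<Rightarrow> nat \<Rightarrow> real" where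
  "moment_array x a b = inner x (opow a (copow b x))"

lemma moment_array_rec: "moment_array x a b = moment_array x (Suc a) b + moment_array x a (Suc b)"
  by (simp add: moment_array_def opow_simps copow_simps opow_diff opow_G inner_simps)

lemma moment_array_shift_left: "moment_array x (Suc (Suc a)) b = moment_array (G x) a b"
proof -
  have "moment_array x (Suc (Suc a)) b = inner (G x) (G (opow a (copow b x)))"
    by (simp add: moment_array_def opow_simps symmetric_opD[OF sym])
  also have "G (opow a (copow b x)) = opow a (copow b (G x))" by (simp add: opow_G copow_G)
  finally show ?thesis by (simp add: moment_array_def)
qed

lemma moment_array_shift_right: "moment_array x a (Suc (Suc b)) = moment_array (x - G x) a b"
proof -
  define z where "z = opow a (copow b x)"
  have "opow a (copow (Suc (Suc b)) x) = (z - G z) - G (z - G z)"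
    by (simp add: copow_simps opow_diff opow_G z_def)
  then have "moment_array x a (Suc (Suc b)) = inner (x - G x) (z - G z)"
    by (simp add: moment_array_def inner_simps blinfun.diff_right symmetric_opD[OF sym])
  also have "z - G z = opow a (copow b (x - G x))"
    by (simp add: z_def copow_diff opow_diff copow_G opow_G)
  finally show ?thesis by (simp add: moment_array_def)
qed

text \<open>
  Squares can be moved to the outside of the form one after the other; the remaining case
  \<open>G (1 - G)\<close> is \<open>(1 - G) G (1 - G) + G (1 - G) G\<close>.
\<close>

lemma moment_array_nonneg: "0 \<le> moment_array x a b"
proof -
  have 10: "0 \<le> moment_array x 1 0" for x using nonneg by (simp add: moment_array_def opow_simps copow_simps)
  have 01: "0 \<le> moment_array x 0 1" for x using le_one[of x] by (simp add: moment_array_def opow_simps copow_simps inner_simps)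
  have 11: "0 \<le> moment_array x 1 1" for x
  proof -
    have "moment_array x 1 1 = moment_array x 2 1 + moment_array x 1 2"
      using moment_array_rec[of x 1 1] by (simp add: numeral_2_eq_2)
    also have "\<dots> = moment_array (G x) 0 1 + moment_array (x - G x) 1 0"
      by (simp add: numeral_2_eq_2 moment_array_shift_left moment_array_shift_right)
    finally show ?thesis using 01[of "G x"] 10[of "x - G x"] by linarith
  qed
  have base: "0 \<le> moment_array x a b" if "a \<le> 1" "b \<le> 1" for x a b
  proof -
    have "a = 0 \<or> a = 1" "b = 0 \<or> b = 1" using that by auto
    then show ?thesis using 10[of x] 01[of x] 11[of x] by (auto simp: moment_array_def opow_simps copow_simps)
  qed
  have "0 \<le> moment_array x a b" if "a \<le> 1" for x a b
    using that
  proof (induction b arbitrary: x rule: less_induct)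
    case (less b)
    show ?case
    proof (cases "b \<le> 1")
      case False
      then obtain b' where b: "b = Suc (Suc b')" by (metis One_nat_def Suc_le_mono nat.exhaust zero_le)
      show ?thesis unfolding b moment_array_shift_right using less.IH[of b' "x - G x"] less.prems b by simp
    qed (use base less in auto)
  qed
  note a1 = this
  show ?thesis
  proof (induction a arbitrary: x rule: less_induct)
    case (less a)
    show ?case
    proof (cases "a \<le> 1")
      case False
      then obtain a' where a: "a = Suc (Suc a')" by (metis One_nat_def Suc_le_mono nat.exhaust zero_le)
      show ?thesis unfolding a moment_array_shift_left using less.IH[of a' "G x"] a by simp
    qed (use a1 in auto)
  qed
qed

lemma moment_measure_exists:
  "\<exists>M. unit_measure M \<and> (\<forall>j. (\<integral>t. t ^ j \<partial>M) = inner x (opow j x))"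
proof -
  have "hausdorff_array (moment_array x)" by standard (rule moment_array_nonneg, rule moment_array_rec)
  then show ?thesis using hausdorff_moment[of "moment_array x"] by (simp add: moment_array_def copow_simps)
qed

definition moment_measure :: "'h \<Rightarrow> real measure" where
  "moment_measure x = (SOME M. unit_measure M \<and> (\<forall>j. (\<integral>t. t ^ j \<partial>M) = inner x (opow j x)))"

lemma moment_measure: "unit_measure (moment_measure x)" "(\<integral>t. t ^ j \<partial>moment_measure x) = inner x (opow j x)"
  using someI_ex[OF moment_measure_exists[of x]] unfolding moment_measure_def by auto

lemma sets_moment_measure [simp, measurable_cong]: "sets (moment_measure x) = sets borel"
  and finite_moment_measure: "finite_measure (moment_measure x)"
  and AE_moment_measure: "AE t in moment_measure x. t \<in> {0..1}"
  using moment_measure(1)[of x] by (auto simp: unit_measure_def)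

lemma space_moment_measure [simp]: "space (moment_measure x) = UNIV"
  using sets_eq_imp_space_eq[OF sets_moment_measure] by simp

lemma measure_moment_measure_UNIV: "measure (moment_measure x) UNIV = inner x x"
  using moment_measure(2)[where j=0 and x=x] by (simp add: opow_simps)

text \<open>
  By polarization this is \<open>\<langle>x, E(B) y\<rangle>\<close> for the projection \<open>E(B)\<close> to be constructed.
\<close>

definition moment_form :: "real set \<Rightarrow> 'h \<Rightarrow> 'h \<Rightarrow> real" where
  "moment_form B x y = (measure (moment_measure (x + y)) B - measure (moment_measure (x - y)) B) / 4"

text \<open>
  The tool by which every property of the projections is proved: a linear relation that holds between
  moments for all exponents holds between measures. The measures are either given, or polarized
  combinations of the \<open>\<mu>\<^sub>x\<close>.
\<close>

lemma moment_identity: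
  assumes ms: "\<And>c M. (c, M) \<in> set ms \<Longrightarrow> unit_measure M"
    and mom: "\<And>j. (\<Sum>(c, M)\<leftarrow>ms. c * (\<integral>t. t ^ j \<partial>M)) + (\<Sum>(c, x, y)\<leftarrow>xs. c * inner x (opow j y)) = 0"
    and B: "B \<in> sets borel"
  shows "(\<Sum>(c, M)\<leftarrow>ms. c * measure M B) + (\<Sum>(c, x, y)\<leftarrow>xs. c * moment_form B x y) = 0"
proof -
  define ys where "ys = concat (map (\<lambda>(c, x, y). [(c / 4, moment_measure (x + y)), (- c / 4, moment_measure (x - y))]) xs)"
  have ys: "(\<Sum>(c, M)\<leftarrow>ys. c * h M) = (\<Sum>(c, x, y)\<leftarrow>xs. c * ((h (moment_measure (x + y)) - h (moment_measure (x - y))) / 4))" for h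
    unfolding ys_def by (induction xs) (auto simp: field_simps)
  have h1: "(\<integral>t. t ^ j \<partial>moment_measure (x + y)) - (\<integral>t. t ^ j \<partial>moment_measure (x - y)) = 4 * inner x (opow j y)" for x y j
    unfolding moment_measure(2) by (rule opow_polarization)
  have "(\<Sum>(c, M)\<leftarrow>ms @ ys. c * measure M B) = 0"
  proof (rule moments_determine_sum_list[OF _ _ B])
    show "unit_measure M" if "(c, M) \<in> set (ms @ ys)" for c M
      using that ms moment_measure(1) by (auto simp: ys_def)
    show "(\<Sum>(c, M)\<leftarrow>ms @ ys. c * (\<integral>t. t ^ j \<partial>M)) = 0" for j
      using mom[of j] ys[of "\<lambda>M. \<integral>t. t ^ j \<partial>M"] by (simp add: h1)
  qed
  then show ?thesis using ys[of "\<lambda>M. measure M B"] by (simp add: moment_form_def)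
qed

lemma moment_form_identity:
  assumes "\<And>j. (\<Sum>(c, x, y)\<leftarrow>xs. c * inner x (opow j y)) = 0" "B \<in> sets borel"
  shows "(\<Sum>(c, x, y)\<leftarrow>xs. c * moment_form B x y) = 0"
  using moment_identity[of "[]" xs B] assms by simp

lemma moment_form_diag: "B \<in> sets borel \<Longrightarrow> moment_form B x x = measure (moment_measure x) B"
  using moment_identity[of "[(-1, moment_measure x)]" "[(1, x, x)]" B] by (simp add: moment_measure)

lemma moment_form_add_left: "B \<in> sets borel \<Longrightarrow> moment_form B (x + x') y = moment_form B x y + moment_form B x' y"
  using moment_form_identity[of "[(1, x + x', y), (-1, x, y), (-1, x', y)]" B] by (simp add: inner_simps)

lemma moment_form_scaleR_left: "B \<in> sets borel \<Longrightarrow> moment_form B (r *\<^sub>R x) y = r * moment_form B x y"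
  using moment_form_identity[of "[(1, r *\<^sub>R x, y), (- r, x, y)]" B] by simp

lemma moment_form_commute: "B \<in> sets borel \<Longrightarrow> moment_form B x y = moment_form B y x"
  using moment_form_identity[of "[(1, x, y), (-1, y, x)]" B] opow_sym by (simp add: inner_commute)

lemma moment_form_bounded_bilinear:
  assumes B: "B \<in> sets borel" shows "bounded_bilinear (moment_form B)"
proof
  show "moment_form B (x + x') y = moment_form B x y + moment_form B x' y" for x x' y using B by (rule moment_form_add_left)
  show "moment_form B x (y + y') = moment_form B x y + moment_form B x y'" for x y y'
    using moment_form_add_left[OF B] by (simp add: moment_form_commute[OF B, of x])
  show "moment_form B (r *\<^sub>R x) y = r *\<^sub>R moment_form B x y" for r x y using moment_form_scaleR_left[OF B] by simp
  show "moment_form B x (r *\<^sub>R y) = r *\<^sub>R moment_form B x y" for r x y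
    using moment_form_scaleR_left[OF B] by (simp add: moment_form_commute[OF B, of x])
  have 1: "\<bar>moment_form B x y\<bar> \<le> ((norm x)\<^sup>2 + (norm y)\<^sup>2) / 2" for x y
  proof -
    have le: "measure (moment_measure v) B \<le> inner v v" for v
      using finite_measure.bounded_measure[OF finite_moment_measure, of v B] by (simp add: measure_moment_measure_UNIV)
    have "\<bar>moment_form B x y\<bar> \<le> (inner (x + y) (x + y) + inner (x - y) (x - y)) / 4"
    proof -
      have "\<bar>measure (moment_measure (x + y)) B - measure (moment_measure (x - y)) B\<bar> \<le> inner (x + y) (x + y) + inner (x - y) (x - y)"
        using le[of "x + y"] le[of "x - y"] measure_nonneg[of "moment_measure (x + y)" B] measure_nonneg[of "moment_measure (x - y)" B]
        by linarith
      then show ?thesis by (simp add: moment_form_def divide_right_mono)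
    qed
    also have "\<dots> = ((norm x)\<^sup>2 + (norm y)\<^sup>2) / 2"
      by (simp add: power2_norm_eq_inner inner_simps inner_commute)
    finally show ?thesis .
  qed
  have zl: "moment_form B 0 y = 0" for y using moment_form_scaleR_left[OF B, of 0 0 y] by simp
  have zr: "moment_form B x 0 = 0" for x using zl[of x] moment_form_commute[OF B, of x 0] by simp
  have "\<bar>moment_form B x y\<bar> \<le> norm x * norm y" for x y
  proof (cases "x = 0 \<or> y = 0")
    case False
    define u v where "u = (1 / norm x) *\<^sub>R x" and "v = (1 / norm y) *\<^sub>R y"
    have xy: "x = norm x *\<^sub>R u" "y = norm y *\<^sub>R v" using False by (auto simp: u_def v_def)
    have "moment_form B (norm x *\<^sub>R u) (norm y *\<^sub>R v) = norm x * moment_form B u (norm y *\<^sub>R v)"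
      by (rule moment_form_scaleR_left[OF B])
    also have "moment_form B u (norm y *\<^sub>R v) = norm y * moment_form B u v"
      unfolding moment_form_commute[OF B, of u] by (rule moment_form_scaleR_left[OF B])
    finally have "moment_form B x y = norm x * (norm y * moment_form B u v)"
      unfolding xy[symmetric] .
    moreover have "\<bar>moment_form B u v\<bar> \<le> 1" using 1[of u v] False by (simp add: u_def v_def)
    then have "norm x * (norm y * \<bar>moment_form B u v\<bar>) \<le> norm x * (norm y * 1)"
      by (intro mult_left_mono) auto
    ultimately show ?thesis by (simp add: abs_mult)
  qed (auto simp: zl zr)
  then show "\<exists>K. \<forall>x y. norm (moment_form B x y) \<le> norm x * norm y * K"
    by (intro exI[of _ 1]) simp
qed

definition proj :: "real set \<Rightarrow> 'h \<Rightarrow>\<^sub>L 'h" where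
  "proj B = (if B \<in> sets borel then (SOME T :: 'h \<Rightarrow>\<^sub>L 'h. \<forall>x y. inner x (T y) = moment_form B x y) else 0)"

lemma inner_proj: "B \<in> sets borel \<Longrightarrow> inner x (proj B y) = moment_form B x y"
  unfolding proj_def using someI_ex[OF bounded_form_operator[OF moment_form_bounded_bilinear[of B]]] by simp

lemma inner_proj_diag: "B \<in> sets borel \<Longrightarrow> inner x (proj B x) = measure (moment_measure x) B"
  by (simp add: inner_proj moment_form_diag)

lemma proj_symmetric: "B \<in> sets borel \<Longrightarrow> symmetric_op (proj B)"
  unfolding symmetric_op_def using inner_proj moment_form_commute by (metis inner_commute)

text \<open>
  The forms \<open>\<langle>f u, E(B) x\<rangle>\<close> and \<open>\<langle>u, E(B) f x\<rangle>\<close> have the same moments, because \<open>f\<close> is symmetric and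
  commutes with the powers of \<open>G\<close>.
\<close>

lemma proj_commute_symmetric:
  assumes B: "B \<in> sets borel" and S: "\<And>x y. inner (f x) y = inner x (f y)" "\<And>x. f (G x) = G (f x)"
  shows "f (proj B x) = proj B (f x)"
proof -
  have "inner u (f (proj B x)) = inner u (proj B (f x))" for u
  proof -
    have "moment_form B (f u) x = moment_form B u (f x)"
      using moment_form_identity[of "[(1, f u, x), (-1, u, f x)]" B] B
      by (simp add: S opow_commute[of f, symmetric])
    then show ?thesis by (simp add: inner_proj[OF B] flip: S(1))
  qed
  then show ?thesis using vector_eq_ldot by blast
qed

lemma proj_G: "B \<in> sets borel \<Longrightarrow> proj B (G x) = G (proj B x)"
  using proj_commute_symmetric[of B "blinfun_apply G" x] by (simp add: symmetric_opD[OF sym])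

lemma proj_commute: "B \<in> sets borel \<Longrightarrow> C \<in> sets borel \<Longrightarrow> proj B (proj C x) = proj C (proj B x)"
  using proj_commute_symmetric[of C "blinfun_apply (proj B)" x]
  by (simp add: symmetric_opD[OF proj_symmetric] proj_G)

lemma proj_scaleC_ii:
  assumes B: "B \<in> sets borel" shows "proj B (scaleC \<i> x) = scaleC \<i> (proj B x)"
proof -
  have "inner u (proj B (scaleC \<i> x)) = inner u (scaleC \<i> (proj B x))" for u
  proof -
    \<comment> \<open>multiplication by \<open>i\<close> preserves inner products and commutes with \<open>G\<close>, hence it preserves moments\<close>
    have u: "u = scaleC \<i> (- scaleC \<i> u)" by (simp add: scaleC_minus scaleC_ii_ii)
    have opow: "opow j (scaleC \<i> x) = scaleC \<i> (opow j x)" for j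
      by (rule opow_commute[symmetric]) (simp add: complex_linear)
    have "moment_form B (scaleC \<i> (- scaleC \<i> u)) (scaleC \<i> x) = moment_form B (- scaleC \<i> u) x"
      using moment_form_identity[of "[(1, scaleC \<i> (- scaleC \<i> u), scaleC \<i> x), (-1, - scaleC \<i> u, x)]" B] B
      by (simp add: opow inner_scaleC_ii del: inner_minus_left)
    then have "inner u (proj B (scaleC \<i> x)) = inner (- scaleC \<i> u) (proj B x)"
      using u by (simp add: inner_proj[OF B])
    also have "\<dots> = inner (scaleC \<i> (- scaleC \<i> u)) (scaleC \<i> (proj B x))"
      by (simp add: inner_scaleC_ii del: inner_minus_left)
    finally show ?thesis using u by simp
  qed
  then show ?thesis using vector_eq_ldot by blast
qed

lemma density_moment_measure:
  assumes w [measurable]: "w \<in> borel_measurable borel" and w1: "\<And>t. t \<in> {0..1} \<Longrightarrow> 0 \<le> w t \<and> w t \<le> 1"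
  shows "unit_measure (density (moment_measure x) (\<lambda>t. ennreal (w t)))"
    and "(\<integral>t. t ^ j \<partial>density (moment_measure x) (\<lambda>t. ennreal (w t))) = (\<integral>t. w t * t ^ j \<partial>moment_measure x)"
    and "B \<in> sets borel \<Longrightarrow> measure (density (moment_measure x) (\<lambda>t. ennreal (w t))) B = (\<integral>t. w t * indicator B t \<partial>moment_measure x)"
proof -
  have nn: "AE t in moment_measure x. 0 \<le> w t" using AE_moment_measure[of x] by eventually_elim (simp add: w1)
  have "(\<integral>\<^sup>+t. ennreal (w t) \<partial>moment_measure x) \<le> (\<integral>\<^sup>+t. 1 \<partial>moment_measure x)"
  proof (rule nn_integral_mono_AE)
    show "AE t in moment_measure x. ennreal (w t) \<le> 1" using AE_moment_measure[of x] by eventually_elim (simp add: w1)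
  qed
  also have "\<dots> < \<infinity>" using finite_measure.emeasure_finite[OF finite_moment_measure, of x UNIV] by (simp add: less_top)
  finally have "finite_measure (density (moment_measure x) (\<lambda>t. ennreal (w t)))"
    by (intro finite_measureI) (simp add: emeasure_density)
  moreover have "AE t in density (moment_measure x) (\<lambda>t. ennreal (w t)). t \<in> {0..1}"
    using AE_moment_measure[of x] by (subst AE_density) (auto elim: eventually_mono)
  ultimately show u: "unit_measure (density (moment_measure x) (\<lambda>t. ennreal (w t)))"
    unfolding unit_measure_def by simp
  show "(\<integral>t. t ^ j \<partial>density (moment_measure x) (\<lambda>t. ennreal (w t))) = (\<integral>t. w t * t ^ j \<partial>moment_measure x)"
    using nn by (subst integral_density) auto
  show "measure (density (moment_measure x) (\<lambda>t. ennreal (w t))) B = (\<integral>t. w t * indicator B t \<partial>moment_measure x)" if B: "B \<in> sets borel"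
  proof -
    have "measure (density (moment_measure x) (\<lambda>t. ennreal (w t))) B = (\<integral>t. indicator B t \<partial>density (moment_measure x) (\<lambda>t. ennreal (w t)))"
      using B by simp
    also have "\<dots> = (\<integral>t. w t * indicator B t \<partial>moment_measure x)"
      using nn B by (subst integral_density) auto
    finally show ?thesis .
  qed
qed

text \<open>
  The measure \<open>t\<^sup>j d\<mu>\<^sub>x\<close> has the moments \<open>\<langle>x, G\<^sup>i G\<^sup>j x\<rangle>\<close>, which belong to the polarized measure for \<open>x\<close>
  and \<open>G\<^sup>j x\<close>.
\<close>

lemma proj_moment:
  assumes B: "B \<in> sets borel"
  shows "inner x (proj B (opow j x)) = (\<integral>t. indicator B t * t ^ j \<partial>moment_measure x)"
proof -
  define D where "D = density (moment_measure x) (\<lambda>t. ennreal (t ^ j))"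
  have w: "(\<lambda>t::real. t ^ j) \<in> borel_measurable borel" "\<And>t::real. t \<in> {0..1} \<Longrightarrow> 0 \<le> t ^ j \<and> t ^ j \<le> 1"
    by (auto simp: power_le_one)
  have "(\<integral>t. t ^ i \<partial>D) = inner x (opow i (opow j x))" for i
    using density_moment_measure(2)[OF w, of x i] by (simp add: D_def moment_measure(2) add.commute flip: power_add opow_add_exponent)
  then have "measure D B = moment_form B x (opow j x)"
    using moment_identity[of "[(1, D)]" "[(-1, x, opow j x)]" B] B density_moment_measure(1)[OF w] by (simp add: D_def)
  then show ?thesis
    using density_moment_measure(3)[OF w B, of x] by (simp add: D_def inner_proj[OF B] mult.commute)
qed

text \<open>
  By the preceding lemma the restriction of \<open>\<mu>\<^sub>x\<close> to \<open>C\<close> has the moments \<open>\<langle>x, G\<^sup>i E(C) x\<rangle>\<close>, so it is the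
  polarized measure for \<open>x\<close> and \<open>E(C) x\<close>.
\<close>

lemma proj_Int:
  assumes B: "B \<in> sets borel" and C: "C \<in> sets borel"
  shows "proj (B \<inter> C) = proj B o\<^sub>L proj C"
proof (rule symmetric_op_eqI)
  show "symmetric_op (proj (B \<inter> C))" using B C by (intro proj_symmetric) auto
  show "symmetric_op (proj B o\<^sub>L proj C)"
    unfolding symmetric_op_def
    by (simp add: symmetric_opD[OF proj_symmetric] B C proj_commute)
  fix x
  define D where "D = density (moment_measure x) (\<lambda>t. ennreal (indicator C t))"
  have w: "(indicator C :: real \<Rightarrow> real) \<in> borel_measurable borel" "\<And>t::real. t \<in> {0..1} \<Longrightarrow> 0 \<le> indicat_real C t \<and> indicat_real C t \<le> 1"
    using C by (auto simp: indicator_def)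
  have "(\<integral>t. t ^ i \<partial>D) = inner x (opow i (proj C x))" for i
  proof -
    have "opow i (proj C x) = proj C (opow i x)" using C by (intro opow_commute[symmetric]) (simp add: proj_G)
    then show ?thesis using density_moment_measure(2)[OF w, of x i] proj_moment[OF C, of x i] by (simp add: D_def)
  qed
  then have "measure D B = moment_form B x (proj C x)"
    using moment_identity[of "[(1, D)]" "[(-1, x, proj C x)]" B] B density_moment_measure(1)[OF w] by (simp add: D_def)
  moreover have "measure D B = measure (moment_measure x) (B \<inter> C)"
  proof -
    have "measure D B = (\<integral>t. indicator (B \<inter> C) t \<partial>moment_measure x)"
    proof -
      have "indicat_real C t * indicat_real B t = indicator (B \<inter> C) t" for t
        by (auto simp: indicator_def)
      then show ?thesis using density_moment_measure(3)[OF w B, of x] by (simp only: D_def)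
    qed
    also have "\<dots> = measure (moment_measure x) (B \<inter> C)" using B C by simp
    finally show ?thesis .
  qed
  ultimately show "inner x (proj (B \<inter> C) x) = inner x ((proj B o\<^sub>L proj C) x)"
    using B C by (simp add: inner_proj[OF B] inner_proj_diag)
qed

lemma proj_norm_sq:
  assumes B: "B \<in> sets borel" shows "(norm (proj B x))\<^sup>2 = measure (moment_measure x) B"
proof -
  have "(norm (proj B x))\<^sup>2 = inner x (proj B (proj B x))"
    by (simp add: power2_norm_eq_inner symmetric_opD[OF proj_symmetric[OF B]])
  also have "proj B (proj B x) = proj (B \<inter> B) x" unfolding proj_Int[OF B B] by simp
  finally show ?thesis by (simp add: inner_proj_diag B)
qed

lemma proj_diff:
  assumes B: "B \<in> sets borel" and C: "C \<in> sets borel" and "C \<subseteq> B"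
  shows "proj (B - C) = proj B - proj C"
proof (rule symmetric_op_eqI)
  have BC: "B - C \<in> sets borel" using B C by (rule sets.Diff)
  show "symmetric_op (proj (B - C))" by (rule proj_symmetric[OF BC])
  show "symmetric_op (proj B - proj C)" by (intro symmetric_op_diff proj_symmetric B C)
  show "inner x (proj (B - C) x) = inner x ((proj B - proj C) x)" for x
    using finite_measure.finite_measure_Diff[OF finite_moment_measure, of B x C] assms
    by (simp add: blinfun.diff_left inner_diff_right inner_proj_diag[OF BC] inner_proj_diag[OF B] inner_proj_diag[OF C])
qed

lemma proj_UNIV: "proj UNIV = id_blinfun"
proof (rule symmetric_op_eqI)
  show "symmetric_op (proj UNIV)" by (rule proj_symmetric) simp
  show "symmetric_op (id_blinfun :: 'h \<Rightarrow>\<^sub>L 'h)" by (simp add: symmetric_op_def)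
  show "inner x (proj UNIV x) = inner x (id_blinfun x)" for x by (simp add: inner_proj_diag measure_moment_measure_UNIV)
qed

text \<open>
  The remainder after \<open>n\<close> terms is \<open>E(V\<^sub>n) x\<close> for sets \<open>V\<^sub>n\<close> that decrease to the empty set, and its
  norm is \<open>\<mu>\<^sub>x(V\<^sub>n)\<^sup>1\<^sup>/\<^sup>2\<close>.
\<close>

lemma proj_sums:
  fixes A :: "nat \<Rightarrow> real set"
  assumes A: "range A \<subseteq> sets borel" "disjoint_family A"
  shows "(\<lambda>n. proj (A n) x) sums proj (\<Union>n. A n) x"
proof -
  define U where "U n = (\<Union>i<n. A i)" for n
  have U: "U n \<in> sets borel" for n using A(1) unfolding U_def by auto
  have UN: "(\<Union>n. A n) \<in> sets borel" using A(1) by auto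
  have sum: "(\<Sum>i<n. proj (A i) x) = proj (U n) x" for n
  proof (induction n)
    case 0
    have "proj {} = 0" using proj_diff[of UNIV UNIV] by simp
    then show ?case by (simp add: U_def)
  next
    case (Suc n)
    have "A n \<inter> A i = {}" if "i < n" for i
      using disjoint_family_onD[OF A(2), of n i] that by simp
    then have "A n \<inter> U n = {}" unfolding U_def by blast
    then have "U (Suc n) - U n = A n" unfolding U_def by (auto simp: less_Suc_eq)
    moreover have "U n \<subseteq> U (Suc n)" unfolding U_def by (auto simp: less_Suc_eq)
    ultimately have "proj (A n) = proj (U (Suc n)) - proj (U n)"
      using proj_diff[OF U[of "Suc n"] U[of n]] by simp
    then show ?case using Suc by (simp add: blinfun.diff_left)
  qed
  define V where "V n = (\<Union>n. A n) - U n" for n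
  have V: "V n \<in> sets borel" for n unfolding V_def using U UN by simp
  have "U n \<subseteq> (\<Union>n. A n)" for n by (auto simp: U_def)
  then have "proj (V n) x = proj (\<Union>n. A n) x - proj (U n) x" for n
    unfolding V_def using proj_diff[OF UN U] by (simp add: blinfun.diff_left)
  then have eq: "norm (proj (U n) x - proj (\<Union>n. A n) x) = sqrt (measure (moment_measure x) (V n))" for n
    using proj_norm_sq[OF V[of n], of x] by (metis norm_minus_commute norm_ge_zero real_sqrt_unique)
  have "decseq V"
    unfolding decseq_def V_def U_def by (intro allI impI Diff_mono order_refl UN_mono) auto
  moreover have "(\<Inter>n. V n) = {}" unfolding V_def U_def by blast
  ultimately have "(\<lambda>n. measure (moment_measure x) (V n)) \<longlonglongrightarrow> measure (moment_measure x) {}"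
    using finite_measure.finite_Lim_measure_decseq[OF finite_moment_measure, of V x] V by auto
  then have "(\<lambda>n. sqrt (measure (moment_measure x) (V n))) \<longlonglongrightarrow> sqrt 0"
    by (intro tendsto_real_sqrt) simp
  then have "(\<lambda>n. proj (U n) x - proj (\<Union>n. A n) x) \<longlonglongrightarrow> 0"
    by (subst tendsto_norm_zero_iff[symmetric]) (simp add: eq)
  then show ?thesis unfolding sums_def sum by (rule LIM_zero_cancel)
qed

lemma proj_pvm: "projection_valued_measure proj"
  unfolding projection_valued_measure_def
proof (intro conjI allI ballI impI)
  show "proj A = 0" if "A \<notin> sets borel" for A using that by (simp add: proj_def)
  show "proj A o\<^sub>L proj A = proj A" if "A \<in> sets borel" for A using proj_Int[OF that that] by simp
  show "proj (A \<inter> B) = proj A o\<^sub>L proj B" if "A \<in> sets borel" "B \<in> sets borel" for A B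
    using that by (rule proj_Int)
  show "cinner (proj A x) y = cinner x (proj A y)" if "A \<in> sets borel" for A x y
    by (simp add: complex_eq_iff Re_cinner Im_cinner symmetric_opD[OF proj_symmetric[OF that]] proj_scaleC_ii[OF that])
  show "(\<lambda>n. proj (A n) x) sums proj (\<Union>n. A n) x" if "range A \<subseteq> sets borel" "disjoint_family A" for A x
    using that by (rule proj_sums)
qed (rule proj_UNIV)

lemma scalar_measure_proj: "scalar_measure proj x = moment_measure x"
proof (rule measure_eqI)
  have pvm: "pvm proj" by (rule pvm.intro[OF proj_pvm])
  show sets: "sets (scalar_measure proj x) = sets (moment_measure x)" by (simp add: pvm.sets_mu[OF pvm])
  fix A assume "A \<in> sets (scalar_measure proj x)"
  then have A: "A \<in> sets borel" by (simp add: sets)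
  show "emeasure (scalar_measure proj x) A = emeasure (moment_measure x) A"
    by (simp add: pvm.emeasure_mu[OF pvm] A inner_proj_diag finite_measure.emeasure_eq_measure[OF finite_moment_measure])
qed

end

theorem unit_operator_spectral:
  assumes "positive_contraction G"
  shows "\<exists>E. projection_valued_measure E \<and> 
    (\<forall>x. (AE t in scalar_measure E x. t \<in> {0..1}) \<and> (\<integral>t. t \<partial>scalar_measure E x) = inner x (G x))"
proof -
  interpret positive_contraction G by fact
  have "(AE t in scalar_measure proj x. t \<in> {0..1}) \<and> (\<integral>t. t \<partial>scalar_measure proj x) = inner x (G x)" for x
    unfolding scalar_measure_proj using AE_moment_measure[of x] moment_measure(2)[where j=1 and x=x] by (simp add: opow_simps)
  then show ?thesis using proj_pvm by blast
qed

section \<open>Push-forward of a projection-valued measure\<close>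

text \<open>
  The change of variables is used twice: with \<open>t \<mapsto> l / t\<close> to pass from a bounded operator to its inverse, and
  with \<open>t \<mapsto> t + c\<close> to pass from \<open>L\<close> to \<open>L + c\<close>.
\<close>

definition push_pvm :: "(real \<Rightarrow> real) \<Rightarrow> (real set \<Rightarrow> ('h::complex_hilbert) \<Rightarrow>\<^sub>L 'h) \<Rightarrow> real set \<Rightarrow> 'h \<Rightarrow>\<^sub>L 'h" where
  "push_pvm \<phi> E A = (if A \<in> sets borel then E (\<phi> -` A) else 0)"

lemma push_pvm:
  assumes E: "projection_valued_measure E" and \<phi>: "\<phi> \<in> borel_measurable borel"
  shows "projection_valued_measure (push_pvm \<phi> E)"
proof -
  interpret pvm E by (rule pvm.intro[OF E])
  have v: "\<phi> -` A \<in> sets borel" if "A \<in> sets borel" for A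
    using measurable_sets_borel[OF \<phi> that] .
  show ?thesis
    unfolding projection_valued_measure_def
  proof (intro conjI allI ballI impI)
    show "push_pvm \<phi> E A = 0" if "A \<notin> sets borel" for A using that by (simp add: push_pvm_def)
    show "push_pvm \<phi> E A o\<^sub>L push_pvm \<phi> E A = push_pvm \<phi> E A" if "A \<in> sets borel" for A
      using that v by (intro blinfun_eqI) (simp add: push_pvm_def proj_idem)
    show "cinner (push_pvm \<phi> E A x) y = cinner x (push_pvm \<phi> E A y)" if "A \<in> sets borel" for A x y
      using that v by (simp add: push_pvm_def proj_cinner)
    show "push_pvm \<phi> E UNIV = id_blinfun" by (intro blinfun_eqI) (simp add: push_pvm_def)
    show "push_pvm \<phi> E (A \<inter> B) = push_pvm \<phi> E A o\<^sub>L push_pvm \<phi> E B" if "A \<in> sets borel" "B \<in> sets borel" for A B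
      using that v by (intro blinfun_eqI) (simp add: push_pvm_def proj_Int)
    show "(\<lambda>n. push_pvm \<phi> E (A n) x) sums push_pvm \<phi> E (\<Union>n. A n) x"
      if A: "range A \<subseteq> sets borel" "disjoint_family A" for A :: "nat \<Rightarrow> real set" and x
    proof -
      have An: "A n \<in> sets borel" for n using A(1) by blast
      have "range (\<lambda>n. \<phi> -` A n) \<subseteq> sets borel" using v An by blast
      moreover have "disjoint_family (\<lambda>n. \<phi> -` A n)"
        using A(2) unfolding disjoint_family_on_def by blast
      ultimately have "(\<lambda>n. E (\<phi> -` A n) x) sums E (\<Union>n. \<phi> -` A n) x" by (rule proj_sums)
      then show ?thesis using An sets.countable_UN[OF A(1)] by (simp add: push_pvm_def vimage_UN)
    qed
  qed
qed

lemma scalar_measure_push_pvm: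
  assumes E: "projection_valued_measure E" and \<phi>: "\<phi> \<in> borel_measurable borel"
  shows "scalar_measure (push_pvm \<phi> E) x = distr (scalar_measure E x) borel \<phi>"
proof -
  have p: "pvm E" "pvm (push_pvm \<phi> E)" using E push_pvm[OF E \<phi>] by (auto intro: pvm.intro)
  have \<phi>': "\<phi> \<in> measurable (scalar_measure E x) borel"
    using \<phi> by (simp add: measurable_cong_sets[OF pvm.sets_mu[OF p(1)] refl])
  show ?thesis
  proof (rule measure_eqI)
    show "sets (scalar_measure (push_pvm \<phi> E) x) = sets (distr (scalar_measure E x) borel \<phi>)"
      by (simp add: pvm.sets_mu[OF p(2)])
    fix A assume "A \<in> sets (scalar_measure (push_pvm \<phi> E) x)"
    then have A: "A \<in> sets borel" by (simp add: pvm.sets_mu[OF p(2)])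
    show "emeasure (scalar_measure (push_pvm \<phi> E) x) A = emeasure (distr (scalar_measure E x) borel \<phi>) A"
      using A measurable_sets_borel[OF \<phi> A]
      by (simp add: emeasure_distr[OF \<phi>'] pvm.emeasure_mu[OF p(1)] pvm.emeasure_mu[OF p(2)] pvm.space_mu[OF p(1)] push_pvm_def)
  qed
qed

lemma is_spectral_integral_push_pvm:
  assumes E: "projection_valued_measure E" and \<phi>: "\<phi> \<in> borel_measurable borel" and f: "f \<in> borel_measurable borel"
  shows "is_spectral_integral (push_pvm \<phi> E) f T \<longleftrightarrow> is_spectral_integral E (\<lambda>t. f (\<phi> t)) T"
proof -
  have p: "pvm E" using E by (rule pvm.intro)
  have \<phi>': "\<phi> \<in> measurable (scalar_measure E x) borel" for x
    using \<phi> by (simp add: measurable_cong_sets[OF pvm.sets_mu[OF p] refl])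
  have 1: "(\<integral>\<^sup>+t. ennreal ((f t)\<^sup>2) \<partial>scalar_measure (push_pvm \<phi> E) x) = (\<integral>\<^sup>+t. ennreal ((f (\<phi> t))\<^sup>2) \<partial>scalar_measure E x)" for x
    unfolding scalar_measure_push_pvm[OF E \<phi>] using f by (subst nn_integral_distr[OF \<phi>']) auto
  have 2: "(\<integral>t. f t \<partial>scalar_measure (push_pvm \<phi> E) x) = (\<integral>t. f (\<phi> t) \<partial>scalar_measure E x)" for x
    unfolding scalar_measure_push_pvm[OF E \<phi>] using f by (subst integral_distr[OF \<phi>']) auto
  show ?thesis unfolding is_spectral_integral_def 1 2 ..
qed

section \<open>Uniqueness of the spectral measure\<close>

lemma linear_op_scaleR:
  assumes "linear_op L" "x \<in> dom L"
  shows "r *\<^sub>R x \<in> dom L" "app L (r *\<^sub>R x) = r *\<^sub>R app L x"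
  using assms unfolding linear_op_def by (metis scaleC_of_real)+

lemma linear_op_add:
  assumes "linear_op L" "x \<in> dom L" "y \<in> dom L"
  shows "x + y \<in> dom L" "app L (x + y) = app L x + app L y"
  using assms unfolding linear_op_def by blast+

lemma linear_op_scaleC:
  assumes "linear_op L" "x \<in> dom L"
  shows "scaleC c x \<in> dom L" "app L (scaleC c x) = scaleC c (app L x)"
  using assms unfolding linear_op_def by blast+

lemma linear_op_diff:
  assumes L: "linear_op L" "x \<in> dom L" "y \<in> dom L"
  shows "x - y \<in> dom L" "app L (x - y) = app L x - app L y"
proof -
  have "- y \<in> dom L" "app L (- y) = - app L y"
    using linear_op_scaleR[OF L(1,3), of "-1"] by simp_all
  then have "x + (- y) \<in> dom L \<and> app L (x + (- y)) = app L x + (- app L y)"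
    using L unfolding linear_op_def by metis
  then show "x - y \<in> dom L" "app L (x - y) = app L x - app L y" by simp_all
qed

lemma bounded_below_inj:
  assumes L: "linear_op L" "bounded_below_op l L" "l > 0" and xy: "x \<in> dom L" "y \<in> dom L" "app L x = app L y"
  shows "x = y"
proof -
  have "l * inner (x - y) (x - y) \<le> inner (x - y) (app L (x - y))"
    using linear_op_diff(1)[OF L(1) xy(1,2)] L(2) unfolding bounded_below_op_def Re_cinner by blast
  then have "l * inner (x - y) (x - y) \<le> 0" using linear_op_diff(2)[OF L(1) xy(1,2)] xy(3) by simp
  then have "inner (x - y) (x - y) \<le> 0" using L(3) by (simp add: mult_le_0_iff)
  then show ?thesis by (simp add: inner_le_zero_iff)
qed

text \<open>
  The value zero below \<open>l\<close> makes the function bounded; it lies outside the spectrum of an operator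
  \<open>L \<ge> l\<close>.
\<close>

definition cut_inverse :: "real \<Rightarrow> real \<Rightarrow> real" where
  "cut_inverse l t = (if l \<le> t then 1 / t else 0)"

lemma cut_inverse_measurable [measurable]: "cut_inverse l \<in> borel_measurable borel"
  unfolding cut_inverse_def[abs_def] by measurable

locale spectral_pair = pvm E for E :: "real set \<Rightarrow> ('h::complex_hilbert) \<Rightarrow>\<^sub>L 'h" +
  fixes L :: "'h unb_op" and l :: real
  assumes spec_int: "is_spectral_integral E (\<lambda>t. t) L"
    and l: "l > 0" and below: "bounded_below_op l L"
begin

lemma linear: "linear_op L"
  using spec_int by (simp add: is_spectral_integral_def)

lemma dom_iff: "x \<in> dom L \<longleftrightarrow> (\<integral>\<^sup>+t. ennreal (t\<^sup>2) \<partial>mu x) < \<infinity>"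
  using spec_int by (auto simp: is_spectral_integral_def)

lemma cinner_app: "x \<in> dom L \<Longrightarrow> cinner x (app L x) = complex_of_real (\<integral>t. t \<partial>mu x)"
  using spec_int by (auto simp: is_spectral_integral_def)

text \<open>
  On the range of \<open>E [- k, l - \<epsilon>]\<close> the quadratic form of \<open>L\<close> is at most \<open>l - \<epsilon>\<close>, hence this range is zero.
\<close>

lemma spectral_gap: "AE t in mu x. l \<le> t"
proof -
  have "AE t in mu x. \<not> (- real k \<le> t \<and> t \<le> l - 1 / (real k + 1))" for k
  proof -
    define B where "B = {- real k .. l - 1 / (real k + 1)}"
    define y where "y = E B x"
    have B: "B \<in> sets borel" by (simp add: B_def)
    have mu_y: "mu y = density (mu x) (\<lambda>t. ennreal ((indicator B t)\<^sup>2))"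
      using mu_calc[of "indicator B" x] B by (simp add: calc_indicator y_def)
    have AE_y: "AE t in mu y. t \<in> B"
      unfolding mu_y by (subst AE_density) (use B in \<open>auto simp: indicator_def\<close>)
    have fin: "finite_measure (mu y)" by (rule finite_measure_mu)
    define c where "c = max \<bar>- real k\<bar> \<bar>l - 1 / (real k + 1)\<bar>"
    have Bc: "\<bar>t\<bar> \<le> c" if "t \<in> B" for t using that unfolding B_def c_def by auto
    have sq: "(\<integral>\<^sup>+t. ennreal (t\<^sup>2) \<partial>mu y) < \<infinity>"
    proof -
      have "(\<integral>\<^sup>+t. ennreal (t\<^sup>2) \<partial>mu y) \<le> (\<integral>\<^sup>+t. ennreal (c\<^sup>2) \<partial>mu y)"
      proof (rule nn_integral_mono_AE)
        show "AE t in mu y. ennreal (t\<^sup>2) \<le> ennreal (c\<^sup>2)"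
          using AE_y by eventually_elim (use Bc in \<open>auto intro!: ennreal_leI power2_le_iff_abs_le[THEN iffD2] simp: c_def\<close>)
      qed
      also have "\<dots> < \<infinity>"
        using finite_measure.emeasure_finite[OF fin, of UNIV] by (simp add: ennreal_mult_less_top less_top)
      finally show ?thesis .
    qed
    then have y: "y \<in> dom L" by (simp add: dom_iff)
    have int: "integrable (mu y) (\<lambda>t. t)"
    proof (rule finite_measure.integrable_const_bound[OF fin, where B=c])
      show "AE t in mu y. norm t \<le> c" using AE_y by eventually_elim (use Bc in auto)
    qed simp
    have "l * inner y y \<le> inner y (app L y)"
      using below y unfolding bounded_below_op_def Re_cinner by blast
    also have "inner y (app L y) = (\<integral>t. t \<partial>mu y)"
      using cinner_app[OF y] by (simp flip: Re_cinner)
    also have "\<dots> \<le> (\<integral>t. l - 1 / (real k + 1) \<partial>mu y)"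
    proof (rule integral_mono_AE[OF int])
      show "AE t in mu y. t \<le> l - 1 / (real k + 1)" using AE_y by eventually_elim (simp add: B_def)
    qed (use finite_measure.integrable_const[OF fin] in auto)
    also have "\<dots> = (l - 1 / (real k + 1)) * inner y y" by (simp add: measure_mu_UNIV)
    finally have "(1 / (real k + 1)) * inner y y \<le> 0" by (simp add: algebra_simps)
    then have "inner y y \<le> 0" by (simp add: divide_le_0_iff)
    then have "E B x = 0" by (simp add: inner_le_zero_iff y_def)
    then have "emeasure (mu x) B = 0" by (simp add: emeasure_mu B)
    then have "AE t in mu x. t \<notin> B"
      using B by (intro AE_I[where N=B]) auto
    then show ?thesis by (simp add: B_def)
  qed
  then have "AE t in mu x. \<forall>k. \<not> (- real k \<le> t \<and> t \<le> l - 1 / (real k + 1))"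
    by (simp add: AE_all_countable)
  then show ?thesis
  proof eventually_elim
    case (elim t)
    show "l \<le> t"
    proof (rule ccontr)
      assume "\<not> l \<le> t"
      then have lt: "l - t > 0" by simp
      obtain k where k: "max (- t) (1 / (l - t)) < real k" using reals_Archimedean2 by blast
      then have "1 / (l - t) < real k + 1" by simp
      then have "1 / (real k + 1) < l - t" using lt by (simp add: field_simps)
      then show False using elim k by (auto dest!: spec[of _ k])
    qed
  qed
qed

abbreviation recip :: "real \<Rightarrow> real" where
  "recip \<equiv> cut_inverse l"

lemma recip_bborel [simp]: "recip \<in> bborel"
proof (rule bborelI)
  show "recip \<in> borel_measurable borel" by measurable
  show "\<bar>recip t\<bar> \<le> 1 / l" for t using l by (auto simp: cut_inverse_def frac_le)
qed

lemma resolvent_dom: "calc recip x \<in> dom L"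
proof -
  have "(\<integral>\<^sup>+t. ennreal (t\<^sup>2) \<partial>mu (calc recip x)) = (\<integral>\<^sup>+t. ennreal ((recip t)\<^sup>2) * ennreal (t\<^sup>2) \<partial>mu x)"
    unfolding mu_calc[OF recip_bborel] by (subst nn_integral_density) auto
  also have "\<dots> \<le> (\<integral>\<^sup>+t. 1 \<partial>mu x)"
    using l by (intro nn_integral_mono) (auto simp: cut_inverse_def power_divide simp flip: ennreal_mult)
  also have "\<dots> < \<infinity>" using finite_measure.emeasure_finite[OF finite_measure_mu, of x UNIV] by (simp add: less_top)
  finally show ?thesis by (simp add: dom_iff)
qed

text \<open>
  With \<open>R = \<integral> 1/t dE\<close> both sides are \<open>\<langle>x, R x\<rangle>\<close>, since \<open>\<mu>\<^sub>R\<^sub>x = t\<^sup>-\<^sup>2 \<mu>\<^sub>x\<close> and the form of \<open>L\<close> at \<open>R x\<close> is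
  \<open>\<integral> t d\<mu>\<^sub>R\<^sub>x\<close>.
\<close>

lemma resolvent_diag: "cinner (calc recip x) (app L (calc recip x)) = cinner (calc recip x) x"
proof -
  have "(\<integral>t. t \<partial>mu (calc recip x)) = (\<integral>t. (recip t)\<^sup>2 * t \<partial>mu x)"
    unfolding mu_calc[OF recip_bborel] by (subst integral_density) auto
  also have "(\<lambda>t. (recip t)\<^sup>2 * t) = recip"
    using l by (auto simp: cut_inverse_def fun_eq_iff power2_eq_square)
  finally have "cinner (calc recip x) (app L (calc recip x)) = cinner x (calc recip x)"
    using cinner_app[OF resolvent_dom] cinner_calc[OF recip_bborel] by simp
  then show ?thesis by (simp add: calc_cinner)
qed

lemma resolvent_inj:
  assumes "calc recip w = 0" shows "w = 0"
proof -
  have "(\<integral>t. recip t \<partial>mu w) = 0" using inner_calc[OF recip_bborel, of w] assms by simp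
  moreover have "0 \<le> recip t" for t using l by (simp add: cut_inverse_def)
  ultimately have "AE t in mu w. recip t = 0"
    using integral_nonneg_eq_0_iff_AE[OF integrable_mu[OF recip_bborel]] by simp
  then have "AE t in mu w. False"
    using spectral_gap[of w] by eventually_elim (use l in \<open>auto simp: cut_inverse_def split: if_splits\<close>)
  then have "emeasure (mu w) UNIV = 0"
    by (simp add: AE_iff_measurable[where N=UNIV])
  then show ?thesis by (simp add: emeasure_mu inner_le_zero_iff)
qed

text \<open>
  By polarization of the previous identity, \<open>L R x - x\<close> is orthogonal to the range of \<open>R\<close>. Since \<open>R\<close> is symmetric
  and injective, this range is dense.
\<close>

lemma resolvent: "app L (calc recip x) = x"
proof -
  let ?R = "calc recip"
  have lin: "app L (?R u + ?R v) = app L (?R u) + app L (?R v)" "app L (scaleC c (?R u)) = scaleC c (app L (?R u))" for u v c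
    using linear resolvent_dom unfolding linear_op_def by simp_all
  have "cinner (?R u) (app L (?R x) - x) = 0" for u
  proof (rule sesquilinear_zero[where D=UNIV and b="\<lambda>u v. cinner (?R u) (app L (?R v) - v)"])
    show "cinner (?R u) (app L (?R u) - u) = 0" for u
      by (simp add: cinner_diff_right resolvent_diag)
  qed (simp_all add: blinfun.add_right lin calc_scaleC cinner_add_left cinner_add_right cinner_scaleC_left
      cinner_scaleC_right cinner_diff_right algebra_simps)
  then have "cinner u (?R (app L (?R x) - x)) = 0" for u
    by (simp add: calc_cinner)
  then have "?R (app L (?R x) - x) = 0"
    by (intro cinner_eqI) simp
  from resolvent_inj[OF this] show ?thesis by simp
qed

lemma integral_recip_power: "(\<integral>t. recip t ^ j \<partial>mu x) = inner x ((blinfun_apply (calc recip) ^^ j) x)"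
proof -
  have "(\<lambda>t. recip t ^ j) \<in> bborel \<and> blinfun_apply (calc (\<lambda>t. recip t ^ j)) = blinfun_apply (calc recip) ^^ j"
  proof (induction j)
    case 0
    have "calc (\<lambda>t. 1) = E UNIV" using calc_indicator[of UNIV] by simp
    then show ?case by (auto simp: fun_eq_iff)
  next
    case (Suc j)
    then show ?case by (auto simp: bborel_mult calc_mult fun_eq_iff)
  qed
  then show ?thesis by (metis inner_calc)
qed

end

text \<open>
  The operator \<open>R = \<integral> 1/t dE\<close> is the inverse of \<open>L\<close>, so it does not depend on \<open>E\<close>. The numbers
  \<open>l\<^sup>j \<langle>x, R\<^sup>j x\<rangle>\<close> are the moments of the image of \<open>\<mu>\<^sub>x\<close> under \<open>t \<mapsto> l / t\<close>, a measure on the unit interval, and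
  they determine it.
\<close>

lemma spectral_measure_unique:
  assumes 1: "spectral_pair E L l" and 2: "spectral_pair F L l"
  shows "E = F"
proof
  interpret E: spectral_pair E L l by fact
  interpret F: spectral_pair F L l by fact
  have l: "l > 0" by (rule E.l)
  have calc: "F.calc E.recip = E.calc E.recip"
  proof (rule blinfun_eqI)
    fix x
    show "F.calc E.recip x = E.calc E.recip x"
      using bounded_below_inj[OF E.linear E.below l F.resolvent_dom E.resolvent_dom] 
        F.resolvent E.resolvent by simp
  qed
  define g where "g t = l * E.recip t" for t
  have g [measurable]: "g \<in> borel_measurable borel"
    unfolding g_def by measurable
  have g01: "g t \<in> {0..1}" for t using l by (auto simp: g_def cut_inverse_def)
  show "E A = F A" for A
  proof (cases "A \<in> sets borel")
    case False
    then show ?thesis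
      using E.pvm F.pvm unfolding projection_valued_measure_def by metis
  next
    case A: True
    show ?thesis
    proof (rule symmetric_op_eqI[OF E.proj_symmetric[OF A] F.proj_symmetric[OF A]])
      fix x
      have gE: "g \<in> measurable (E.mu x) borel" and gF: "g \<in> measurable (F.mu x) borel"
        by measurable
      have unit: "unit_measure (distr (E.mu x) borel g)" "unit_measure (distr (F.mu x) borel g)"
        using finite_measure.finite_measure_distr[OF E.finite_measure_mu gE]
          finite_measure.finite_measure_distr[OF F.finite_measure_mu gF] g01
        by (auto simp: unit_measure_def AE_distr_iff[OF gE] AE_distr_iff[OF gF])
      have momE: "(\<integral>t. t ^ j \<partial>distr (E.mu x) borel g) = l ^ j * inner x ((blinfun_apply (E.calc E.recip) ^^ j) x)" for j
        using E.integral_recip_power[where j=j and x=x] by (subst integral_distr[OF gE]) (simp_all add: g_def power_mult_distrib)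
      have momF: "(\<integral>t. t ^ j \<partial>distr (F.mu x) borel g) = l ^ j * inner x ((blinfun_apply (E.calc E.recip) ^^ j) x)" for j
        using F.integral_recip_power[where j=j and x=x, unfolded calc] by (subst integral_distr[OF gF]) (simp_all add: g_def power_mult_distrib)
      \<comment> \<open>the image of \<open>A\<close> under \<open>t \<mapsto> l / t\<close>, as far as the spectrum is concerned\<close>
      define C where "C = (\<lambda>u. l / u) -` A \<inter> {0<..}"
      have C: "C \<in> sets borel"
        unfolding C_def by (intro sets.Int measurable_sets_borel[OF _ A]) auto
      have "measure (distr (E.mu x) borel g) C = measure (distr (F.mu x) borel g) C"
        using moments_determine_sum_list[of "[(1, distr (E.mu x) borel g), (-1, distr (F.mu x) borel g)]", OF _ _ C] unit
        by (auto simp: momE momF)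
      then have "measure (E.mu x) (g -` C) = measure (F.mu x) (g -` C)"
        by (simp add: measure_distr[OF gE C] measure_distr[OF gF C])
      moreover have tC: "t \<in> g -` C \<longleftrightarrow> t \<in> A" if "l \<le> t" for t
        using that l by (simp add: C_def g_def cut_inverse_def)
      have gC: "g -` C \<in> sets borel" using measurable_sets_borel[OF g C] .
      have "measure (E.mu x) (g -` C) = measure (E.mu x) A"
      proof (rule finite_measure.finite_measure_eq_AE[OF E.finite_measure_mu])
        show "AE t in E.mu x. (t \<in> g -` C) = (t \<in> A)" using E.spectral_gap[of x] by eventually_elim (rule tC)
      qed (use A gC in auto)
      moreover have "measure (F.mu x) (g -` C) = measure (F.mu x) A"
      proof (rule finite_measure.finite_measure_eq_AE[OF F.finite_measure_mu])
        show "AE t in F.mu x. (t \<in> g -` C) = (t \<in> A)" using F.spectral_gap[of x] by eventually_elim (rule tC)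
      qed (use A gC in auto)
      ultimately show "inner x (E A x) = inner x (F A x)"
        by (simp add: E.measure_mu[OF A] F.measure_mu[OF A])
    qed
  qed
qed

lemma (in spectral_pair) spectral_measure_eq: "spectral_measure L = E"
  unfolding spectral_measure_def
proof (rule the_equality)
  show "projection_valued_measure E \<and> is_spectral_integral E (\<lambda>t. t) L" using pvm spec_int by simp
  fix F :: "real set \<Rightarrow> 'h \<Rightarrow>\<^sub>L 'h"
  assume F: "projection_valued_measure F \<and> is_spectral_integral F (\<lambda>t. t) L"
  have "spectral_pair F L l"
    using F l below by (simp add: spectral_pair_def spectral_pair_axioms_def pvm_def)
  then show "F = E" using spectral_measure_unique[OF _ spectral_pair_axioms] by blast
qed

section \<open>The spectral theorem for strictly positive self-adjoint operators\<close>

locale positive_self_adjoint =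
  fixes L :: "('h::complex_hilbert) unb_op" and l :: real
  assumes sa: "self_adjoint_op L" and l: "l > 0" and below: "bounded_below_op l L"
begin

lemma linear: "linear_op L"
  and dense: "closure (dom L) = UNIV"
  and adj: "adjoint_op L = L"
  using sa by (auto simp: self_adjoint_op_def)

lemma dense_eqI:
  assumes "\<And>u. u \<in> dom L \<Longrightarrow> inner z u = inner z' u" shows "z = z'"
proof -
  have "closed {u. inner z u = inner z' u}"
    by (intro closed_Collect_eq continuous_intros)
  then have "closure (dom L) \<subseteq> {u. inner z u = inner z' u}"
    using assms by (intro closure_minimal) auto
  then show ?thesis using vector_eq_rdot[of z z'] by (auto simp: dense)
qed

lemma cinner_eq_iff_inner:
  "(\<forall>u\<in>dom L. cinner y (app L u) = cinner z u) \<longleftrightarrow> (\<forall>u\<in>dom L. inner y (app L u) = inner z u)"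
proof
  assume "\<forall>u\<in>dom L. cinner y (app L u) = cinner z u"
  then show "\<forall>u\<in>dom L. inner y (app L u) = inner z u" by (simp flip: Re_cinner)
next
  assume *: "\<forall>u\<in>dom L. inner y (app L u) = inner z u"
  show "\<forall>u\<in>dom L. cinner y (app L u) = cinner z u"
  proof
    fix u assume u: "u \<in> dom L"
    then have "scaleC \<i> u \<in> dom L" "app L (scaleC \<i> u) = scaleC \<i> (app L u)"
      using linear unfolding linear_op_def by blast+
    then show "cinner y (app L u) = cinner z u"
      using *[rule_format, OF u] *[rule_format, of "scaleC \<i> u"] by (simp add: complex_eq_iff Re_cinner Im_cinner)
  qed
qed

text \<open>
  A self-adjoint operator has no proper symmetric extension. This is the form in which the equality
  of \<open>L\<close> with its adjoint is used.
\<close>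

lemma adjoint_maximal:
  assumes *: "\<And>u. u \<in> dom L \<Longrightarrow> inner y (app L u) = inner z u"
  shows "y \<in> dom L" "app L y = z"
proof -
  have c: "\<forall>u\<in>dom L. cinner y (app L u) = cinner z u"
    using * cinner_eq_iff_inner by blast
  have "(THE z. \<forall>u\<in>dom L. cinner y (app L u) = cinner z u) = z"
  proof (rule the_equality)
    show "\<forall>u\<in>dom L. cinner y (app L u) = cinner z u" by (rule c)
    fix z' assume "\<forall>u\<in>dom L. cinner y (app L u) = cinner z' u"
    then have "\<forall>u\<in>dom L. inner y (app L u) = inner z' u" using cinner_eq_iff_inner by blast
    then show "z' = z" using * by (intro dense_eqI) force
  qed
  then have "adjoint_op L y = Some z" using c unfolding adjoint_op_def by auto
  then show "y \<in> dom L" "app L y = z" by (auto simp: adj)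
qed

lemma symmetric:
  assumes y: "y \<in> dom L" and u: "u \<in> dom L"
  shows "inner y (app L u) = inner (app L y) u"
proof -
  have "adjoint_op L y \<noteq> None" using y by (auto simp: adj)
  then obtain z where z: "\<forall>u\<in>dom L. cinner y (app L u) = cinner z u"
    unfolding adjoint_op_def by (auto split: if_splits)
  then have "\<forall>u\<in>dom L. inner y (app L u) = inner z u" using cinner_eq_iff_inner by blast
  then show ?thesis using adjoint_maximal(2)[of y z] u by auto
qed

lemma norm_below: assumes x: "x \<in> dom L" shows "l * norm x \<le> norm (app L x)"
proof (cases "x = 0")
  case False
  have "norm x * (l * norm x) = l * inner x x"
    by (simp add: power2_norm_eq_inner[symmetric] power2_eq_square)
  also have "\<dots> \<le> inner x (app L x)"
    using below x unfolding bounded_below_op_def Re_cinner by blast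
  also have "\<dots> \<le> norm x * norm (app L x)" by (rule norm_cauchy_schwarz)
  finally show ?thesis using False by simp
qed simp

lemma zero_dom: "0 \<in> dom L" "app L 0 = 0"
  using linear_op_scaleR[OF linear, of 0 0] linear by (auto simp: linear_op_def)

text \<open>
  The lower bound makes the range closed. A vector orthogonal to the range belongs to the domain of the
  adjoint and is mapped to zero, so it vanishes.
\<close>

lemma surjective: "app L ` dom L = UNIV"
proof (rule ccontr)
  assume ne: "app L ` dom L \<noteq> UNIV"
  have "subspace (app L ` dom L)"
    unfolding subspace_def
  proof (intro conjI ballI allI)
    show "0 \<in> app L ` dom L" using imageI[OF zero_dom(1), of "app L"] by (simp only: zero_dom(2))
    show "x + y \<in> app L ` dom L" if h: "x \<in> app L ` dom L" "y \<in> app L ` dom L" for x y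
    proof -
      obtain u v where uv: "u \<in> dom L" "v \<in> dom L" "x = app L u" "y = app L v" using h by blast
      then have "u + v \<in> dom L" "app L (u + v) = x + y"
        using linear_op_add[OF linear uv(1,2)] by (simp_all only: uv(3,4))
      then show ?thesis using imageI[of "u + v" "dom L" "app L"] by simp
    qed
    show "c *\<^sub>R x \<in> app L ` dom L" if h: "x \<in> app L ` dom L" for c x
    proof -
      obtain u where u: "u \<in> dom L" "x = app L u" using h by blast
      then have "c *\<^sub>R u \<in> dom L" "app L (c *\<^sub>R u) = c *\<^sub>R x"
        using linear_op_scaleR[OF linear u(1)] by (simp_all only: u(2))
      then show ?thesis using imageI[of "c *\<^sub>R u" "dom L" "app L"] by simp
    qed
  qed
  moreover have "closed (app L ` dom L)"
    unfolding closed_sequential_limits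
    proof (intro allI impI, elim conjE)
      fix f y assume f: "\<forall>n. f n \<in> app L ` dom L" "f \<longlonglongrightarrow> y"
      then have "\<forall>n. \<exists>x. x \<in> dom L \<and> f n = app L x" by blast
      from choice[OF this] obtain u where "\<forall>n. u n \<in> dom L \<and> f n = app L (u n)" ..
      then have u: "\<And>n. u n \<in> dom L" "\<And>n. f n = app L (u n)" by auto
      have "Cauchy u"
      proof (rule CauchyI)
        fix e :: real assume "e > 0"
        then have "0 < l * e" using l by simp
        then obtain N where N: "\<And>m n. m \<ge> N \<Longrightarrow> n \<ge> N \<Longrightarrow> norm (f m - f n) < l * e"
          using CauchyD[OF LIMSEQ_imp_Cauchy[OF f(2)]] by blast
        have "norm (u m - u n) < e" if "m \<ge> N" "n \<ge> N" for m n
        proof -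
          have "l * norm (u m - u n) \<le> norm (f m - f n)"
            using norm_below[OF linear_op_diff(1)[OF linear u(1) u(1)]] 
            by (simp add: linear_op_diff(2)[OF linear u(1) u(1)] u(2))
          also have "\<dots> < l * e" using N that by blast
          finally show ?thesis using l by simp
        qed
        then show "\<exists>M. \<forall>m\<ge>M. \<forall>n\<ge>M. norm (u m - u n) < e" by blast
      qed
      then obtain x where x: "u \<longlonglongrightarrow> x" using Cauchy_convergent_iff convergent_def by blast
      have "inner x (app L v) = inner y v" if v: "v \<in> dom L" for v
      proof -
        have "(\<lambda>n. inner (u n) (app L v)) \<longlonglongrightarrow> inner x (app L v)" by (intro tendsto_intros x)
        moreover have "(\<lambda>n. inner (f n) v) \<longlonglongrightarrow> inner y v" by (intro tendsto_intros f)
        moreover have "inner (u n) (app L v) = inner (f n) v" for n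
          using symmetric[OF u(1) v] by (simp add: u(2))
        ultimately show ?thesis using LIMSEQ_unique by simp
      qed
      from adjoint_maximal[of x y, OF this] show "y \<in> app L ` dom L" using imageI[of x "dom L" "app L"] by simp
    qed
  ultimately have "\<exists>z. z \<noteq> 0 \<and> (\<forall>y\<in>app L ` dom L. inner z y = 0)"
    using ne by (rule exists_orthogonal_vector)
  then obtain z where z: "z \<noteq> 0" "\<And>y. y \<in> app L ` dom L \<Longrightarrow> inner z y = 0"
    by (elim exE conjE) (simp only: Ball_def)
  have "inner z (app L u) = inner 0 u" if "u \<in> dom L" for u using z(2)[OF imageI[OF that]] by simp
  from adjoint_maximal[of z 0, OF this] have "z = 0" using norm_below[of z] l by (simp add: mult_le_0_iff)
  then show False using z by simp
qed

definition inv_op :: "'h \<Rightarrow> 'h" where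
  "inv_op y = (SOME x. x \<in> dom L \<and> app L x = y)"

lemma inv_op: "inv_op y \<in> dom L" "app L (inv_op y) = y"
proof -
  have "y \<in> app L ` dom L" unfolding surjective by simp
  then have "\<exists>x. x \<in> dom L \<and> app L x = y" by (elim imageE) auto
  from someI_ex[OF this] show "inv_op y \<in> dom L" "app L (inv_op y) = y" unfolding inv_op_def by auto
qed

lemma inv_op_eqI: "x \<in> dom L \<Longrightarrow> app L x = y \<Longrightarrow> inv_op y = x"
  using bounded_below_inj[OF linear below l] inv_op by blast

lemma inv_op_app: "x \<in> dom L \<Longrightarrow> inv_op (app L x) = x"
  by (rule inv_op_eqI) auto

lemma bounded_linear_inv_op: "bounded_linear inv_op"
proof (rule bounded_linear_intro)
  show "inv_op (x + y) = inv_op x + inv_op y" for x y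
    using linear_op_add[OF linear inv_op(1) inv_op(1)] by (intro inv_op_eqI) (simp_all only: inv_op(2))
  show "inv_op (r *\<^sub>R x) = r *\<^sub>R inv_op x" for r x
    using linear_op_scaleR[OF linear inv_op(1)] by (intro inv_op_eqI) (simp_all only: inv_op(2))
  show "norm (inv_op x) \<le> norm x * (1 / l)" for x
    using norm_below[OF inv_op(1)[of x]] inv_op(2)[of x] l by (simp add: field_simps)
qed

text \<open>The operator \<open>l L\<^sup>-\<^sup>1\<close> lies between \<open>0\<close> and \<open>1\<close>.\<close>

definition scaled_inverse :: "'h \<Rightarrow>\<^sub>L 'h" where
  "scaled_inverse = l *\<^sub>R Blinfun inv_op"

lemma scaled_inverse_apply: "scaled_inverse x = l *\<^sub>R inv_op x"
  by (simp add: scaled_inverse_def blinfun.scaleR_left bounded_linear_Blinfun_apply bounded_linear_inv_op)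

lemma positive_contraction_scaled_inverse: "positive_contraction scaled_inverse"
proof
  show "symmetric_op scaled_inverse"
    unfolding symmetric_op_def scaled_inverse_apply
    using symmetric[OF inv_op(1) inv_op(1)] by (simp add: inv_op(2))
  show "scaled_inverse (scaleC \<i> x) = scaleC \<i> (scaled_inverse x)" for x
  proof -
    have "inv_op (scaleC \<i> x) = scaleC \<i> (inv_op x)"
      using linear_op_scaleC[OF linear inv_op(1)] by (intro inv_op_eqI) (simp_all only: inv_op(2))
    then show ?thesis by (simp add: scaled_inverse_apply scaleC_scaleC mult.commute flip: scaleC_of_real)
  qed
  fix x
  have "l * inner (inv_op x) (inv_op x) \<le> inner (inv_op x) x"
    using below[unfolded bounded_below_op_def Re_cinner, rule_format, OF inv_op(1)[of x]] by (simp only: inv_op(2))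
  moreover have "0 \<le> l * inner (inv_op x) (inv_op x)" using l by simp
  ultimately have "0 \<le> inner x (inv_op x)" by (simp add: inner_commute)
  then show "0 \<le> inner x (scaled_inverse x)" using l by (simp add: scaled_inverse_apply)
  have "inner x (scaled_inverse x) \<le> norm x * (l * norm (inv_op x))"
    using norm_cauchy_schwarz[of x "scaled_inverse x"] l by (simp add: scaled_inverse_apply)
  also have "\<dots> \<le> norm x * norm x"
    using norm_below[OF inv_op(1)[of x]] by (intro mult_left_mono) (simp_all add: inv_op)
  finally show "inner x (scaled_inverse x) \<le> inner x x" by (simp add: power2_norm_eq_inner[symmetric] power2_eq_square)
qed

text \<open>
  The spectral measure \<open>F\<close> of \<open>G = l L\<^sup>-\<^sup>1\<close> gives that of \<open>L\<close> by the change of variables \<open>t \<mapsto> l / t\<close>. There is no mass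
  at zero because \<open>G\<close> is injective. For \<open>x = L\<^sup>-\<^sup>1 z\<close> the measure of \<open>x\<close> is \<open>t\<^sup>2 / l\<^sup>2\<close> times that of \<open>z\<close>, which gives the
  quadratic form and one inclusion of the domains. Conversely, if \<open>l / t\<close> is square integrable for \<open>x\<close>, then
  the truncations of \<open>l / t\<close> applied to \<open>x\<close> converge to a preimage of \<open>x\<close> under \<open>L\<^sup>-\<^sup>1\<close>.
\<close>

theorem spectral_pair_exists: "\<exists>E. spectral_pair E L l"
proof -
  obtain F where F: "projection_valued_measure F"
    and AE01: "\<And>x. AE t in scalar_measure F x. t \<in> {0..1}"
    and intF: "\<And>x. (\<integral>t. t \<partial>scalar_measure F x) = inner x (scaled_inverse x)"
    using unit_operator_spectral[OF positive_contraction_scaled_inverse] by blast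
  interpret F: pvm F by (rule pvm.intro[OF F])
  \<comment> \<open>the identity function, made bounded off the spectrum\<close>
  define c where "c t = max 0 (min 1 t)" for t :: real
  have c: "c \<in> bborel" by (rule bborelI[where c=1]) (auto simp: c_def[abs_def])
  have sym_scaled_inverse: "symmetric_op scaled_inverse" using positive_contraction_scaled_inverse by (simp add: positive_contraction_def)
  have calc_c: "F.calc c = scaled_inverse"
  proof (rule F.calc_eqI[OF c])
    have "(\<integral>t. c t \<partial>F.mu x) = (\<integral>t. t \<partial>F.mu x)" for x
    proof (rule integral_cong_AE)
      show "AE t in F.mu x. c t = t" using AE01[of x] by eventually_elim (simp add: c_def)
    qed (use c in auto)
    then show "F.represents c scaled_inverse" unfolding F.represents_def using sym_scaled_inverse intF by simp
  qed
  have scaled_inverse_inj: "x = 0" if "inner x (scaled_inverse x) = 0" for x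
  proof -
    have "inner (app L (inv_op x)) (inv_op x) = 0" using that l by (simp add: scaled_inverse_apply inv_op)
    then have "inner (inv_op x) (app L (inv_op x)) = 0" by (simp add: inner_commute)
    then have "l * inner (inv_op x) (inv_op x) \<le> 0"
      using below[unfolded bounded_below_op_def Re_cinner, rule_format, OF inv_op(1)[of x]] by simp
    then have "inv_op x = 0" using l by (simp add: mult_le_0_iff inner_le_zero_iff)
    then show ?thesis using inv_op(2)[of x] zero_dom by simp
  qed
  have AE: "AE t in F.mu x. 0 < t \<and> t \<le> 1" for x
  proof -
    define y where "y = F {0} x"
    have "F.mu y = density (F.mu x) (\<lambda>t. ennreal ((indicator {0} t)\<^sup>2))"
      using F.mu_calc[of "indicator {0}" x] by (simp add: F.calc_indicator y_def)
    then have "(\<integral>t. t \<partial>F.mu y) = (\<integral>t. (indicator {0} t)\<^sup>2 * t \<partial>F.mu x)"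
      by (simp add: integral_density)
    also have "(\<lambda>t. (indicator {0} t)\<^sup>2 * t) = (\<lambda>t::real. 0)" by (auto simp: indicator_def fun_eq_iff)
    finally have "y = 0" using scaled_inverse_inj[of y] intF[of y] by simp
    then have "emeasure (F.mu x) {0} = 0" by (simp add: F.emeasure_mu y_def)
    then have "AE t in F.mu x. t \<notin> {0}" by (intro AE_I[where N="{0}"]) auto
    with AE01[of x] show ?thesis by eventually_elim auto
  qed
  have mu_inv: "F.mu (inv_op z) = density (F.mu z) (\<lambda>t. ennreal ((c t / l)\<^sup>2))"
    and calc_inv: "F.calc (\<lambda>t. c t / l) z = inv_op z" and cl: "(\<lambda>t. c t / l) \<in> bborel" for z
  proof -
    have eq: "(\<lambda>t. c t / l) = (\<lambda>t. (1 / l) * c t + 0)" by (simp add: fun_eq_iff)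
    show cl: "(\<lambda>t. c t / l) \<in> bborel" unfolding eq using c by (intro bborel_lin) auto
    have z0: "F.calc (\<lambda>t. 0) = 0" using F.calc_diff[OF c c] by simp
    have "F.calc (\<lambda>t. c t / l) = (1 / l) *\<^sub>R scaled_inverse"
      unfolding eq F.calc_lin[OF c bborel_const] calc_c z0 by simp
    then show ci: "F.calc (\<lambda>t. c t / l) z = inv_op z"
      using l by (simp add: scaled_inverse_apply blinfun.scaleR_left)
    show "F.mu (inv_op z) = density (F.mu z) (\<lambda>t. ennreal ((c t / l)\<^sup>2))"
      using F.mu_calc[OF cl, of z] by (simp add: ci)
  qed
  have cm [measurable]: "c \<in> borel_measurable borel" using c by auto
  have "is_spectral_integral F (\<lambda>t. l / t) L"
    unfolding is_spectral_integral_def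
  proof (intro conjI linear ballI)
    have sub1: "(\<integral>\<^sup>+t. ennreal ((l / t)\<^sup>2) \<partial>F.mu x) < \<infinity>" if x: "x \<in> dom L" for x
    proof -
      have "(\<integral>\<^sup>+t. ennreal ((l / t)\<^sup>2) \<partial>F.mu (inv_op (app L x))) = (\<integral>\<^sup>+t. ennreal ((c t / l)\<^sup>2) * ennreal ((l / t)\<^sup>2) \<partial>F.mu (app L x))"
        unfolding mu_inv by (subst nn_integral_density) auto
      also have "\<dots> = (\<integral>\<^sup>+t. 1 \<partial>F.mu (app L x))"
      proof (rule nn_integral_cong_AE)
        show "AE t in F.mu (app L x). ennreal ((c t / l)\<^sup>2) * ennreal ((l / t)\<^sup>2) = 1"
          using AE[of "app L x"]
          by eventually_elim (use l in \<open>simp add: c_def power_divide flip: ennreal_mult\<close>)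
      qed
      also have "\<dots> < \<infinity>"
        using finite_measure.emeasure_finite[OF F.finite_measure_mu, of "app L x" UNIV] by (simp add: less_top)
      finally show ?thesis by (simp add: inv_op_app x)
    qed
    have sub2: "x \<in> dom L" if fin: "(\<integral>\<^sup>+t. ennreal ((l / t)\<^sup>2) \<partial>F.mu x) < \<infinity>" for x
    proof -
      define B where "B n = {1 / (real n + 1) ..}" for n
      define w where "w n t = indicator (B n) t * (l / t)" for n and t :: real
      have B [measurable]: "B n \<in> sets borel" for n by (simp add: B_def)
      have w: "w n \<in> bborel" for n
      proof (rule bborelI)
        show "\<bar>w n t\<bar> \<le> l * (real n + 1)" for t
        proof (cases "t \<in> B n")
          case True
          then have "0 < 1 / (real n + 1)" "1 / (real n + 1) \<le> t" by (auto simp: B_def)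
          moreover from this have "0 < t" by linarith
          ultimately have "l / t \<le> l / (1 / (real n + 1))" "0 < t"
            using l divide_left_mono[of "1 / (real n + 1)" t l] by simp_all
          then show ?thesis using True l by (simp add: w_def)
        qed (use l in \<open>simp add: w_def\<close>)
      qed (simp add: w_def[abs_def])
      have mono: "B n \<subseteq> B m" if "n \<le> m" for n m
        using that by (auto simp: B_def intro: order_trans[rotated] frac_le)
      have ev: "AE t in F.mu x. eventually (\<lambda>n. t \<in> B n) sequentially"
        using AE[of x]
      proof eventually_elim
        case (elim t)
        then have "eventually (\<lambda>n. 1 / (real n + 1) < t) sequentially"
          by (intro order_tendstoD(2)[OF one_over_Suc_tendsto]) simp
        then show ?case by eventually_elim (simp add: B_def)
      qed
      obtain z' where z': "(\<lambda>n. F.calc (w n) x) \<longlonglongrightarrow> z'"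
        using F.truncated_calc_converges[OF B mono ev _ _ fin] w unfolding w_def[abs_def] by auto
      have "(\<lambda>n. F.calc (\<lambda>t. c t / l) (F.calc (w n) x)) \<longlonglongrightarrow> F.calc (\<lambda>t. c t / l) z'"
        by (intro tendsto_intros z')
      moreover have "F.calc (\<lambda>t. c t / l) (F.calc (w n) x) = F (B n) x" for n
      proof -
        have "F.calc (\<lambda>t. c t / l * w n t) = F.calc (indicator (B n))"
        proof (rule F.calc_cong_AE)
          fix y
          show "AE t in F.mu y. c t / l * w n t = indicator (B n) t"
            using AE[of y] by eventually_elim (use l in \<open>auto simp: c_def w_def\<close>)
        qed (rule bborel_mult[OF cl w], simp)
        then have "F.calc (\<lambda>t. c t / l) o\<^sub>L F.calc (w n) = F (B n)"
          unfolding F.calc_mult[OF cl w] F.calc_indicator[OF B] .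
        then show ?thesis by (metis blinfun_apply_blinfun_compose)
      qed
      moreover have "(\<lambda>n. F (B n) x) \<longlonglongrightarrow> x" by (rule F.truncation_tendsto[OF B ev])
      ultimately have "inv_op z' = x" using LIMSEQ_unique by (simp add: calc_inv)
      then show ?thesis using inv_op(1)[of z'] by simp
    qed
    show "dom L = {x. (\<integral>\<^sup>+t. ennreal ((l / t)\<^sup>2) \<partial>F.mu x) < \<infinity>}"
      using sub1 sub2 by blast
    show "cinner x (app L x) = complex_of_real (\<integral>t. l / t \<partial>F.mu x)" if x: "x \<in> dom L" for x
    proof -
      have "cinner x (app L x) = cinner (app L x) x"
        using cinner_eq_iff_inner[of x "app L x"] symmetric[OF x] x by blast
      then have "cinner x (app L x) = cnj (cinner x (app L x))"
        using cinner_commute[of x "app L x"] by simp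
      then have "Im (cinner x (app L x)) = 0" by (simp add: complex_eq_iff)
      moreover have "Re (cinner x (app L x)) = (\<integral>t. l / t \<partial>F.mu x)"
      proof -
        have "(\<integral>t. l / t \<partial>F.mu (inv_op (app L x))) = (\<integral>t. (c t / l)\<^sup>2 * (l / t) \<partial>F.mu (app L x))"
          unfolding mu_inv by (subst integral_density) auto
        also have "\<dots> = (\<integral>t. c t / l \<partial>F.mu (app L x))"
        proof (rule integral_cong_AE)
          show "AE t in F.mu (app L x). (c t / l)\<^sup>2 * (l / t) = c t / l"
            using AE[of "app L x"] by eventually_elim (use l in \<open>simp add: c_def power2_eq_square\<close>)
        qed auto
        also have "\<dots> = inner (app L x) (inv_op (app L x))"
          using F.inner_calc[OF cl, of "app L x"] by (simp add: calc_inv)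
        finally show ?thesis by (simp add: inv_op_app x Re_cinner inner_commute)
      qed
      ultimately show ?thesis by (simp add: complex_eq_iff)
    qed
  qed
  then have "is_spectral_integral (push_pvm (\<lambda>t. l / t) F) (\<lambda>t. t) L"
    by (subst is_spectral_integral_push_pvm[OF F]) auto
  moreover have "projection_valued_measure (push_pvm (\<lambda>t. l / t) F)"
    by (rule push_pvm[OF F]) auto
  ultimately have "spectral_pair (push_pvm (\<lambda>t. l / t) F) L l"
    using l below by (simp add: spectral_pair_def spectral_pair_axioms_def pvm_def)
  then show ?thesis by blast
qed

end

section \<open>Bochner integrals in arbitrary Banach spaces\<close>

lemma simple_function_measurable_image:
  "simple_function M s \<Longrightarrow> s \<in> measurable M (count_space (s ` space M))"
  by (auto simp: simple_function_def measurable_count_space_eq2)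

text \<open>
  In a space that is not second countable the difference of measurable functions need not be measurable.
  Here one of the functions has finitely many values.
\<close>

lemma measurable_norm_diff_simple:
  fixes f s :: "'a \<Rightarrow> 'b::real_normed_vector"
  assumes f: "f \<in> borel_measurable M" and s: "simple_function M s"
  shows "(\<lambda>x. norm (f x - s x)) \<in> borel_measurable M"
proof -
  have fin: "countable (s ` space M)" using s by (simp add: simple_function_def countable_finite)
  have m: "(\<lambda>x. norm (f x - y)) \<in> borel_measurable M" for y
  proof -
    have "(\<lambda>z::'b. norm (z - y)) \<in> borel_measurable borel"
      by (intro borel_measurable_continuous_onI continuous_intros)
    from measurable_compose[OF f this] show ?thesis .
  qed
  have "(\<lambda>x. (\<lambda>y x. norm (f x - y)) (s x) x) \<in> borel_measurable M"
    by (rule measurable_compose_countable'[OF m simple_function_measurable_image[OF s] fin])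
  then show ?thesis by simp
qed

lemma simple_bochner_integrable_simple_function:
  "Bochner_Integration.simple_bochner_integrable M s \<Longrightarrow> simple_function M s"
  by (auto elim: Bochner_Integration.simple_bochner_integrable.cases)

text \<open>
  Operator-valued integrals are evaluated, and shown to be unique, through scalar ones.
\<close>

lemma has_strong_bochner_integral_bounded_linear:
  fixes f :: "'a \<Rightarrow> 'b::real_normed_vector" and T :: "'b \<Rightarrow> 'c::{real_normed_vector, second_countable_topology}"
  assumes T: "bounded_linear T" and f: "has_strong_bochner_integral M f I"
  shows "has_bochner_integral M (\<lambda>x. T (f x)) (T I)"
proof -
  interpret T: bounded_linear T by fact
  obtain s where fm: "f \<in> borel_measurable M"
    and s: "\<And>i::nat. Bochner_Integration.simple_bochner_integrable M (s i)"
    and lim: "(\<lambda>i. \<integral>\<^sup>+x. ennreal (norm (f x - s i x)) \<partial>M) \<longlonglongrightarrow> 0"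
    and int: "(\<lambda>i. Bochner_Integration.simple_bochner_integral M (s i)) \<longlonglongrightarrow> I"
    using f unfolding has_strong_bochner_integral_def by blast
  obtain K where K: "K > 0" "\<And>x. norm (T x) \<le> norm x * K" using T.pos_bounded by blast
  show ?thesis
  proof (rule has_bochner_integral.intros)
    have "T \<in> borel_measurable borel"
      by (intro borel_measurable_continuous_onI T.continuous_on continuous_on_id)
    from measurable_compose[OF fm this] show "(\<lambda>x. T (f x)) \<in> borel_measurable M" .
    show "Bochner_Integration.simple_bochner_integrable M (\<lambda>x. T (s i x))" for i
      using s by (intro simple_bochner_integrable_compose2[where p="\<lambda>x y. T x"]) (auto simp: T.zero)
    have "(\<lambda>i. Bochner_Integration.simple_bochner_integral M (\<lambda>x. T (s i x))) = (\<lambda>i. T (Bochner_Integration.simple_bochner_integral M (s i)))"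
      using simple_bochner_integral_linear[OF T.linear_axioms s] by (intro ext) simp
    then show "(\<lambda>i. Bochner_Integration.simple_bochner_integral M (\<lambda>x. T (s i x))) \<longlonglongrightarrow> T I"
      using T.tendsto[OF int] by simp
    have le: "(\<integral>\<^sup>+x. norm (T (f x) - T (s i x)) \<partial>M) \<le> ennreal K * (\<integral>\<^sup>+x. ennreal (norm (f x - s i x)) \<partial>M)" for i
    proof -
      have "(\<integral>\<^sup>+x. norm (T (f x) - T (s i x)) \<partial>M) \<le> (\<integral>\<^sup>+x. ennreal K * ennreal (norm (f x - s i x)) \<partial>M)"
      proof (rule nn_integral_mono)
        fix x
        have "norm (T (f x) - T (s i x)) \<le> K * norm (f x - s i x)"
          using K(2)[of "f x - s i x"] by (simp add: T.diff mult.commute)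
        then show "ennreal (norm (T (f x) - T (s i x))) \<le> ennreal K * ennreal (norm (f x - s i x))"
          unfolding ennreal_mult'[OF less_imp_le[OF K(1)], symmetric] by (rule ennreal_leI)
      qed
      also have "\<dots> = ennreal K * (\<integral>\<^sup>+x. ennreal (norm (f x - s i x)) \<partial>M)"
        using measurable_norm_diff_simple[OF fm simple_bochner_integrable_simple_function[OF s]]
        by (intro nn_integral_cmult) auto
      finally show ?thesis .
    qed
    have "(\<lambda>i. ennreal K * (\<integral>\<^sup>+x. ennreal (norm (f x - s i x)) \<partial>M)) \<longlonglongrightarrow> ennreal K * 0"
      by (rule ennreal_tendsto_cmult[OF _ lim]) simp
    then have Klim: "(\<lambda>i. ennreal K * (\<integral>\<^sup>+x. ennreal (norm (f x - s i x)) \<partial>M)) \<longlonglongrightarrow> 0"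
      by simp
    show "(\<lambda>i. \<integral>\<^sup>+x. norm (T (f x) - T (s i x)) \<partial>M) \<longlonglongrightarrow> 0"
      by (rule tendsto_sandwich[OF _ _ tendsto_const Klim]) (simp, intro always_eventually allI le)
  qed
qed

lemma simple_bochner_integral_diff_le:
  fixes f s t :: "'a \<Rightarrow> 'b::real_normed_vector"
  assumes f: "f \<in> borel_measurable M"
    and s: "Bochner_Integration.simple_bochner_integrable M s" and t: "Bochner_Integration.simple_bochner_integrable M t"
  shows "ennreal (norm (Bochner_Integration.simple_bochner_integral M s - Bochner_Integration.simple_bochner_integral M t)) \<le>
    (\<integral>\<^sup>+x. ennreal (norm (f x - s x)) \<partial>M) + (\<integral>\<^sup>+x. ennreal (norm (f x - t x)) \<partial>M)"
proof -
  note meas = measurable_norm_diff_simple[OF f simple_bochner_integrable_simple_function]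
  have "ennreal (norm (Bochner_Integration.simple_bochner_integral M s - Bochner_Integration.simple_bochner_integral M t))
      = norm (Bochner_Integration.simple_bochner_integral M (\<lambda>x. s x - t x))"
    using s t by (subst simple_bochner_integral_diff) auto
  also have "\<dots> \<le> Bochner_Integration.simple_bochner_integral M (\<lambda>x. norm (s x - t x))"
    using simple_bochner_integrable_compose2[of "(-)" M "s" "t"] s t
    by (auto intro!: simple_bochner_integral_norm_bound ennreal_leI)
  also have "\<dots> = (\<integral>\<^sup>+x. norm (s x - t x) \<partial>M)"
    using simple_bochner_integrable_compose2[of "\<lambda>x y. norm (x - y)" M "s" "t"] s t
    by (auto intro!: simple_bochner_integral_eq_nn_integral)
  also have "\<dots> \<le> (\<integral>\<^sup>+x. ennreal (norm (f x - s x)) + ennreal (norm (f x - t x)) \<partial>M)"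
  proof (rule nn_integral_mono)
    fix x
    have "norm (s x - t x) \<le> norm (f x - s x) + norm (f x - t x)"
      using norm_triangle_ineq4[of "f x - t x" "f x - s x"] by (simp add: add.commute)
    then show "ennreal (norm (s x - t x)) \<le> ennreal (norm (f x - s x)) + ennreal (norm (f x - t x))"
      by (simp add: ennreal_leI flip: ennreal_plus)
  qed
  also have "\<dots> = (\<integral>\<^sup>+x. ennreal (norm (f x - s x)) \<partial>M) + (\<integral>\<^sup>+x. ennreal (norm (f x - t x)) \<partial>M)"
    using meas[OF s] meas[OF t] by (intro nn_integral_add) auto
  finally show ?thesis .
qed

lemma strong_bochner_integrableI_sequence:
  fixes f :: "'a \<Rightarrow> 'b::banach"
  assumes f: "f \<in> borel_measurable M"
    and s: "\<And>i::nat. Bochner_Integration.simple_bochner_integrable M (s i)"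
    and lim: "(\<lambda>i. \<integral>\<^sup>+x. ennreal (norm (f x - s i x)) \<partial>M) \<longlonglongrightarrow> 0"
  shows "strong_bochner_integrable M f"
proof -
  let ?S = "\<lambda>i. Bochner_Integration.simple_bochner_integral M (s i)"
  have "Cauchy ?S"
  proof (rule CauchyI)
    fix e :: real assume e: "e > 0"
    then have "eventually (\<lambda>i. (\<integral>\<^sup>+x. ennreal (norm (f x - s i x)) \<partial>M) < ennreal (e / 2)) sequentially"
      by (intro order_tendstoD(2)[OF lim]) simp
    then obtain N where N: "\<And>i. i \<ge> N \<Longrightarrow> (\<integral>\<^sup>+x. ennreal (norm (f x - s i x)) \<partial>M) < ennreal (e / 2)"
      by (auto simp: eventually_sequentially)
    have "norm (?S i - ?S j) < e" if "i \<ge> N" "j \<ge> N" for i j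
    proof -
      have "ennreal (norm (?S i - ?S j)) \<le> (\<integral>\<^sup>+x. ennreal (norm (f x - s i x)) \<partial>M) + (\<integral>\<^sup>+x. ennreal (norm (f x - s j x)) \<partial>M)"
        by (rule simple_bochner_integral_diff_le[OF f s s])
      also have "\<dots> < ennreal (e / 2) + ennreal (e / 2)"
        using N that by (intro add_strict_mono) auto
      also have "\<dots> = ennreal e" using e by (simp flip: ennreal_plus)
      finally show ?thesis by (simp add: ennreal_less_iff)
    qed
    then show "\<exists>N. \<forall>i\<ge>N. \<forall>j\<ge>N. norm (?S i - ?S j) < e" by blast
  qed
  then obtain I where "?S \<longlonglongrightarrow> I" using Cauchy_convergent_iff convergent_def by blast
  then show ?thesis
    unfolding strong_bochner_integrable_def has_strong_bochner_integral_def using f s lim by blast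
qed

text \<open>
  A continuous function of a real-valued measurable function is approximated by rounding its argument up;
  since the bound \<open>w\<close> is decreasing, it bounds the approximations as well.
\<close>

lemma strong_bochner_integrable_compose_continuous:
  fixes g :: "real \<Rightarrow> 'b::banach" and h :: "'a \<Rightarrow> real"
  assumes h [measurable]: "h \<in> borel_measurable M" and h0: "\<And>x. 0 \<le> h x"
    and g: "continuous_on {0..} g"
    and gw: "\<And>r. 0 \<le> r \<Longrightarrow> norm (g r) \<le> w r"
    and w: "\<And>r r'. 0 \<le> r \<Longrightarrow> r \<le> r' \<Longrightarrow> w r' \<le> w r"
    and wm: "(\<lambda>x. w (h x)) \<in> borel_measurable M"
    and fin: "(\<integral>\<^sup>+x. ennreal (w (h x)) \<partial>M) < \<infinity>"
  shows "strong_bochner_integrable M (\<lambda>x. g (h x))"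
proof -
  define d where "d i r = of_int \<lceil>(real i + 1) * r\<rceil> / (real i + 1)" for i and r :: real
  define s where "s i x = (if h x \<le> real i then g (d i (h x)) else 0)" for i x
  have d: "r \<le> d i r" "d i r \<le> r + 1 / (real i + 1)" for i r
  proof -
    have i: "0 < real i + 1" by simp
    show "r \<le> d i r"
      unfolding d_def pos_le_divide_eq[OF i] mult.commute[of r] by (rule le_of_int_ceiling)
    have "(r + 1 / (real i + 1)) * (real i + 1) = (real i + 1) * r + 1"
      using i by (simp add: field_simps)
    then show "d i r \<le> r + 1 / (real i + 1)"
      unfolding d_def pos_divide_le_eq[OF i] by simp
  qed
  have w0: "0 \<le> w r" if "0 \<le> r" for r by (rule order_trans[OF norm_ge_zero gw[OF that]])
  have meas: "(\<lambda>x. g (h x)) \<in> borel_measurable M"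
  proof -
    have "continuous_on UNIV (\<lambda>r. g (max 0 r))"
      by (rule continuous_on_compose2[OF g]) (auto intro: continuous_on_max)
    then have "(\<lambda>r. g (max 0 r)) \<in> borel_measurable borel" by (rule borel_measurable_continuous_onI)
    from measurable_compose[OF h this] show ?thesis by (simp only: max_absorb2[OF h0])
  qed
  have simple: "simple_function M (s i)" for i
  proof -
    define k where "k x = (if h x \<le> real i then \<lceil>(real i + 1) * h x\<rceil> else -1)" for x
    have "k x \<in> {-1..\<lceil>(real i + 1) * real i\<rceil>}" for x
    proof (cases "h x \<le> real i")
      case True
      then have "\<lceil>(real i + 1) * h x\<rceil> \<le> \<lceil>(real i + 1) * real i\<rceil>"
        by (intro ceiling_mono mult_left_mono) auto
      moreover have "0 \<le> (real i + 1) * h x" using h0[of x] by simp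
      then have "-1 \<le> \<lceil>(real i + 1) * h x\<rceil>" by linarith
      ultimately show ?thesis using True unfolding k_def by simp
    next
      case False
      have "0 \<le> (real i + 1) * real i" by simp
      then have "-1 \<le> \<lceil>(real i + 1) * real i\<rceil>" by linarith
      then show ?thesis using False unfolding k_def by simp
    qed
    then have "k ` space M \<subseteq> {-1..\<lceil>(real i + 1) * real i\<rceil>}" by blast
    then have "finite (k ` space M)" by (rule finite_subset) simp
    moreover have "k \<in> measurable M (count_space UNIV)" unfolding k_def by measurable
    ultimately have "simple_function M k"
      unfolding simple_function_def by (intro conjI ballI measurable_sets[of k M "count_space UNIV"]) simp_all
    then have "simple_function M (\<lambda>x. (if k x = -1 then 0 else g (of_int (k x) / (real i + 1))))"
      by (rule simple_function_compose1)
    moreover have "(if k x = -1 then 0 else g (of_int (k x) / (real i + 1))) = s i x" for x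
    proof -
      have "0 \<le> (real i + 1) * h x" using h0[of x] by simp
      then have "\<lceil>(real i + 1) * h x\<rceil> \<noteq> -1" by linarith
      then show ?thesis by (cases "h x \<le> real i") (simp_all only: k_def s_def d_def if_True if_False simp_thms)
    qed
    ultimately show ?thesis by simp
  qed
  have sw: "norm (s i x) \<le> w (h x)" for i x
  proof (cases "h x \<le> real i")
    case True
    have "0 \<le> d i (h x)" using d(1)[of "h x" i] h0[of x] by linarith
    then have "norm (g (d i (h x))) \<le> w (d i (h x))" by (rule gw)
    also have "\<dots> \<le> w (h x)" by (rule w[OF h0 d(1)])
    finally show ?thesis using True by (simp add: s_def)
  next
    case False
    then show ?thesis using w0[OF h0] by (simp add: s_def)
  qed
  have s: "Bochner_Integration.simple_bochner_integrable M (s i)" for i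
  proof (rule simple_bochner_integrableI_bounded[OF simple])
    have "(\<integral>\<^sup>+x. norm (s i x) \<partial>M) \<le> (\<integral>\<^sup>+x. ennreal (w (h x)) \<partial>M)"
      by (intro nn_integral_mono ennreal_leI sw)
    then show "(\<integral>\<^sup>+x. norm (s i x) \<partial>M) < \<infinity>" using fin by (rule le_less_trans)
  qed
  have "(\<lambda>i. \<integral>\<^sup>+x. ennreal (norm (g (h x) - s i x)) \<partial>M) \<longlonglongrightarrow> (\<integral>\<^sup>+x. 0 \<partial>M)"
  proof (rule nn_integral_dominated_convergence[where w="\<lambda>x. ennreal (2 * w (h x))"])
    show "(\<lambda>x. ennreal (norm (g (h x) - s i x))) \<in> borel_measurable M" for i
      using measurable_norm_diff_simple[OF meas simple[of i]] by simp
    show "(\<integral>\<^sup>+x. ennreal (2 * w (h x)) \<partial>M) < \<infinity>"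
    proof -
      have "(\<integral>\<^sup>+x. ennreal (2 * w (h x)) \<partial>M) = (\<integral>\<^sup>+x. ennreal 2 * ennreal (w (h x)) \<partial>M)"
        by (intro nn_integral_cong ennreal_mult w0 h0) simp
      also have "\<dots> = ennreal 2 * (\<integral>\<^sup>+x. ennreal (w (h x)) \<partial>M)"
        using wm by (intro nn_integral_cmult) simp
      also have "\<dots> < \<infinity>" using fin by (simp add: ennreal_mult_less_top)
      finally show ?thesis .
    qed
    show "AE x in M. ennreal (norm (g (h x) - s i x)) \<le> ennreal (2 * w (h x))" for i
    proof (intro AE_I2 ennreal_leI)
      show "norm (g (h x) - s i x) \<le> 2 * w (h x)" for x
        using norm_triangle_ineq4[of "g (h x)" "s i x"] gw[OF h0, of x] sw[of i x] by linarith
    qed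
    show "AE x in M. (\<lambda>i. ennreal (norm (g (h x) - s i x))) \<longlonglongrightarrow> 0"
    proof (rule AE_I2)
      fix x
      have "(\<lambda>i. d i (h x)) \<longlonglongrightarrow> h x"
      proof (rule tendsto_sandwich[OF _ _ tendsto_const])
        show "(\<lambda>i. h x + 1 / (real i + 1)) \<longlonglongrightarrow> h x" using tendsto_add[OF tendsto_const one_over_Suc_tendsto, of "h x"] by simp
      qed (simp_all only: d eventually_True)
      then have "(\<lambda>i. g (d i (h x))) \<longlonglongrightarrow> g (h x)"
      proof (rule continuous_on_tendsto_compose[OF g])
        have "0 \<le> d i (h x)" for i using d(1)[of "h x" i] h0[of x] by linarith
        then show "\<forall>\<^sub>F i in sequentially. d i (h x) \<in> {0..}" by simp
      qed (use h0 in simp)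
      moreover have "eventually (\<lambda>i. s i x = g (d i (h x))) sequentially"
      proof -
        obtain N where "h x \<le> real N" using real_arch_simple by blast
        show ?thesis using eventually_ge_at_top[of N]
        proof eventually_elim
          case (elim i)
          then have "h x \<le> real i" using \<open>h x \<le> real N\<close> by linarith
          then show ?case by (simp add: s_def)
        qed
      qed
      ultimately have "(\<lambda>i. s i x) \<longlonglongrightarrow> g (h x)" by (subst tendsto_cong) assumption+
      then have "(\<lambda>i. norm (g (h x) - s i x)) \<longlonglongrightarrow> norm (g (h x) - g (h x))"
        by (intro tendsto_intros)
      from tendsto_ennrealI[OF this] show "(\<lambda>i. ennreal (norm (g (h x) - s i x))) \<longlonglongrightarrow> 0"
        by simp
    qed
  qed (use wm in simp_all)
  then show ?thesis
    using strong_bochner_integrableI_sequence[OF meas s] by simp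
qed

section \<open>The scalar integral\<close>

lemma norm_sq_nonneg: "0 \<le> norm_sq m q"
  by (simp add: norm_sq_def sum_nonneg)

lemma sets_lebesgue_Rn [measurable_cong]: "sets (lebesgue_Rn m) = sets (\<Pi>\<^sub>M i\<in>{..<m}. borel)"
  unfolding lebesgue_Rn_def by (rule sets_PiM_cong) auto

lemma norm_sq_measurable [measurable]: "norm_sq m \<in> borel_measurable (lebesgue_Rn m)"
  unfolding norm_sq_def[abs_def] by measurable

lemma sigma_finite_lebesgue_Rn: "sigma_finite_measure (lebesgue_Rn m)"
proof -
  interpret product_sigma_finite "\<lambda>_::nat. lborel :: real measure"
    by standard
  show ?thesis unfolding lebesgue_Rn_def by (rule sigma_finite) simp
qed

lemma gaussian_nn_integral:
  assumes u: "u > 0"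
  shows "(\<integral>\<^sup>+y. ennreal (exp (- u * y\<^sup>2)) \<partial>lborel) = ennreal (sqrt (pi / u))"
proof -
  define \<sigma> where "\<sigma> = sqrt (1 / (2 * u))"
  have \<sigma>: "\<sigma> > 0" "\<sigma>\<^sup>2 = 1 / (2 * u)" using u by (auto simp: \<sigma>_def)
  have "exp (- u * y\<^sup>2) = sqrt (pi / u) * normal_density 0 \<sigma> y" for y
    using u \<sigma> by (simp add: normal_density_def)
  then have "(\<integral>\<^sup>+y. ennreal (exp (- u * y\<^sup>2)) \<partial>lborel) = (\<integral>\<^sup>+y. ennreal (sqrt (pi / u)) * ennreal (normal_density 0 \<sigma> y) \<partial>lborel)"
    using u by (simp add: ennreal_mult)
  also have "\<dots> = ennreal (sqrt (pi / u)) * (\<integral>\<^sup>+y. ennreal (normal_density 0 \<sigma> y) \<partial>lborel)"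
    by (intro nn_integral_cmult) auto
  also have "(\<integral>\<^sup>+y. ennreal (normal_density 0 \<sigma> y) \<partial>lborel) = 1"
    using \<sigma> by (subst nn_integral_eq_integral) (auto simp: integrable_normal_density integral_normal_density)
  finally show ?thesis by simp
qed

lemma gaussian_nn_integral_Rn:
  assumes u: "u > 0"
  shows "(\<integral>\<^sup>+q. ennreal (exp (- u * norm_sq m q)) \<partial>lebesgue_Rn m) = ennreal ((pi / u) powr (real m / 2))"
proof -
  interpret product_sigma_finite "\<lambda>_::nat. lborel :: real measure"
    by standard
  have "(\<integral>\<^sup>+q. ennreal (exp (- u * norm_sq m q)) \<partial>lebesgue_Rn m) =
      (\<integral>\<^sup>+q. (\<Prod>i\<in>{..<m}. ennreal (exp (- u * (q i)\<^sup>2))) \<partial>(\<Pi>\<^sub>M i\<in>{..<m}. lborel))"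
    unfolding lebesgue_Rn_def norm_sq_def
    by (intro nn_integral_cong) (simp add: prod_ennreal sum_distrib_left sum_negf flip: exp_sum)
  also have "\<dots> = (\<Prod>i\<in>{..<m}. \<integral>\<^sup>+y. ennreal (exp (- u * y\<^sup>2)) \<partial>lborel)"
    by (rule product_nn_integral_prod) auto
  also have "\<dots> = ennreal (sqrt (pi / u) ^ m)"
    unfolding gaussian_nn_integral[OF u] using u by (simp add: ennreal_power)
  also have "sqrt (pi / u) ^ m = (pi / u) powr (real m / 2)"
    using u by (simp add: powr_half_sqrt[symmetric] powr_powr flip: powr_realpow)
  finally show ?thesis .
qed

lemma Gamma_nn_integral_scaled:
  assumes a: "a > 0" and s: "s > (0::real)"
  shows "(\<integral>\<^sup>+u. ennreal (indicator {0..} u * u powr (s - 1) * exp (- a * u)) \<partial>lborel) = ennreal (Gamma s * a powr (- s))"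
proof -
  have G: "Gamma s > 0" using s by (rule Gamma_real_pos)
  have "ennreal (Gamma s) = (\<integral>\<^sup>+t. ennreal (indicator {0..} t * t powr (s - 1) / exp t) \<partial>lborel)"
    by (rule Gamma_conv_nn_integral_real[OF s])
  also have "\<dots> = ennreal a * (\<integral>\<^sup>+u. ennreal (indicator {0..} (0 + a * u) * (0 + a * u) powr (s - 1) / exp (0 + a * u)) \<partial>lborel)"
    using a by (subst nn_integral_real_affine[where c=a and t=0]) auto
  also have "(\<lambda>u. ennreal (indicator {0..} (0 + a * u) * (0 + a * u) powr (s - 1) / exp (0 + a * u))) =
      (\<lambda>u. ennreal (a powr (s - 1)) * ennreal (indicator {0..} u * u powr (s - 1) * exp (- a * u)))"
    using a by (auto simp: fun_eq_iff indicator_def powr_mult zero_le_mult_iff exp_minus field_simps simp flip: ennreal_mult)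
  also have "(\<integral>\<^sup>+u. ennreal (a powr (s - 1)) * ennreal (indicator {0..} u * u powr (s - 1) * exp (- a * u)) \<partial>lborel)
      = ennreal (a powr (s - 1)) * (\<integral>\<^sup>+u. ennreal (indicator {0..} u * u powr (s - 1) * exp (- a * u)) \<partial>lborel)"
    by (intro nn_integral_cmult) auto
  finally have "ennreal (Gamma s) = ennreal (a powr s) * (\<integral>\<^sup>+u. ennreal (indicator {0..} u * u powr (s - 1) * exp (- a * u)) \<partial>lborel)"
    using a by (simp add: mult.assoc[symmetric] ennreal_mult[symmetric] powr_mult_base)
  then have "ennreal (a powr (- s)) * ennreal (Gamma s) = (ennreal (a powr (- s)) * ennreal (a powr s)) * (\<integral>\<^sup>+u. ennreal (indicator {0..} u * u powr (s - 1) * exp (- a * u)) \<partial>lborel)"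
    by (simp add: mult.assoc)
  also have "ennreal (a powr (- s)) * ennreal (a powr s) = 1"
    using a by (simp add: ennreal_mult[symmetric] powr_add[symmetric])
  finally show ?thesis using G by (simp add: ennreal_mult mult.commute)
qed

text \<open>
  Write \<open>\<Gamma>(s) (t + |q|\<^sup>2)\<^sup>-\<^sup>s\<close> as \<open>\<integral> u\<^sup>s\<^sup>-\<^sup>1 exp (- (t + |q|\<^sup>2) u) du\<close> and integrate over \<open>q\<close> first. The Gaussian integral
  contributes \<open>(\<pi> / u)\<^sup>m\<^sup>/\<^sup>2\<close>, which lowers the exponent \<open>s\<close> by \<open>m/2\<close> in the remaining Gamma integral.
\<close>

theorem multiplier_scalar_integral:
  assumes t: "t > 0" and s: "s > real m / 2"
  shows "(\<integral>\<^sup>+q. ennreal ((t + norm_sq m q) powr (- s)) \<partial>lebesgue_Rn m) =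
    ennreal (pi powr (real m / 2) * (Gamma (s - real m / 2) / Gamma s) * t powr (real m / 2 - s))"
proof -
  have s0: "s > 0" using s by (smt (verit) divide_nonneg_pos of_nat_0_le_iff)
  have s': "s - real m / 2 > 0" using s by simp
  have G: "Gamma s > 0" "Gamma (s - real m / 2) > 0" using s s0 by (auto intro: Gamma_real_pos)
  interpret R: sigma_finite_measure "lebesgue_Rn m" by (rule sigma_finite_lebesgue_Rn)
  interpret P: pair_sigma_finite "lborel :: real measure" "lebesgue_Rn m" ..
  let ?f = "\<lambda>u q. ennreal (indicator {0..} u * u powr (s - 1) * exp (- (t + norm_sq m q) * u))"
  have "ennreal (Gamma s) * (\<integral>\<^sup>+q. ennreal ((t + norm_sq m q) powr (- s)) \<partial>lebesgue_Rn m)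
     = (\<integral>\<^sup>+q. ennreal (Gamma s * (t + norm_sq m q) powr (- s)) \<partial>lebesgue_Rn m)"
    using G by (subst nn_integral_cmult[symmetric]) (auto simp: ennreal_mult)
  also have "\<dots> = (\<integral>\<^sup>+q. \<integral>\<^sup>+u. ?f u q \<partial>lborel \<partial>lebesgue_Rn m)"
    using t norm_sq_nonneg[of m] by (intro nn_integral_cong Gamma_nn_integral_scaled[symmetric] s0) (simp add: add_pos_nonneg)
  also have "\<dots> = (\<integral>\<^sup>+u. \<integral>\<^sup>+q. ?f u q \<partial>lebesgue_Rn m \<partial>lborel)"
    by (rule P.Fubini') measurable
  also have "\<dots> = (\<integral>\<^sup>+u. ennreal (pi powr (real m / 2)) * ennreal (indicator {0..} u * u powr ((s - real m / 2) - 1) * exp (- t * u)) \<partial>lborel)"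
  proof (rule nn_integral_cong_AE)
    have "AE u in lborel. u \<noteq> (0::real)" by (rule AE_lborel_singleton)
    then show "AE u in lborel. (\<integral>\<^sup>+q. ?f u q \<partial>lebesgue_Rn m) =
        ennreal (pi powr (real m / 2)) * ennreal (indicator {0..} u * u powr ((s - real m / 2) - 1) * exp (- t * u))"
    proof eventually_elim
      case (elim u)
      show ?case
      proof (cases "u > 0")
        case False
        then show ?thesis using elim by (simp add: indicator_def)
      next
        case u: True
        have "(\<integral>\<^sup>+q. ?f u q \<partial>lebesgue_Rn m) = (\<integral>\<^sup>+q. ennreal (u powr (s - 1) * exp (- t * u)) * ennreal (exp (- u * norm_sq m q)) \<partial>lebesgue_Rn m)"
          using u by (intro nn_integral_cong) (simp add: ennreal_mult[symmetric] algebra_simps flip: exp_add)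
        also have "\<dots> = ennreal (u powr (s - 1) * exp (- t * u)) * ennreal ((pi / u) powr (real m / 2))"
          unfolding gaussian_nn_integral_Rn[OF u, symmetric] by (rule nn_integral_cmult) measurable
        also have "\<dots> = ennreal (pi powr (real m / 2) * (u powr ((s - real m / 2) - 1) * exp (- t * u)))"
        proof -
          have "u powr (s - 1) / u powr (real m / 2) = u powr ((s - real m / 2) - 1)"
            by (simp add: powr_diff[symmetric] algebra_simps)
          moreover have "(u powr (s - 1) * exp (- t * u)) * (pi / u) powr (real m / 2) =
              pi powr (real m / 2) * ((u powr (s - 1) / u powr (real m / 2)) * exp (- t * u))"
            using u by (simp add: powr_divide)
          ultimately show ?thesis by (simp only: ennreal_mult[symmetric] powr_ge_zero exp_ge_zero mult_nonneg_nonneg)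
        qed
        finally show ?thesis using u by (simp add: ennreal_mult)
      qed
    qed
  qed
  also have "\<dots> = ennreal (pi powr (real m / 2)) * ennreal (Gamma (s - real m / 2) * t powr (- (s - real m / 2)))"
    unfolding Gamma_nn_integral_scaled[OF t s', symmetric] by (rule nn_integral_cmult) measurable
  finally have eq: "ennreal (Gamma s) * (\<integral>\<^sup>+q. ennreal ((t + norm_sq m q) powr (- s)) \<partial>lebesgue_Rn m)
    = ennreal (pi powr (real m / 2) * (Gamma (s - real m / 2) * t powr (real m / 2 - s)))"
    using G by (simp add: ennreal_mult)
  have "(\<integral>\<^sup>+q. ennreal ((t + norm_sq m q) powr (- s)) \<partial>lebesgue_Rn m) =
    ennreal (1 / Gamma s) * (ennreal (Gamma s) * (\<integral>\<^sup>+q. ennreal ((t + norm_sq m q) powr (- s)) \<partial>lebesgue_Rn m))"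
    using G by (simp add: mult.assoc[symmetric] ennreal_mult[symmetric])
  also have "\<dots> = ennreal (1 / Gamma s * (pi powr (real m / 2) * (Gamma (s - real m / 2) * t powr (real m / 2 - s))))"
    unfolding eq using G by (subst ennreal_mult) auto
  finally show ?thesis by (simp add: mult_ac)
qed

section \<open>Functions of a strictly positive operator\<close>

lemma bounded_op_Some: "bounded_op (\<lambda>x. Some (blinfun_apply B x)) = B"
  unfolding bounded_op_def by (rule the_equality) (auto intro: blinfun_eqI)

context spectral_pair
begin

text \<open>
  Functions that agree from \<open>l\<close> on have the same integral, because the spectral measure has no mass below \<open>l\<close>.
\<close>

lemma is_spectral_integral_calc:
  assumes f: "f \<in> borel_measurable borel" and g: "g \<in> bborel" and fg: "\<And>t. l \<le> t \<Longrightarrow> f t = g t"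
  shows "is_spectral_integral E f (\<lambda>x. Some (calc g x))"
proof -
  have AE: "AE t in mu x. f t = g t" for x using spectral_gap[of x] by eventually_elim (rule fg)
  have sq: "(\<integral>\<^sup>+t. ennreal ((f t)\<^sup>2) \<partial>mu x) < \<infinity>" for x
  proof -
    have "(\<integral>\<^sup>+t. ennreal ((f t)\<^sup>2) \<partial>mu x) = (\<integral>\<^sup>+t. ennreal (g t * g t) \<partial>mu x)"
      using AE[of x] by (intro nn_integral_cong_AE) (auto simp: power2_eq_square elim: eventually_mono)
    also have "\<dots> = ennreal (\<integral>t. g t * g t \<partial>mu x)"
      by (intro nn_integral_eq_integral integrable_mu bborel_mult g) simp
    finally show ?thesis by simp
  qed
  have int: "(\<integral>t. f t \<partial>mu x) = (\<integral>t. g t \<partial>mu x)" for x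
    using AE[of x] f g by (intro integral_cong_AE) auto
  show ?thesis
    unfolding is_spectral_integral_def linear_op_def
    using sq by (auto simp: blinfun.add_right calc_scaleC g int cinner_calc dom_def)
qed

lemma fun_calc_eq:
  assumes f: "f \<in> borel_measurable borel" and g: "g \<in> bborel" and fg: "\<And>t. l \<le> t \<Longrightarrow> f t = g t"
  shows "fun_calc f L = (\<lambda>x. Some (calc g x))"
  unfolding fun_calc_def spectral_measure_eq
proof (rule the_equality)
  show S: "is_spectral_integral E f (\<lambda>x. Some (calc g x))"
    by (rule is_spectral_integral_calc[OF assms])
  fix T assume T: "is_spectral_integral E f T"
  have "dom T = dom (\<lambda>x. Some (calc g x))" using S T unfolding is_spectral_integral_def by simp
  then have domT: "dom T = UNIV" by auto
  have lin: "linear_op T" using T unfolding is_spectral_integral_def by simp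
  have diag: "cinner x (app T x) = cinner x (calc g x)" for x
    using S T domT unfolding is_spectral_integral_def by auto
  have "cinner u (app T x - calc g x) = 0" for u x
  proof (rule sesquilinear_zero[where D=UNIV and b="\<lambda>u x. cinner u (app T x - calc g x)"])
    show "cinner u (app T u - calc g u) = 0" for u by (simp add: cinner_diff_right diag)
  qed (simp_all add: linear_op_add[OF lin] linear_op_scaleC[OF lin] domT blinfun.add_right calc_scaleC g
      cinner_add_left cinner_add_right cinner_scaleC_left cinner_scaleC_right cinner_diff_right algebra_simps)
  then have "app T x - calc g x = 0" for x by (intro cinner_eqI) simp
  then have "app T x = calc g x" for x by simp
  moreover have "T x \<noteq> None" for x using domT by auto
  ultimately show "T = (\<lambda>x. Some (calc g x))"
    by (intro ext) (metis option.exhaust_sel)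
qed

lemma spectral_pair_shift:
  assumes c: "c \<ge> 0"
  shows "spectral_pair (push_pvm (\<lambda>t. t + c) E) (shift_op L c) l"
proof -
  have dom: "dom (shift_op L c) = dom L" by (auto simp: shift_op_def dom_def)
  have appl: "app (shift_op L c) x = app L x + c *\<^sub>R x" if "x \<in> dom L" for x
    using that by (auto simp: shift_op_def)
  have lin: "linear_op (shift_op L c)"
    unfolding linear_op_def dom
  proof (intro conjI ballI allI)
    show "0 \<in> dom L" using linear by (simp add: linear_op_def)
    fix x assume x: "x \<in> dom L"
    show "scaleC a x \<in> dom L" for a by (rule linear_op_scaleC[OF linear x])
    show "app (shift_op L c) (scaleC a x) = scaleC a (app (shift_op L c) x)" for a
      by (simp add: appl x linear_op_scaleC[OF linear x] scaleC_add_right scaleC_scaleC mult.commute flip: scaleC_of_real)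
    fix y assume y: "y \<in> dom L"
    show "x + y \<in> dom L" by (rule linear_op_add[OF linear x y])
    show "app (shift_op L c) (x + y) = app (shift_op L c) x + app (shift_op L c) y"
      by (simp add: appl x y linear_op_add[OF linear x y] scaleR_add_right)
  qed
  have finite: "(\<integral>\<^sup>+t. ennreal ((t + c)\<^sup>2) \<partial>mu x) < \<infinity> \<longleftrightarrow> (\<integral>\<^sup>+t. ennreal (t\<^sup>2) \<partial>mu x) < \<infinity>" for x
  proof
    assume *: "(\<integral>\<^sup>+t. ennreal ((t + c)\<^sup>2) \<partial>mu x) < \<infinity>"
    have "(\<integral>\<^sup>+t. ennreal (t\<^sup>2) \<partial>mu x) \<le> (\<integral>\<^sup>+t. ennreal ((t + c)\<^sup>2) \<partial>mu x)"
    proof (rule nn_integral_mono_AE)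
      show "AE t in mu x. ennreal (t\<^sup>2) \<le> ennreal ((t + c)\<^sup>2)"
        using spectral_gap[of x] by eventually_elim (use l c in \<open>auto intro!: ennreal_leI power_mono\<close>)
    qed
    then show "(\<integral>\<^sup>+t. ennreal (t\<^sup>2) \<partial>mu x) < \<infinity>" using * by (rule le_less_trans)
  next
    assume *: "(\<integral>\<^sup>+t. ennreal (t\<^sup>2) \<partial>mu x) < \<infinity>"
    have "(\<integral>\<^sup>+t. ennreal ((t + c)\<^sup>2) \<partial>mu x) \<le> (\<integral>\<^sup>+t. ennreal (2 * t\<^sup>2) + ennreal (2 * c\<^sup>2) \<partial>mu x)"
    proof (rule nn_integral_mono)
      fix t
      have "(t + c)\<^sup>2 \<le> 2 * t\<^sup>2 + 2 * c\<^sup>2"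
        using zero_le_power2[of "t - c"] by (simp add: power2_eq_square algebra_simps)
      then have "ennreal ((t + c)\<^sup>2) \<le> ennreal (2 * t\<^sup>2 + 2 * c\<^sup>2)" by (rule ennreal_leI)
      also have "\<dots> = ennreal (2 * t\<^sup>2) + ennreal (2 * c\<^sup>2)" by (rule ennreal_plus) auto
      finally show "ennreal ((t + c)\<^sup>2) \<le> ennreal (2 * t\<^sup>2) + ennreal (2 * c\<^sup>2)" .
    qed
    also have "\<dots> = ennreal 2 * (\<integral>\<^sup>+t. ennreal (t\<^sup>2) \<partial>mu x) + (\<integral>\<^sup>+t. ennreal (2 * c\<^sup>2) \<partial>mu x)"
      by (subst nn_integral_add) (auto simp: nn_integral_cmult ennreal_mult')
    also have "\<dots> < \<infinity>"
      using * finite_measure.emeasure_finite[OF finite_measure_mu, of x UNIV]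
      by (simp add: ennreal_mult_less_top less_top)
    finally show "(\<integral>\<^sup>+t. ennreal ((t + c)\<^sup>2) \<partial>mu x) < \<infinity>" .
  qed
  have "is_spectral_integral E (\<lambda>t. t + c) (shift_op L c)"
    unfolding is_spectral_integral_def dom finite
  proof (intro conjI lin ballI)
    show "dom L = {x. (\<integral>\<^sup>+t. ennreal (t\<^sup>2) \<partial>mu x) < \<infinity>}" using dom_iff by blast
    fix x assume x: "x \<in> dom L"
    have int: "integrable (mu x) (\<lambda>t. t)"
    proof (rule Bochner_Integration.integrable_bound)
      have "integrable (mu x) (\<lambda>t. t\<^sup>2)"
        using x by (intro integrableI_nonneg) (auto simp: dom_iff)
      then show "integrable (mu x) (\<lambda>t. 1 + t\<^sup>2)"
        by (intro Bochner_Integration.integrable_add finite_measure.integrable_const[OF finite_measure_mu])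
      have "\<bar>t\<bar> \<le> 1 + t\<^sup>2" for t :: real
      proof -
        have "0 \<le> (\<bar>t\<bar> - 1)\<^sup>2" by simp
        then have "2 * \<bar>t\<bar> \<le> 1 + t\<^sup>2" by (simp add: power2_eq_square algebra_simps)
        then show ?thesis by linarith
      qed
      then show "AE t in mu x. norm t \<le> norm (1 + t\<^sup>2)" by simp
    qed simp
    have "cinner x (c *\<^sub>R x) = complex_of_real (c * inner x x)"
      by (simp add: cinner_scaleC_right cinner_self flip: scaleC_of_real)
    moreover have "(\<integral>t. t + c \<partial>mu x) = (\<integral>t. t \<partial>mu x) + c * inner x x"
      using Bochner_Integration.integral_add[OF int finite_measure.integrable_const[OF finite_measure_mu, of x c]]
      by (simp add: measure_mu_UNIV mult.commute)
    ultimately show "cinner x (app (shift_op L c) x) = complex_of_real (\<integral>t. t + c \<partial>mu x)"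
      by (simp add: appl x cinner_add_right cinner_app)
  qed
  then have "is_spectral_integral (push_pvm (\<lambda>t. t + c) E) (\<lambda>t. t) (shift_op L c)"
    by (subst is_spectral_integral_push_pvm[OF pvm]) auto
  moreover have "bounded_below_op l (shift_op L c)"
    unfolding bounded_below_op_def dom Re_cinner
  proof
    fix x assume x: "x \<in> dom L"
    have "l * inner x x \<le> inner x (app L x)" using below x unfolding bounded_below_op_def Re_cinner by blast
    moreover have "0 \<le> c * inner x x" using c by simp
    ultimately show "l * inner x x \<le> inner x (app (shift_op L c) x)" by (simp add: appl x inner_add_right)
  qed
  moreover have "projection_valued_measure (push_pvm (\<lambda>t. t + c) E)"
    by (rule push_pvm[OF pvm]) auto
  ultimately show ?thesis
    using l by (simp add: spectral_pair_def spectral_pair_axioms_def pvm_def)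
qed

text \<open>
  The spectral measure of \<open>L + c\<close> is the push-forward of that of \<open>L\<close>, so all the operators \<open>(L + |q|\<^sup>2)\<^sup>-\<^sup>s\<close> are functions
  of the single operator \<open>L\<close>.
\<close>

lemma fun_calc_shift:
  assumes c: "c \<ge> 0" and f: "f \<in> borel_measurable borel"
  shows "fun_calc f (shift_op L c) = fun_calc (\<lambda>t. f (t + c)) L"
proof -
  have "is_spectral_integral (push_pvm (\<lambda>t. t + c) E) f = is_spectral_integral E (\<lambda>t. f (t + c))"
    by (rule ext, rule is_spectral_integral_push_pvm[OF pvm _ f]) measurable
  then show ?thesis
    unfolding fun_calc_def spectral_measure_eq spectral_pair.spectral_measure_eq[OF spectral_pair_shift[OF c]]
    by simp
qed

end

section \<open>The operator-valued integrand\<close>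

text \<open>
  As a function of \<open>t\<close> this is \<open>(t + c)\<^sup>a\<close> on the spectrum of an operator \<open>L \<ge> l\<close>, extended by zero to a bounded function.
\<close>

definition cut_powr :: "real \<Rightarrow> real \<Rightarrow> real \<Rightarrow> real \<Rightarrow> real" where
  "cut_powr l a c t = (if l \<le> t then (t + c) powr a else 0)"

lemma cut_powr_measurable [measurable]:
  "(\<lambda>x. cut_powr l a (f x) (g x)) \<in> borel_measurable M"
  if [measurable]: "f \<in> borel_measurable M" "g \<in> borel_measurable M"
  unfolding cut_powr_def by measurable

lemma cut_powr_nonneg: "0 \<le> cut_powr l a c t"
  by (simp add: cut_powr_def)

lemma cut_powr_le: "l > 0 \<Longrightarrow> c \<ge> 0 \<Longrightarrow> a \<le> 0 \<Longrightarrow> \<bar>cut_powr l a c t\<bar> \<le> (l + c) powr a"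
  by (simp add: cut_powr_def powr_mono2')

lemma cut_powr_bborel: "l > 0 \<Longrightarrow> c \<ge> 0 \<Longrightarrow> a \<le> 0 \<Longrightarrow> cut_powr l a c \<in> bborel"
  by (rule bborelI[OF _ cut_powr_le]) auto

text \<open>
  The quotient \<open>(t + c) / (t + c')\<close> is smallest for \<open>t = l\<close> and \<open>c = 0\<close> at a given difference \<open>c' - c\<close>. The bound does
  not depend on \<open>t\<close>, so it controls the operator norm.
\<close>

lemma powr_shift_diff:
  fixes a l t c c' :: real
  assumes "0 < l" "l \<le> t" "0 \<le> c" "c \<le> c'" "a \<le> 0"
  shows "0 \<le> (t + c) powr a - (t + c') powr a"
    and "(t + c) powr a - (t + c') powr a \<le> l powr a * (1 - (l / (l + (c' - c))) powr (- a))"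
proof -
  have pos: "0 < t + c" "0 < t + c'" "0 < l + (c' - c)" using assms by auto
  show "0 \<le> (t + c) powr a - (t + c') powr a"
    using assms pos by (simp add: powr_mono2')
  have "l * (t + c') \<le> (t + c) * (l + (c' - c))"
  proof -
    have "l * (c' - c) \<le> (t + c) * (c' - c)" using assms by (intro mult_right_mono) auto
    then show ?thesis by (simp add: algebra_simps)
  qed
  then have "l / (l + (c' - c)) \<le> (t + c) / (t + c')"
    using pos by (simp add: divide_le_eq le_divide_eq mult.commute)
  then have le: "(l / (l + (c' - c))) powr (- a) \<le> ((t + c) / (t + c')) powr (- a)"
    using assms pos by (intro powr_mono2) auto
  have "((t + c) / (t + c')) powr (- a) \<le> 1"
    using assms pos by (intro powr_le1) (auto simp: divide_le_eq)
  have "(t + c) powr a * ((t + c) / (t + c')) powr (- a) = (t + c') powr a"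
    using pos by (simp add: powr_divide powr_minus field_simps)
  then have "(t + c) powr a - (t + c') powr a = (t + c) powr a * (1 - ((t + c) / (t + c')) powr (- a))"
    by (simp add: right_diff_distrib)
  also have "\<dots> \<le> l powr a * (1 - (l / (l + (c' - c))) powr (- a))"
    using assms pos le \<open>((t + c) / (t + c')) powr (- a) \<le> 1\<close> by (intro mult_mono powr_mono2') auto
  finally show "(t + c) powr a - (t + c') powr a \<le> l powr a * (1 - (l / (l + (c' - c))) powr (- a))" .
qed

context spectral_pair
begin

lemma continuous_shifted_power:
  assumes a: "a \<le> 0"
  shows "continuous_on {0..} (\<lambda>c. calc (cut_powr l a c))"
proof -
  define \<omega> where "\<omega> d = l powr a * (1 - (l / (l + d)) powr (- a))" for d
  have \<omega>0: "0 \<le> \<omega> d" if "0 \<le> d" for d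
  proof -
    have "(l / (l + d)) powr (- a) \<le> 1" using that l a by (intro powr_le1) (auto simp: divide_le_eq)
    then show ?thesis by (simp add: \<omega>_def)
  qed
  have 1: "\<bar>cut_powr l a c t - cut_powr l a c' t\<bar> \<le> \<omega> (c' - c)" if "0 \<le> c" "c \<le> c'" for c c' t
    using powr_shift_diff[OF l _ that a, of t] \<omega>0[of "c' - c"] that by (auto simp: cut_powr_def \<omega>_def)
  have 2: "\<bar>cut_powr l a c t - cut_powr l a c' t\<bar> \<le> \<omega> \<bar>c - c'\<bar>" if "0 \<le> c" "0 \<le> c'" for c c' t
  proof (cases "c \<le> c'")
    case True
    then show ?thesis using 1[OF that(1) True, of t] by simp
  next
    case False
    then show ?thesis using 1[OF that(2), of c t] by (simp add: abs_minus_commute)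
  qed
  have 3: "norm (calc (cut_powr l a c) - calc (cut_powr l a c')) \<le> \<omega> \<bar>c - c'\<bar>" if "0 \<le> c" "0 \<le> c'" for c c'
    using that 2 by (intro norm_calc_diff_le cut_powr_bborel l a) auto
  show ?thesis
    unfolding continuous_on_def
  proof
    fix c :: real assume c: "c \<in> {0..}"
    have "((\<lambda>r. calc (cut_powr l a r) - calc (cut_powr l a c)) \<longlongrightarrow> 0) (at c within {0..})"
    proof (rule Lim_null_comparison)
      show "eventually (\<lambda>r. norm (calc (cut_powr l a r) - calc (cut_powr l a c)) \<le> \<omega> \<bar>r - c\<bar>) (at c within {0..})"
        using c 3 by (auto simp: eventually_at_filter)
      have "((\<lambda>r. \<omega> \<bar>r - c\<bar>) \<longlongrightarrow> l powr a * (1 - (l / (l + \<bar>c - c\<bar>)) powr (- a))) (at c within {0..})"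
        unfolding \<omega>_def using l by (intro tendsto_intros) auto
      then show "((\<lambda>r. \<omega> \<bar>r - c\<bar>) \<longlongrightarrow> 0) (at c within {0..})" using l by simp
    qed
    then show "((\<lambda>r. calc (cut_powr l a r)) \<longlongrightarrow> calc (cut_powr l a c)) (at c within {0..})"
      by (rule LIM_zero_cancel)
  qed
qed

lemma bounded_op_powr:
  assumes c: "c \<ge> 0" and a: "a \<le> 0"
  shows "bounded_op (op_powr (shift_op L c) a) = calc (cut_powr l a c)"
proof -
  have "fun_calc (\<lambda>t. t powr a) (shift_op L c) = fun_calc (\<lambda>t. (t + c) powr a) L"
    by (rule fun_calc_shift[OF c]) measurable
  also have "\<dots> = (\<lambda>x. Some (calc (cut_powr l a c) x))"
    by (rule fun_calc_eq) (use c a l in \<open>auto intro: cut_powr_bborel simp: cut_powr_def\<close>)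
  finally show ?thesis by (simp add: op_powr_def bounded_op_Some)
qed

lemma shift_op_zero: "shift_op L 0 = L"
  by (rule ext) (simp add: shift_op_def option.map_ident)

lemma multiplier_integrand_eq:
  assumes "s \<ge> 0"
  shows "multiplier_integrand m s L = (\<lambda>q. calc (cut_powr l (- s) (norm_sq m q)))"
  using assms by (intro ext) (simp add: multiplier_integrand_def bounded_op_powr norm_sq_nonneg)

text \<open>
  The integrand is a norm-continuous function of \<open>|q|\<^sup>2\<close> with norm at most \<open>(l + |q|\<^sup>2)\<^sup>-\<^sup>s\<close>, whose integral is
  finite by the scalar formula at \<open>t = l\<close>.
\<close>

lemma integrand_integrable:
  assumes s: "s > real m / 2"
  shows "strong_bochner_integrable (lebesgue_Rn m) (multiplier_integrand m s L)"
proof -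
  have s0: "s \<ge> 0" using s by (meson divide_nonneg_pos less_imp_le of_nat_0_le_iff order_trans zero_less_numeral)
  show ?thesis
    unfolding multiplier_integrand_eq[OF s0]
  proof (rule strong_bochner_integrable_compose_continuous[where w="\<lambda>r. (l + r) powr (- s)"])
    show "continuous_on {0..} (\<lambda>c. calc (cut_powr l (- s) c))" using s0 by (intro continuous_shifted_power) simp
    show "norm (calc (cut_powr l (- s) r)) \<le> (l + r) powr (- s)" if "0 \<le> r" for r
      using that s0 l by (intro norm_calc_le cut_powr_bborel cut_powr_le) auto
    show "(l + r') powr (- s) \<le> (l + r) powr (- s)" if "0 \<le> r" "r \<le> r'" for r r'
      using that s0 l by (intro powr_mono2') auto
    show "(\<integral>\<^sup>+q. ennreal ((l + norm_sq m q) powr (- s)) \<partial>lebesgue_Rn m) < \<infinity>"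
      unfolding multiplier_scalar_integral[OF l s] by simp
  qed (auto simp: norm_sq_nonneg)
qed

text \<open>
  Both sides are symmetric, so it suffices to compare quadratic forms. That of the integral at \<open>x\<close> is
  the double integral of \<open>(t + |q|\<^sup>2)\<^sup>-\<^sup>s\<close> over \<open>q\<close> and \<open>\<mu>\<^sub>x\<close>; after interchanging the integrals the scalar formula
  applies for every \<open>t\<close> in the spectrum.
\<close>

lemma integrand_integral:
  assumes s: "s > real m / 2" and I: "has_strong_bochner_integral (lebesgue_Rn m) (multiplier_integrand m s L) I"
  defines "C \<equiv> pi powr (real m / 2) * (Gamma (s - real m / 2) / Gamma s)"
  shows "I = C *\<^sub>R calc (cut_powr l (real m / 2 - s) 0)"
proof -
  have s0: "s > 0" using s by (meson divide_nonneg_pos le_less_trans of_nat_0_le_iff zero_less_numeral)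
  have C: "C \<ge> 0"
    using s s0 Gamma_real_pos[of s] Gamma_real_pos[of "s - real m / 2"] by (simp add: C_def)
  define K where "K q = calc (cut_powr l (- s) (norm_sq m q))" for q
  have k: "cut_powr l (- s) (norm_sq m q) \<in> bborel" for q
    using s0 by (intro cut_powr_bborel l norm_sq_nonneg) simp
  have k0: "cut_powr l (real m / 2 - s) 0 \<in> bborel"
    using s by (intro cut_powr_bborel l) auto
  have intg: "has_bochner_integral (lebesgue_Rn m) (\<lambda>q. inner x (K q y)) (inner x (I y))" for x y
  proof -
    have "bounded_linear (\<lambda>T :: 'h \<Rightarrow>\<^sub>L 'h. inner x (T y))"
      by (intro bounded_linear_inner_right_comp blinfun.bounded_linear_left)
    from has_strong_bochner_integral_bounded_linear[OF this I] show ?thesis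
      using s0 by (simp add: multiplier_integrand_eq K_def)
  qed
  show ?thesis
  proof (rule symmetric_op_eqI)
    show "symmetric_op I"
      unfolding symmetric_op_def
    proof (intro allI)
      fix x y
      have "inner x (K q y) = inner y (K q x)" for q
        using symmetric_opD[OF calc_symmetric[OF k[of q]], of y x] by (simp add: K_def inner_commute)
      then have "inner x (I y) = inner y (I x)"
        using has_bochner_integral_integral_eq[OF intg[of x y]] has_bochner_integral_integral_eq[OF intg[of y x]] by simp
      then show "inner (I x) y = inner x (I y)" by (simp add: inner_commute)
    qed
    show "symmetric_op (C *\<^sub>R calc (cut_powr l (real m / 2 - s) 0))"
      by (intro symmetric_op_scaleR calc_symmetric k0)
    fix x
    interpret R: sigma_finite_measure "lebesgue_Rn m" by (rule sigma_finite_lebesgue_Rn)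
    interpret M: finite_measure "mu x" by (rule finite_measure_mu)
    interpret P: pair_sigma_finite "mu x" "lebesgue_Rn m" ..
    have Kx: "ennreal (inner x (K q x)) = (\<integral>\<^sup>+t. ennreal (cut_powr l (- s) (norm_sq m q) t) \<partial>mu x)" for q
      unfolding K_def inner_calc[OF k]
      by (rule nn_integral_eq_integral[symmetric]) (auto intro!: integrable_mu k simp: cut_powr_nonneg)
    have Kx0: "0 \<le> inner x (K q x)" for q
      unfolding K_def inner_calc[OF k] by (intro Bochner_Integration.integral_nonneg cut_powr_nonneg)
    have Ix: "inner x (I x) = (\<integral>q. inner x (K q x) \<partial>lebesgue_Rn m)"
      using has_bochner_integral_integral_eq[OF intg[of x x]] by simp
    then have Ix0: "0 \<le> inner x (I x)" using Kx0 by (simp add: Bochner_Integration.integral_nonneg)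
    have "ennreal (inner x (I x)) = (\<integral>\<^sup>+q. ennreal (inner x (K q x)) \<partial>lebesgue_Rn m)"
      unfolding Ix using has_bochner_integral_iff[THEN iffD1, OF intg[of x x]] Kx0
      by (intro nn_integral_eq_integral[symmetric]) auto
    also have "\<dots> = (\<integral>\<^sup>+q. \<integral>\<^sup>+t. ennreal (cut_powr l (- s) (norm_sq m q) t) \<partial>mu x \<partial>lebesgue_Rn m)"
      unfolding Kx ..
    also have "\<dots> = (\<integral>\<^sup>+t. \<integral>\<^sup>+q. ennreal (cut_powr l (- s) (norm_sq m q) t) \<partial>lebesgue_Rn m \<partial>mu x)"
      by (rule P.Fubini') measurable
    also have "\<dots> = (\<integral>\<^sup>+t. ennreal (C * cut_powr l (real m / 2 - s) 0 t) \<partial>mu x)"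
    proof (rule nn_integral_cong)
      fix t
      show "(\<integral>\<^sup>+q. ennreal (cut_powr l (- s) (norm_sq m q) t) \<partial>lebesgue_Rn m) = ennreal (C * cut_powr l (real m / 2 - s) 0 t)"
      proof (cases "l \<le> t")
        case True
        then have "t > 0" using l by simp
        from multiplier_scalar_integral[OF this s] show ?thesis using True by (simp add: cut_powr_def C_def)
      qed (simp add: cut_powr_def)
    qed
    also have "\<dots> = ennreal (\<integral>t. C * cut_powr l (real m / 2 - s) 0 t \<partial>mu x)"
      using integrable_mu[OF k0, of x] C by (intro nn_integral_eq_integral) (auto simp: cut_powr_nonneg)
    also have "(\<integral>t. C * cut_powr l (real m / 2 - s) 0 t \<partial>mu x) = C * inner x (calc (cut_powr l (real m / 2 - s) 0) x)"
      using inner_calc[OF k0, of x] by simp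
    finally have "ennreal (inner x (I x)) = ennreal (C * inner x (calc (cut_powr l (real m / 2 - s) 0) x))" .
    moreover have "0 \<le> C * inner x (calc (cut_powr l (real m / 2 - s) 0) x)"
      unfolding inner_calc[OF k0] using C by (intro mult_nonneg_nonneg Bochner_Integration.integral_nonneg cut_powr_nonneg)
    ultimately have "inner x (I x) = C * inner x (calc (cut_powr l (real m / 2 - s) 0) x)"
      using Ix0 by simp
    then show "inner x (I x) = inner x ((C *\<^sub>R calc (cut_powr l (real m / 2 - s) 0)) x)"
      by (simp add: blinfun.scaleR_left)
  qed
qed

lemma reduced_multiplier_calc:
  assumes s: "s > real m / 2"
  shows "reduced_multiplier m s L = multiplier_const m s *\<^sub>R calc (cut_powr l (real m / 2 - s) 0)"
proof -
  let ?C = "pi powr (real m / 2) * (Gamma (s - real m / 2) / Gamma s)"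
  obtain I where I: "has_strong_bochner_integral (lebesgue_Rn m) (multiplier_integrand m s L) I"
    using integrand_integrable[OF s] unfolding strong_bochner_integrable_def by blast
  have "strong_bochner_integral (lebesgue_Rn m) (multiplier_integrand m s L) = I"
    unfolding strong_bochner_integral_def
  proof (rule the_equality[where P="has_strong_bochner_integral (lebesgue_Rn m) (multiplier_integrand m s L)", OF I])
    fix J assume "has_strong_bochner_integral (lebesgue_Rn m) (multiplier_integrand m s L) J"
    from integrand_integral[OF s this] show "J = I" using integrand_integral[OF s I] by simp
  qed
  then have "reduced_multiplier m s L = (1 / (2 * pi) ^ m * ?C) *\<^sub>R calc (cut_powr l (real m / 2 - s) 0)"
    using integrand_integral[OF s I] by (simp add: reduced_multiplier_def)
  also have "1 / (2 * pi) ^ m * ?C = multiplier_const m s"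
  proof -
    have "(2 * pi) ^ m = (2 * pi) powr real m" by (rule powr_realpow[symmetric]) simp
    also have "\<dots> = ((2 * pi) powr 2) powr (real m / 2)" unfolding powr_powr by simp
    also have "(2 * pi) powr 2 = (4 * pi) * pi" by (simp add: power2_eq_square)
    also have "((4 * pi) * pi) powr (real m / 2) = (4 * pi) powr (real m / 2) * pi powr (real m / 2)"
      by (rule powr_mult)
    finally show ?thesis by (simp add: multiplier_const_def)
  qed
  finally show ?thesis .
qed

lemma reduced_multiplier_eq:
  assumes s: "s > real m / 2"
  shows "reduced_multiplier m s L = multiplier_const m s *\<^sub>R bounded_op (op_powr L (real m / 2 - s))"
  using reduced_multiplier_calc[OF s] bounded_op_powr[of 0 "real m / 2 - s"] s by (simp add: shift_op_zero)

lemma fun_calc_multiplier: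
  assumes s: "s > real m / 2"
  shows "fun_calc (\<lambda>t. multiplier_const m s * t powr (real m / 2 - s)) L = (\<lambda>x. Some (reduced_multiplier m s L x))"
proof -
  let ?k = "cut_powr l (real m / 2 - s) 0"
  have k: "?k \<in> bborel" using s by (intro cut_powr_bborel l) auto
  have "(\<lambda>t. multiplier_const m s * ?k t + 0) \<in> bborel" by (intro bborel_lin k bborel_const)
  then have "fun_calc (\<lambda>t. multiplier_const m s * t powr (real m / 2 - s)) L =
      (\<lambda>x. Some (calc (\<lambda>t. multiplier_const m s * ?k t + 0) x))"
    by (intro fun_calc_eq) (auto simp: cut_powr_def)
  also have "calc (\<lambda>t. multiplier_const m s * ?k t + 0) = reduced_multiplier m s L"
  proof -
    have "calc (\<lambda>t. 0) = 0" using calc_diff[OF k k] by simp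
    then show ?thesis
      unfolding reduced_multiplier_calc[OF s] calc_lin[OF k bborel_const] by simp
  qed
  finally show ?thesis .
qed

end

section \<open>The Green power\<close>

lemma multiplier_const_s_star:
  "multiplier_const m (s_star m) = 1 / ((4 * pi) powr (real m / 2) * Gamma (1 + real m / 2))"
  by (simp add: multiplier_const_def s_star_def)

lemma multiplier_const_codimension_three:
  "(4 * pi) powr (3 / 2) * Gamma (1 + 3 / 2) = 6 * pi\<^sup>2"
proof -
  have "(3 / 2 :: real) \<notin> \<int>\<^sub>\<le>\<^sub>0" "(1 / 2 :: real) \<notin> \<int>\<^sub>\<le>\<^sub>0"
    by (auto dest: nonpos_Ints_nonpos)
  note Gamma_step = this[THEN Gamma_plus1]
  have "Gamma (1 + 3 / 2 :: real) = 3 / 2 * Gamma (3 / 2)"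
    using Gamma_step(1) by (simp only: add.commute)
  also have "Gamma (3 / 2 :: real) = 1 / 2 * sqrt pi"
    using Gamma_step(2) by (simp add: Gamma_one_half_real)
  finally have G: "Gamma (1 + 3 / 2 :: real) = 3 / 4 * sqrt pi" by simp
  have "(4 * pi) powr (3 / 2) = (4 * pi) powr (1 + 1 / 2)" by simp
  also have "\<dots> = (4 * pi) * (2 * sqrt pi)"
    by (subst powr_add) (simp add: powr_half_sqrt real_sqrt_mult)
  finally show ?thesis unfolding G by (simp add: power2_eq_square)
qed

theorem proposition4p3:
  fixes \<mu>B :: "'b measure"
    and cls :: "('b \<Rightarrow> complex) \<Rightarrow> 'h::complex_hilbert"
    and L :: "'h unb_op"
    and m :: nat and s l :: real
  assumes "L2_space \<mu>B cls"
    and "m \<ge> 1" and "s > real m / 2"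
    and "self_adjoint_op L" and "l > 0" and "bounded_below_op l L"
  shows "strong_bochner_integrable (lebesgue_Rn m) (multiplier_integrand m s L)
    \<and> reduced_multiplier m s L =
        multiplier_const m s *\<^sub>R bounded_op (op_powr L (real m / 2 - s))
    \<and> fun_calc (\<lambda>t. multiplier_const m s * t powr (real m / 2 - s)) L =
        (\<lambda>x. Some (reduced_multiplier m s L x))
    \<and> ((\<forall>t>0. t powr (real m / 2 - s) = inverse t) \<longleftrightarrow> s = s_star m)
    \<and> reduced_multiplier m (s_star m) L =
        (1 / ((4 * pi) powr (real m / 2) * Gamma (1 + real m / 2))) *\<^sub>R bounded_op (op_powr L (- 1))
    \<and> s_star 3 = 5 / 2
    \<and> reduced_multiplier 3 (5 / 2) L = (1 / (6 * pi\<^sup>2)) *\<^sub>R bounded_op (op_powr L (- 1))"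
proof -
  have "positive_self_adjoint L l" using assms by (simp add: positive_self_adjoint_def)
  then obtain E where E: "spectral_pair E L l" using positive_self_adjoint.spectral_pair_exists by blast
  interpret spectral_pair E L l by (rule E)
  have star: "reduced_multiplier n (s_star n) L =
      (1 / ((4 * pi) powr (real n / 2) * Gamma (1 + real n / 2))) *\<^sub>R bounded_op (op_powr L (- 1))" for n
    using reduced_multiplier_eq[of n "s_star n"] by (simp add: multiplier_const_s_star) (simp add: s_star_def)
  have "(\<forall>t>0. t powr (real m / 2 - s) = inverse t) \<longleftrightarrow> s = s_star m"
  proof
    assume "\<forall>t>0. t powr (real m / 2 - s) = inverse t"
    then have "2 powr (real m / 2 - s) = inverse 2" by simp
    also have "\<dots> = 2 powr (- 1 :: real)" by (simp add: powr_minus)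
    finally have "real m / 2 - s = - 1" by (simp only: powr_inj)
    then show "s = s_star m" by (simp add: s_star_def)
  next
    assume "s = s_star m"
    then have "real m / 2 - s = - 1" by (simp add: s_star_def)
    then show "\<forall>t>0. t powr (real m / 2 - s) = inverse t" by (simp add: powr_minus)
  qed
  moreover have s3: "s_star 3 = 5 / 2" by (simp add: s_star_def)
  moreover have "reduced_multiplier 3 (5 / 2) L = (1 / (6 * pi\<^sup>2)) *\<^sub>R bounded_op (op_powr L (- 1))"
    using star[of 3] multiplier_const_codimension_three by (simp add: s3)
  ultimately show ?thesis
    using integrand_integrable[OF assms(3)] reduced_multiplier_eq[OF assms(3)] fun_calc_multiplier[OF assms(3)] star[of m]
    by blast
qed

end
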